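(* Let $\lambda^\dagger=\sum_{i=1}^Nm_i\delta_{(x_i,v_i)}\in\mathcal M_+(\Lambda)$ with $m_i>0$ and distinct $(x_i,v_i)$, and set $u_t^\dagger=\mathrm{Mv}_t^d\lambda^\dagger$, $\gamma_\theta^\dagger=\mathrm{Rj}_\theta\lambda^\dagger=\sum_im_i\delta_{(\theta\cdot x_i,\theta\cdot v_i)}$, $f_t^\dagger=\mathrm{Ob}_tu_t^\dagger$. Let $\emptyset\ne\mathcal T'\subset\mathcal T$ be such that $u_t^\dagger$ is stably reconstructible (via $\mathrm{Ob}_t$) for all $t\in\mathcal T'$. Further, (1) let $\overline\Theta\subset\Theta$ be compact such that for every $\theta\in\overline\Theta$ the configuration $\gamma_\theta^\dagger$ contains no coincidence or ghost particle with respect to $\mathcal T'$, and (2) let $\overline\Sigma\subset\Sigma$ be compact such that for all $t\in\overline\Sigma$ all particles have positive mutual distance in the projections $(\mathrm{Rd}_\theta u_t^\dagger)_{\theta\in\overline\Theta}$ (i.e. $\theta\cdot(x_i+tv_i)\ne\theta\cdot(x_j+tv_j)$ for all $i\neq j$, $\theta\in\overline\Theta$) and the set $\operatorname{supp}u_t^\dagger$ is uniquely determined by the family of sets $(\operatorname{supp}\mathrm{Rd}_\theta u_t^\dagger)_{\theta\in\overline\Theta}$. Then there exist constants $R,C>0$ (depending on $\lambda^\dagger,\mathcal T',\overline\Theta,\overline\Sigma$) such that for all noisy data $f^\delta=(f_t^\delta)_{t\in\mathcal T}$ in $H$ with noise strength $\delta=\frac12\sum_{t\in\mathcal T}\|f_t^\delta-f_t^\dagger\|_H^2>0$,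 the solution $(u,\gamma)$ of $$\min_{\gamma\in\mathcal M_+(\Theta\times\Gamma),\,u\in\mathcal M_+(\Omega)^\Sigma}\|\gamma\|_{\mathcal M}+\frac1{2\alpha}\sum_{t\in\mathcal T}\|\mathrm{Ob}_tu_t-f_t^\delta\|_H^2\ \text{ s.t. }\ \mathrm{Mv}^1_t\gamma_\theta=\mathrm{Rd}_\theta u_t\text{ for all }t\in\Sigma,\ \mathcal H_\Theta\text{-a.a. }\theta\in\Theta$$ with $\alpha=\sqrt\delta$ satisfies (1) $W_{2,R}^2(u_t,u_t^\dagger)\le C\sqrt\delta$ for all $t\in\overline\Sigma$, (2) $W_{2,R}^2(\gamma_\theta,\gamma_\theta^\dagger)\le C\sqrt\delta$ for $\mathcal H_\Theta$-almost all $\theta\in\overline\Theta$.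
   Context: $\mathcal M(X)$ and $\mathcal M_+(X)$ denote the finite signed and the finite nonnegative Radon measures on $X$, $\|\cdot\|_{\mathcal M}$ the total variation norm, $g_\#\nu$ the pushforward. $d\in\mathbb N$; $\Omega\subset\mathbb R^d$, $\Sigma\subset\mathbb R$ and $\Theta\subset S^{d-1}$ are compact; $\emptyset\ne\mathcal T\subset\Sigma$ is finite; $\mathcal H_\Theta$ is a Borel probability measure on $\Theta$ with $\operatorname{supp}\mathcal H_\Theta=\Theta$. $\Lambda=\{(x,v)\in\mathbb R^d\times\mathbb R^d: x+tv\in\Omega\ \forall t\in\Sigma\}$ and $\Gamma=\{(\theta\cdot x,\theta\cdot v):(x,v)\in\Lambda,\theta\in\Theta\}\subset\mathbb R^2$; both are compact. Operators: $\mathrm{Rd}_\theta\nu=[x\mapsto\theta\cdot x]_\#\nu$; $\mathrm{Rj}_\theta\lambda=[(x,v)\mapsto(\theta\cdot x,\theta\cdot v)]_\#\lambda$; $\mathrm{Mv}^n_t\lambda=[(x,v)\mapsto x+tv]_\#\lambda$ for $\lambda\in\mathcal M(\mathbb R^n\times\mathbb R^n)$. $H$ is a Hilbert space and, for $t\in\mathcal T$, $\mathrm{Ob}_t:\mathcal M(\Omega)\to H$ is the dual of a bounded linear operator $\mathrm{Ob}_t^*:H\to C(\Omega)$. The slices $\gamma_\theta\in\mathcal M_+(\Gamma)$ are defined by $\gamma=\mathcal H_\Theta\otimes_\theta\gamma_\theta$, i.e. $\gamma(A\times B)=\int_A\gamma_\theta(B)\,\mathrm d\mathcal H_\Theta(\theta)$;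 the constraint includes the existence of this disintegration. Coincidence/ghost particle: a configuration $\sum_im_i\delta_{(y_i,w_i)}$ on $\mathbb R^n\times\mathbb R^n$ (here $n=1$) has a coincidence with respect to $\mathcal T'$ if $y_i+tw_i=y_j+tw_j$ for some particles $i\ne j$ and some $t\in\mathcal T'$; it has a ghost particle with respect to $\mathcal T'$ if there is $(y,w)$ outside its support such that for each $t\in\mathcal T'$ there is $i$ (depending on $t$) with $y+tw=y_i+tw_i$. Stable reconstructibility: $\nu^\dagger=\sum_{i=1}^Nm_i\delta_{z_i}\in\mathcal M_+(\Omega)$ ($z_i$ distinct, $m_i>0$) is stably reconstructible via $\mathrm{Ob}_t$ if there are $\kappa,\mu,R>0$ such that for any $s\in\{-1,1\}^N$, with $\nu^s=\sum_is_i\delta_{z_i}$, there exist $v^\dagger,v^s\in H$ with $-\mathrm{Ob}_t^*v^\dagger\in\partial\|\cdot\|_{\mathcal M}(\nu^\dagger)$, $-\mathrm{Ob}_t^*v^s\in\partial\|\cdot\|_{\mathcal M}(\nu^s)$ and $-\mathrm{Ob}_t^*v^\dagger(x)\le1-\kappa\min\{R,\operatorname{dist}(x,\{z_1,\dots,z_N\})\}^2$ for all $x\in\Omega$, and $\mathrm{Ob}_t^*v^s(z_i)\,\mathrm{Ob}_t^*v^s(x)\ge1-\mu\operatorname{dist}(x,z_i)^2$ for all $x\in\Omega$ with $\operatorname{dist}(x,z_i)<R$, $i=1,\dots,N$. Here $\partial\|\cdot\|_{\mathcal M}(\nu)=\{\varphi\in C(\Omega):|\varphi|\le1,\ \int\varphi\,\mathrm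 d\nu=\|\nu\|_{\mathcal M}\}$. Unbalanced Wasserstein divergence: for $\nu_1,\nu_2\in\mathcal M_+(\mathbb R^n)$ (measures on compact subsets extended by zero), $W_{2,R}^2(\nu_1,\nu_2)=\inf\{W_2^2(\nu,\nu_2)+\frac12R^2\|\nu_1-\nu\|_{\mathcal M}:\nu\in\mathcal M_+(\mathbb R^n)\}$, where $W_2$ is the Wasserstein-2 distance (infinite if the masses differ). *)

theory Defs
  imports "HOL-Probability.Probability"
begin

text \<open>
  Conventions. A measure on a subset X of a Euclidean space is identified with its extension by
  zero, that is, with a Borel measure of the ambient space that vanishes on Borel sets disjoint
  from X. Finite Borel measures on Euclidean spaces are automatically Radon. A finite signed
  measure is a real-valued set function (zero by convention off the Borel sets), so that a
  nonnegative finite measure \<open>\<nu> :: 'a measure\<close> is the signed measure \<open>measure \<nu>\<close>.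
\<close>

definition pos_measures :: "'a::topological_space set \<Rightarrow> 'a measure set" where
  "pos_measures X = {\<nu>. sets \<nu> = sets borel \<and> finite_measure \<nu> \<and>
     (\<forall>A\<in>sets borel. A \<inter> X = {} \<longrightarrow> emeasure \<nu> A = 0)}"

definition signed_measures :: "'a::topological_space set \<Rightarrow> ('a set \<Rightarrow> real) set" where
  "signed_measures X = {\<mu>.
     (\<forall>A::nat \<Rightarrow> 'a set. range A \<subseteq> sets borel \<longrightarrow> disjoint_family A \<longrightarrow>
        (\<lambda>i. \<mu> (A i)) sums \<mu> (\<Union>i. A i)) \<and>
     (\<forall>A\<in>sets borel. A \<inter> X = {} \<longrightarrow> \<mu> A = 0) \<and>
     (\<forall>A. A \<notin> sets borel \<longrightarrow> \<mu> A = 0)}"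

definition tv_norm :: "('a::topological_space set \<Rightarrow> real) \<Rightarrow> real" where
  "tv_norm \<mu> = (SUP P \<in> {P. finite P \<and> P \<subseteq> sets borel \<and> partition_on UNIV P}. \<Sum>A\<in>P. \<bar>\<mu> A\<bar>)"

text \<open>Positive part of the Jordan decomposition; the negative part is the positive part of \<open>- \<mu>\<close>.\<close>

definition jordan_pos :: "('a::topological_space set \<Rightarrow> real) \<Rightarrow> 'a measure" where
  "jordan_pos \<mu> = measure_of UNIV (sets borel)
     (\<lambda>A. ennreal (SUP B \<in> {B \<in> sets borel. B \<subseteq> A}. \<mu> B))"

definition signed_integral ::
  "'a::topological_space set \<Rightarrow> ('a set \<Rightarrow> real) \<Rightarrow> ('a \<Rightarrow> real) \<Rightarrow> real" where
  "signed_integral X \<mu> \<phi> =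
     (LINT x:X|jordan_pos \<mu>. \<phi> x) - (LINT x:X|jordan_pos (\<lambda>A. - \<mu> A). \<phi> x)"

lemma tv_norm_measure:
  assumes "sets \<nu> = sets borel" "finite_measure \<nu>"
  shows "tv_norm (measure \<nu>) = measure \<nu> UNIV"
proof -
  interpret finite_measure \<nu> by fact
  have "(\<Sum>A\<in>P. \<bar>measure \<nu> A\<bar>) = measure \<nu> UNIV"
    if "finite P" "P \<subseteq> sets borel" "partition_on UNIV P" for P
  proof -
    have "(\<Sum>A\<in>P. measure \<nu> A) = measure \<nu> (\<Union>A\<in>P. A)"
      using that assms
      by (intro finite_measure_finite_Union[symmetric])
         (auto simp: disjoint_family_on_def partition_on_def disjoint_def)
    then show ?thesis using that by (simp add: partition_on_def)
  qed
  moreover have "{UNIV} \<in> {P. finite P \<and> P \<subseteq> sets (borel :: 'a measure) \<and> partition_on UNIV P}"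
    by (auto simp: partition_on_def disjoint_def)
  ultimately show ?thesis
    unfolding tv_norm_def
    by (smt (verit, ccfv_threshold) cSUP_const SUP_cong empty_iff mem_Collect_eq)
qed

lemma jordan_pos_measure:
  assumes "sets \<nu> = sets borel" "finite_measure \<nu>"
  shows "jordan_pos (measure \<nu>) = \<nu>"
    and "jordan_pos (\<lambda>A. - measure \<nu> A) = null_measure borel"
proof -
  interpret finite_measure \<nu> by fact
  have sp: "space \<nu> = UNIV" using sets_eq_imp_space_eq[OF assms(1)] by simp
  have 1: "(SUP B \<in> {B \<in> sets borel. B \<subseteq> A}. measure \<nu> B) = measure \<nu> A"
    if "A \<in> sets borel" for A
    using that assms(1) by (intro cSup_eq_maximum) (auto intro!: finite_measure_mono)
  have 2: "(SUP B \<in> {B \<in> sets borel. B \<subseteq> A}. - measure \<nu> B) = 0" for A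
    by (intro cSup_eq_maximum) (auto intro!: image_eqI[where x="{}"])
  have "jordan_pos (measure \<nu>) = measure_of UNIV (sets borel) (emeasure \<nu>)"
    unfolding jordan_pos_def
  proof (rule measure_of_eq)
    fix A :: "'a set" assume "A \<in> sigma_sets UNIV (sets borel)"
    then have "A \<in> sets borel" using sets.sigma_sets_eq[of "borel :: 'a measure"] by simp
    then show "ennreal (SUP B \<in> {B \<in> sets borel. B \<subseteq> A}. measure \<nu> B) = emeasure \<nu> A"
      by (simp add: 1 emeasure_eq_measure)
  qed auto
  also have "\<dots> = \<nu>" using measure_of_of_measure[of \<nu>] sp assms(1) by simp
  finally show "jordan_pos (measure \<nu>) = \<nu>" .
  show "jordan_pos (\<lambda>A. - measure \<nu> A) = null_measure borel"
    by (simp add: jordan_pos_def 2 null_measure_def)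
qed

lemma signed_integral_measure:
  assumes "sets \<nu> = sets borel" "finite_measure \<nu>"
  shows "signed_integral X (measure \<nu>) \<phi> = (LINT x:X|\<nu>. \<phi> x)"
  by (simp add: signed_integral_def jordan_pos_measure[OF assms] set_lebesgue_integral_def)

definition supp :: "'a::topological_space measure \<Rightarrow> 'a set" where
  "supp \<nu> = {x. \<forall>U. open U \<longrightarrow> x \<in> U \<longrightarrow> emeasure \<nu> U > 0}"

text \<open>The measure with mass \<open>m i\<close> at \<open>z i\<close>, for \<open>i = 1, \<dots>, N\<close>.\<close>

definition atomic_measure ::
  "nat \<Rightarrow> (nat \<Rightarrow> real) \<Rightarrow> (nat \<Rightarrow> 'a::topological_space) \<Rightarrow> 'a measure" where
  "atomic_measure N m z = distr (point_measure {1..N} (\<lambda>i. ennreal (m i))) borel z"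

definition signed_atomic ::
  "nat \<Rightarrow> (nat \<Rightarrow> real) \<Rightarrow> (nat \<Rightarrow> 'a::topological_space) \<Rightarrow> 'a set \<Rightarrow> real" where
  "signed_atomic N s z = (\<lambda>A. \<Sum>i\<in>{1..N}. s i * measure (return borel (z i)) A)"

subsection \<open>Phase space and transforms\<close>

definition phase_domain ::
  "'a::euclidean_space set \<Rightarrow> real set \<Rightarrow> ('a \<times> 'a) set" where
  "phase_domain \<Omega> \<Sigma> = {(x, v). \<forall>t\<in>\<Sigma>. x + t *\<^sub>R v \<in> \<Omega>}"

definition proj_domain ::
  "'a::euclidean_space set \<Rightarrow> 'a set \<Rightarrow> real set \<Rightarrow> (real \<times> real) set" where
  "proj_domain \<Theta> \<Omega> \<Sigma> =
     {(\<theta> \<bullet> x, \<theta> \<bullet> v) | \<theta> x v. (x, v) \<in> phase_domain \<Omega> \<Sigma> \<and> \<theta> \<in> \<Theta>}"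

definition Rd :: "'a::euclidean_space \<Rightarrow> 'a measure \<Rightarrow> real measure" where
  "Rd \<theta> \<nu> = distr \<nu> borel (\<lambda>x. \<theta> \<bullet> x)"

definition Rj :: "'a::euclidean_space \<Rightarrow> ('a \<times> 'a) measure \<Rightarrow> (real \<times> real) measure" where
  "Rj \<theta> lam = distr lam borel (\<lambda>(x, v). (\<theta> \<bullet> x, \<theta> \<bullet> v))"

definition Mv :: "real \<Rightarrow> ('a::euclidean_space \<times> 'a) measure \<Rightarrow> 'a measure" where
  "Mv t lam = distr lam borel (\<lambda>(x, v). x + t *\<^sub>R v)"

definition has_coincidence ::
  "real set \<Rightarrow> nat \<Rightarrow> (nat \<Rightarrow> 'a::euclidean_space) \<Rightarrow> (nat \<Rightarrow> 'a) \<Rightarrow> bool" where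
  "has_coincidence \<T> N y w \<longleftrightarrow>
     (\<exists>i\<in>{1..N}. \<exists>j\<in>{1..N}. i \<noteq> j \<and> (\<exists>t\<in>\<T>. y i + t *\<^sub>R w i = y j + t *\<^sub>R w j))"

definition has_ghost ::
  "real set \<Rightarrow> nat \<Rightarrow> (nat \<Rightarrow> 'a::euclidean_space) \<Rightarrow> (nat \<Rightarrow> 'a) \<Rightarrow> bool" where
  "has_ghost \<T> N y w \<longleftrightarrow>
     (\<exists>p q. (p, q) \<notin> (\<lambda>i. (y i, w i)) ` {1..N} \<and>
        (\<forall>t\<in>\<T>. \<exists>i\<in>{1..N}. p + t *\<^sub>R q = y i + t *\<^sub>R w i))"

subsection \<open>Observation operators and stable reconstructibility\<close>

text \<open>
  A map into \<open>C(\<Omega>)\<close> is a function whose second argument is relevant on \<open>\<Omega>\<close> only;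
  boundedness refers to the supremum norm on \<open>\<Omega>\<close>.
\<close>

definition bounded_linear_to_C ::
  "'a::euclidean_space set \<Rightarrow> ('h::real_normed_vector \<Rightarrow> 'a \<Rightarrow> real) \<Rightarrow> bool" where
  "bounded_linear_to_C \<Omega> B \<longleftrightarrow>
     (\<forall>h. continuous_on \<Omega> (B h)) \<and>
     (\<forall>g h. \<forall>x\<in>\<Omega>. B (g + h) x = B g x + B h x) \<and>
     (\<forall>c h. \<forall>x\<in>\<Omega>. B (c *\<^sub>R h) x = c * B h x) \<and>
     (\<exists>K. \<forall>h. \<forall>x\<in>\<Omega>. \<bar>B h x\<bar> \<le> K * norm h)"

text \<open>Duality with respect to \<open>M(\<Omega>) = C(\<Omega>)*\<close> and the Riesz identification of the Hilbert space with its dual.\<close>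

definition is_dual_of ::
  "'a::euclidean_space set \<Rightarrow> (('a set \<Rightarrow> real) \<Rightarrow> 'h::real_inner) \<Rightarrow> ('h \<Rightarrow> 'a \<Rightarrow> real) \<Rightarrow> bool" where
  "is_dual_of \<Omega> Ob B \<longleftrightarrow>
     (\<forall>\<mu>\<in>signed_measures \<Omega>. \<forall>h. Ob \<mu> \<bullet> h = signed_integral \<Omega> \<mu> (B h))"

definition tv_subdifferential ::
  "'a::euclidean_space set \<Rightarrow> ('a set \<Rightarrow> real) \<Rightarrow> ('a \<Rightarrow> real) set" where
  "tv_subdifferential \<Omega> \<mu> =
     {\<phi>. continuous_on \<Omega> \<phi> \<and> (\<forall>x\<in>\<Omega>. \<bar>\<phi> x\<bar> \<le> 1) \<and> signed_integral \<Omega> \<mu> \<phi> = tv_norm \<mu>}"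

text \<open>
  The expression \<open>Min (insert R \<dots>)\<close> is \<open>min {R, dist (x, {z\<^sub>1, \<dots>, z\<^sub>N})}\<close>, with the distance to
  the empty set being infinite (whereas \<open>infdist x {} = 0\<close>).
\<close>

definition stably_reconstructible ::
  "'a::euclidean_space set \<Rightarrow> ('h \<Rightarrow> 'a \<Rightarrow> real) \<Rightarrow> 'a measure \<Rightarrow> bool" where
  "stably_reconstructible \<Omega> ObS \<nu> \<longleftrightarrow> \<nu> \<in> pos_measures \<Omega> \<and>
     (\<exists>N m z. inj_on z {1..N} \<and> (\<forall>i\<in>{1..N}. m i > 0) \<and> \<nu> = atomic_measure N m z \<and>
       (\<exists>\<kappa>>0. \<exists>\<mu>>0. \<exists>R>0. \<forall>s. (\<forall>i\<in>{1..N}. s i \<in> {-1, 1}) \<longrightarrow>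
         (\<exists>v vs.
            (\<lambda>x. - ObS v x) \<in> tv_subdifferential \<Omega> (measure \<nu>) \<and>
            (\<lambda>x. - ObS vs x) \<in> tv_subdifferential \<Omega> (signed_atomic N s z) \<and>
            (\<forall>x\<in>\<Omega>. - ObS v x \<le> 1 - \<kappa> * (Min (insert R ((\<lambda>i. dist x (z i)) ` {1..N})))\<^sup>2) \<and>
            (\<forall>i\<in>{1..N}. \<forall>x\<in>\<Omega>. dist x (z i) < R \<longrightarrow>
               ObS vs (z i) * ObS vs x \<ge> 1 - \<mu> * (dist x (z i))\<^sup>2))))"

subsection \<open>Unbalanced Wasserstein divergence\<close>

text \<open>The infimum over an empty set of couplings, i.e. for different masses, is infinite.\<close>

definition wasserstein2_sq ::
  "'a::euclidean_space measure \<Rightarrow> 'a measure \<Rightarrow> ennreal" where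
  "wasserstein2_sq \<nu>1 \<nu>2 =
     (INF \<pi> \<in> {\<pi> \<in> pos_measures UNIV. distr \<pi> borel fst = \<nu>1 \<and> distr \<pi> borel snd = \<nu>2}.
        \<integral>\<^sup>+p. ennreal ((dist (fst p) (snd p))\<^sup>2) \<partial>\<pi>)"

definition unbalanced_wasserstein2_sq ::
  "real \<Rightarrow> 'a::euclidean_space measure \<Rightarrow> 'a measure \<Rightarrow> ennreal" where
  "unbalanced_wasserstein2_sq R \<nu>1 \<nu>2 =
     (INF \<nu> \<in> pos_measures UNIV. wasserstein2_sq \<nu> \<nu>2 +
        ennreal (1/2 * R\<^sup>2 * tv_norm (\<lambda>A. measure \<nu>1 A - measure \<nu> A)))"

subsection \<open>The optimization problem\<close>

text \<open>
  \<open>slices H \<Gamma> \<gamma> \<gamma>s\<close>: the family \<open>\<gamma>s\<close> disintegrates \<open>\<gamma>\<close> with respect to \<open>H\<close>. The family is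
  indexed by the whole ambient space; only its values \<open>H\<close>-almost everywhere matter.
\<close>

definition slices ::
  "'a::euclidean_space measure \<Rightarrow> (real \<times> real) set \<Rightarrow> ('a \<times> real \<times> real) measure \<Rightarrow>
   ('a \<Rightarrow> (real \<times> real) measure) \<Rightarrow> bool" where
  "slices H \<Gamma> \<gamma> \<gamma>s \<longleftrightarrow>
     (\<forall>\<theta>. \<gamma>s \<theta> \<in> pos_measures \<Gamma>) \<and>
     (\<forall>B\<in>sets borel. (\<lambda>\<theta>. emeasure (\<gamma>s \<theta>) B) \<in> borel_measurable borel) \<and>
     (\<forall>A\<in>sets borel. \<forall>B\<in>sets borel.
        emeasure \<gamma> (A \<times> B) = (\<integral>\<^sup>+\<theta>\<in>A. emeasure (\<gamma>s \<theta>) B \<partial>H))"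

definition feasible ::
  "'a::euclidean_space set \<Rightarrow> real set \<Rightarrow> 'a set \<Rightarrow> 'a measure \<Rightarrow>
   (real \<Rightarrow> 'a measure) \<times> ('a \<times> real \<times> real) measure \<Rightarrow> bool" where
  "feasible \<Omega> \<Sigma> \<Theta> H = (\<lambda>(u, \<gamma>).
     \<gamma> \<in> pos_measures (\<Theta> \<times> proj_domain \<Theta> \<Omega> \<Sigma>) \<and>
     (\<forall>t\<in>\<Sigma>. u t \<in> pos_measures \<Omega>) \<and>
     (\<exists>\<gamma>s. slices H (proj_domain \<Theta> \<Omega> \<Sigma>) \<gamma> \<gamma>s \<and>
        (\<forall>t\<in>\<Sigma>. AE \<theta> in H. Mv t (\<gamma>s \<theta>) = Rd \<theta> (u t))))"

definition objective ::
  "real set \<Rightarrow> (real \<Rightarrow> ('a::euclidean_space set \<Rightarrow> real) \<Rightarrow> 'h::real_normed_vector) \<Rightarrow>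
   real \<Rightarrow> (real \<Rightarrow> 'h) \<Rightarrow> (real \<Rightarrow> 'a measure) \<times> ('a \<times> real \<times> real) measure \<Rightarrow> real" where
  "objective \<T> Ob \<alpha> f = (\<lambda>(u, \<gamma>).
     tv_norm (measure \<gamma>) + 1 / (2 * \<alpha>) * (\<Sum>t\<in>\<T>. (norm (Ob t (measure (u t)) - f t))\<^sup>2))"

end

theory Submission
  imports Defs
begin

text \<open>
  Comparing a minimizer with the exact configuration bounds its total mass by that of
  \<open>\<lambda>\<^sup>\<dagger>\<close> plus \<open>\<surd>\<delta>\<close>, and together with a dual certificate it bounds all discrepancies
  \<open>Ob\<^sub>t u\<^sub>t - Ob\<^sub>t u\<^sub>t\<^sup>\<dagger>\<close> by a multiple of \<open>\<surd>\<delta>\<close>. At the times in \<open>\<T>'\<close> stable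
  reconstructibility turns this into two estimates of that order: for the integral of the squared
  distance to the atoms, capped at a small radius, and for the error of the masses of small balls
  about the atoms. Both are inherited by \<open>Rd\<^sub>\<theta> u\<^sub>t = Mv\<^sub>t \<gamma>\<^sub>\<theta>\<close>. Without coincidences and ghost
  particles, the sum over \<open>\<T>'\<close> of the squared capped distances of \<open>y + t w\<close> to the projected atoms
  dominates the squared capped distance of \<open>(y, w)\<close> to the atoms of \<open>\<gamma>\<^sub>\<theta>\<^sup>\<dagger>\<close>, so the two estimates
  hold for \<open>\<gamma>\<^sub>\<theta>\<close>, hence for \<open>Rd\<^sub>\<theta> u\<^sub>t\<close> with \<open>t\<close> in \<open>\<Sigma>b\<close>, and finally, using finitely many
  directions, for \<open>u\<^sub>t\<close>. For a measure satisfying both estimates, rescaling it on each ball to the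
  correct mass and moving that mass to the centre bounds the unbalanced Wasserstein divergence.

  The set \<open>\<Theta>b\<close> may be negligible, so the constraint may fail for every direction in it. The
  geometric estimates are therefore proved for directions near \<open>\<Theta>b\<close>; almost all of these satisfy
  the constraint, they are dense because \<open>H\<Theta>\<close> has full support, and the estimate for
  \<open>Rd\<^sub>\<theta> u\<^sub>t\<close> passes to the limit.
\<close>

subsection \<open>Capped distances\<close>

text \<open>The two estimates support each other. By Chebyshev's inequality the capped cost leaves
  little mass off the neighbourhoods of the atoms, and this lets the mass estimate pass between
  neighbourhoods of different shape (balls, slabs, strips in phase space): by separation, a point of
  one neighbourhood of an atom lies in the other neighbourhood of that atom or off all of them. So
  masses are needed at one observed time only, while the cost is needed at all times of
  \<open>\<T>'\<close>, since several positions are required to locate a point of phase space. The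
  rate comes from \<alpha> = sqrt \<delta>: the noise costs \<delta> / \<alpha> = sqrt \<delta> in
  the objective, and the quadratic inequality that results for the residual has solutions of that
  order. The order of choices matters. The certificate radii and the separation \<sigma> come first,
  then one radius \<rho> common to all times, and only then the constants, which contain 1 /
  \<rho>^2. None of them may depend on \<delta>, the minimizer, the time in \<open>\<Sigma>b\<close>
  or the direction. The radius of the divergence only weights the mass penalty, so it can be
  1.\<close>

definition capped_min :: "real \<Rightarrow> nat \<Rightarrow> (nat \<Rightarrow> real) \<Rightarrow> real" where
  "capped_min r N f = Min (insert r (f ` {1..N}))"

text \<open>The family \<open>f\<close> is left open because the same cost is used with distances in
  space, with distances of projections, with distances of moved phase-space points and with
  distances in phase space. For \<open>N = 0\<close> the capped minimum is \<open>r\<close>, so the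
  cost is then \<open>r^2\<close> times the total mass.\<close>

abbreviation capped_cost :: "'a measure \<Rightarrow> real \<Rightarrow> nat \<Rightarrow> ('a \<Rightarrow> nat \<Rightarrow> real) \<Rightarrow> ennreal" where
  "capped_cost \<mu> r N f \<equiv> (\<integral>\<^sup>+x. ennreal ((capped_min r N (f x))\<^sup>2) \<partial>\<mu>)"

lemma capped_min_ge_iff:
  "a \<le> capped_min r N f \<longleftrightarrow> a \<le> r \<and> (\<forall>i\<in>{1..N}. a \<le> f i)"
  unfolding capped_min_def by (subst Min_ge_iff) auto

lemma capped_min_le_cap: "capped_min r N f \<le> r"
  using capped_min_ge_iff[of "capped_min r N f" r N f] by simp

lemma capped_min_le: "i \<in> {1..N} \<Longrightarrow> capped_min r N f \<le> f i"
  using capped_min_ge_iff[of "capped_min r N f" r N f] by blast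

lemma capped_min_nonneg:
  "0 \<le> r \<Longrightarrow> (\<And>i. i \<in> {1..N} \<Longrightarrow> 0 \<le> f i) \<Longrightarrow> 0 \<le> capped_min r N f"
  by (simp add: capped_min_ge_iff)

lemma capped_min_cases:
  obtains "capped_min r N f = r" | i where "i \<in> {1..N}" "capped_min r N f = f i"
proof -
  have "capped_min r N f \<in> insert r (f ` {1..N})"
    unfolding capped_min_def by (rule Min_in) auto
  then show thesis using that by auto
qed

lemma capped_min_mono:
  assumes "r \<le> r'" "\<And>i. i \<in> {1..N} \<Longrightarrow> f i \<le> g i"
  shows "capped_min r N f \<le> capped_min r' N g"
proof -
  have "capped_min r N f \<le> r'" using capped_min_le_cap[of r N f] assms(1) by linarith
  moreover have "capped_min r N f \<le> g i" if "i \<in> {1..N}" for i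
    using capped_min_le[OF that, of r f] assms(2)[OF that] by linarith
  ultimately show ?thesis by (simp add: capped_min_ge_iff)
qed

lemma capped_min_add:
  assumes "0 \<le> e" "\<And>i. i \<in> {1..N} \<Longrightarrow> f i \<le> g i + e"
  shows "capped_min r N f \<le> capped_min r N g + e"
proof (rule capped_min_cases[of r N g])
  assume "capped_min r N g = r"
  then show ?thesis using capped_min_le_cap[of r N f] assms(1) by linarith
next
  fix i assume "i \<in> {1..N}" "capped_min r N g = g i"
  then show ?thesis using capped_min_le[of i N r f] assms(2)[of i] by linarith
qed

lemma capped_min_eqI:
  assumes "i \<in> {1..N}" "f i \<le> r" "\<And>j. j \<in> {1..N} \<Longrightarrow> j \<noteq> i \<Longrightarrow> f i \<le> f j"
  shows "capped_min r N f = f i"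
proof (rule antisym)
  show "capped_min r N f \<le> f i" using assms(1) by (rule capped_min_le)
  show "f i \<le> capped_min r N f" unfolding capped_min_ge_iff using assms by force
qed

lemma capped_min_measurable [measurable]:
  assumes "\<And>i. i \<in> {1..N} \<Longrightarrow> (\<lambda>x. f x i) \<in> borel_measurable M"
  shows "(\<lambda>x. capped_min r N (f x)) \<in> borel_measurable M"
proof (cases "N = 0")
  case True
  then show ?thesis by (simp add: capped_min_def)
next
  case False
  then have "capped_min r N (f x) = min r (Min ((\<lambda>i. f x i) ` {1..N}))" for x
    unfolding capped_min_def by (subst Min_insert) auto
  moreover have "(\<lambda>x. Min ((\<lambda>i. f x i) ` {1..N})) \<in> borel_measurable M"
    using assms by (intro borel_measurable_Min) auto
  ultimately show ?thesis by simp
qed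

section \<open>Concentration near the atoms and comparison of masses\<close>

lemma pos_measuresD:
  assumes "\<nu> \<in> pos_measures X"
  shows "sets \<nu> = sets borel" "finite_measure \<nu>" "space \<nu> = UNIV"
  using assms sets_eq_imp_space_eq[of \<nu> borel] by (auto simp: pos_measures_def)

lemma AE_pos_measures:
  assumes "\<nu> \<in> pos_measures X" "X \<subseteq> Y" "closed Y"
  shows "AE x in \<nu>. x \<in> Y"
proof (rule AE_I)
  show "{x \<in> space \<nu>. x \<notin> Y} \<subseteq> - Y" by auto
  show "- Y \<in> sets \<nu>" using assms pos_measuresD(1)[OF assms(1)] by simp
  have "- Y \<in> sets borel" "- Y \<inter> X = {}" using assms by auto
  then show "emeasure \<nu> (- Y) = 0" using assms(1) by (auto simp: pos_measures_def)
qed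

text \<open>Chebyshev's inequality. The condition \<open>\<rho> \<le> r\<close> ensures that the cap
  does not push the minimum below \<rho> at points that are far from all atoms.\<close>

lemma measure_capped_min_ge:
  assumes "finite_measure \<mu>" "\<And>i. i \<in> {1..N} \<Longrightarrow> (\<lambda>x. f x i) \<in> borel_measurable \<mu>"
    and "(\<integral>\<^sup>+x. ennreal ((capped_min r N (f x))\<^sup>2) \<partial>\<mu>) \<le> ennreal A"
    and "0 < \<rho>" "\<rho> \<le> r" "0 \<le> A"
  shows "measure \<mu> {x \<in> space \<mu>. \<forall>i\<in>{1..N}. \<rho> \<le> f x i} \<le> A / \<rho>\<^sup>2"
proof -
  interpret finite_measure \<mu> by fact
  note [measurable] = assms(2)
  let ?S = "{x \<in> space \<mu>. \<rho> \<le> capped_min r N (f x)}"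
  have eq: "{x \<in> space \<mu>. \<forall>i\<in>{1..N}. \<rho> \<le> f x i} = ?S"
    using assms(5) by (auto simp: capped_min_ge_iff)
  have [measurable]: "(\<lambda>x. capped_min r N (f x)) \<in> borel_measurable \<mu>"
    by (rule capped_min_measurable) (use assms(2) in auto)
  have "ennreal (\<rho>\<^sup>2 * measure \<mu> ?S) = ennreal (\<rho>\<^sup>2) * emeasure \<mu> ?S"
    by (simp add: emeasure_eq_measure ennreal_mult)
  also have "\<dots> = (\<integral>\<^sup>+x. ennreal (\<rho>\<^sup>2) * indicator ?S x \<partial>\<mu>)"
    by (subst nn_integral_cmult_indicator) auto
  also have "\<dots> \<le> (\<integral>\<^sup>+x. ennreal ((capped_min r N (f x))\<^sup>2) \<partial>\<mu>)"
    using assms(4) by (intro nn_integral_mono) (auto simp: indicator_def intro!: ennreal_leI power_mono)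
  also have "\<dots> \<le> ennreal A" by fact
  finally have "\<rho>\<^sup>2 * measure \<mu> ?S \<le> A" using assms(6) by simp
  then show ?thesis using assms(4) unfolding eq by (simp add: field_simps)
qed

text \<open>\<open>f\<close> and \<open>g\<close> describe two systems of neighbourhoods of the same
  atoms. By \<open>sep\<close>, a point near atom i for \<open>f\<close> cannot be near another atom
  for \<open>g\<close>, so it is near atom i for \<open>g\<close> or near no atom at all. Hence the
  two neighbourhoods differ by sets off one of the systems, which Chebyshev's inequality controls.
  No inclusion between the neighbourhoods is required.\<close>

lemma measure_capped_min_transfer:
  assumes "finite_measure \<mu>"
    and f: "\<And>i. i \<in> {1..N} \<Longrightarrow> (\<lambda>x. f x i) \<in> borel_measurable \<mu>"
    and g: "\<And>i. i \<in> {1..N} \<Longrightarrow> (\<lambda>x. g x i) \<in> borel_measurable \<mu>"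
    and fA: "(\<integral>\<^sup>+x. ennreal ((capped_min r N (f x))\<^sup>2) \<partial>\<mu>) \<le> ennreal A" "0 < \<rho>" "\<rho> \<le> r" "0 \<le> A"
    and gA: "(\<integral>\<^sup>+x. ennreal ((capped_min r' N (g x))\<^sup>2) \<partial>\<mu>) \<le> ennreal A'" "0 < \<rho>'" "\<rho>' \<le> r'" "0 \<le> A'"
    and sep: "\<And>x i j. i \<in> {1..N} \<Longrightarrow> j \<in> {1..N} \<Longrightarrow> i \<noteq> j \<Longrightarrow> f x i < \<rho> \<Longrightarrow> g x j < \<rho>' \<Longrightarrow> False"
    and i: "i \<in> {1..N}"
  shows "\<bar>measure \<mu> {x \<in> space \<mu>. f x i < \<rho>} - measure \<mu> {x \<in> space \<mu>. g x i < \<rho>'}\<bar>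
    \<le> A / \<rho>\<^sup>2 + A' / \<rho>'\<^sup>2"
proof -
  interpret finite_measure \<mu> by fact
  note [measurable] = f g
  let ?F = "{x \<in> space \<mu>. f x i < \<rho>}" and ?G = "{x \<in> space \<mu>. g x i < \<rho>'}"
  let ?FO = "{x \<in> space \<mu>. \<forall>i\<in>{1..N}. \<rho> \<le> f x i}"
  let ?GO = "{x \<in> space \<mu>. \<forall>i\<in>{1..N}. \<rho>' \<le> g x i}"
  have m: "?F \<in> sets \<mu>" "?G \<in> sets \<mu>" "?FO \<in> sets \<mu>" "?GO \<in> sets \<mu>"
    using i by measurable
  have sub: "A \<subseteq> B \<union> C \<Longrightarrow> B \<in> sets \<mu> \<Longrightarrow> C \<in> sets \<mu> \<Longrightarrow> measure \<mu> A \<le> measure \<mu> B + measure \<mu> C"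
    for A B C
    using finite_measure_mono[of A "B \<union> C"] measure_Un_le[of B \<mu> C] by fastforce
  have "?F \<subseteq> ?G \<union> ?GO" using sep[OF i] i by (force simp: not_le)
  from sub[OF this] have 1: "measure \<mu> ?F \<le> measure \<mu> ?G + measure \<mu> ?GO" using m by simp
  have "?G \<subseteq> ?F \<union> ?FO" using sep[OF _ i] i by (force simp: not_le)
  from sub[OF this] have 2: "measure \<mu> ?G \<le> measure \<mu> ?F + measure \<mu> ?FO" using m by simp
  have 3: "measure \<mu> ?FO \<le> A / \<rho>\<^sup>2"
    by (rule measure_capped_min_ge) (use assms in auto)
  have 4: "measure \<mu> ?GO \<le> A' / \<rho>'\<^sup>2"
    by (rule measure_capped_min_ge) (use assms in auto)
  have "0 \<le> A / \<rho>\<^sup>2" "0 \<le> A' / \<rho>'\<^sup>2" using fA gA by auto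
  with 1 2 3 4 show ?thesis by linarith
qed

lemma sum_measure_partition:
  assumes "finite_measure \<nu>" "sets \<nu> = sets borel" "finite P" "P \<subseteq> sets borel" "partition_on UNIV P"
  shows "(\<Sum>A\<in>P. measure \<nu> A) = measure \<nu> UNIV"
proof -
  interpret finite_measure \<nu> by fact
  have "(\<Sum>A\<in>P. measure \<nu> A) = measure \<nu> (\<Union>A\<in>P. A)"
    using assms by (intro finite_measure_finite_Union[symmetric])
       (auto simp: disjoint_family_on_def partition_on_def disjoint_def)
  then show ?thesis using assms by (simp add: partition_on_def)
qed

text \<open>The bound holds piece by piece, and measures add up to their total mass over any finite
  partition. Two dominating measures are provided since a crude bound of a difference of measures
  uses both of them.\<close>

lemma tv_norm_diff_le:
  fixes \<nu>1 \<nu>2 :: "'a::topological_space measure"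
  assumes "finite_measure \<tau>" "finite_measure \<tau>'" "sets \<tau> = sets borel" "sets \<tau>' = sets borel"
    and "\<And>A. A \<in> sets borel \<Longrightarrow> \<bar>\<mu> A\<bar> \<le> measure \<tau> A + measure \<tau>' A"
  shows "tv_norm \<mu> \<le> measure \<tau> UNIV + measure \<tau>' (UNIV :: 'a set)"
  unfolding tv_norm_def
proof (rule cSUP_least)
  have "{UNIV} \<in> {P. finite P \<and> P \<subseteq> sets (borel :: 'a measure) \<and> partition_on UNIV P}"
    by (auto simp: partition_on_def disjoint_def)
  then show "{P. finite P \<and> P \<subseteq> sets (borel :: 'a measure) \<and> partition_on UNIV P} \<noteq> {}"
    by blast
  fix P :: "'a set set"
  assume P: "P \<in> {P. finite P \<and> P \<subseteq> sets borel \<and> partition_on UNIV P}"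
  have *: "(\<Sum>A\<in>P. measure \<nu> A) = measure \<nu> UNIV"
    if "finite_measure \<nu>" "sets \<nu> = sets borel" for \<nu> :: "'a measure"
    using that P by (intro sum_measure_partition) auto
  have "(\<Sum>A\<in>P. \<bar>\<mu> A\<bar>) \<le> (\<Sum>A\<in>P. measure \<tau> A + measure \<tau>' A)"
    using P assms(5) by (intro sum_mono) auto
  also have "\<dots> = measure \<tau> UNIV + measure \<tau>' UNIV"
    using assms by (simp add: sum.distrib *)
  finally show "(\<Sum>A\<in>P. \<bar>\<mu> A\<bar>) \<le> measure \<tau> UNIV + measure \<tau>' UNIV" .
qed

subsection \<open>Atomic measures\<close>

lemma sets_atomic_measure [simp, measurable_cong]: "sets (atomic_measure N m z) = sets borel"
  by (simp add: atomic_measure_def)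

lemma space_atomic_measure [simp]: "space (atomic_measure N m z) = UNIV"
  by (simp add: atomic_measure_def)

lemma nn_integral_atomic_measure:
  assumes "f \<in> borel_measurable borel"
  shows "(\<integral>\<^sup>+x. f x \<partial>atomic_measure N m z) = (\<Sum>i\<in>{1..N}. ennreal (m i) * f (z i))"
  unfolding atomic_measure_def using assms
  by (subst nn_integral_distr) (auto simp: nn_integral_point_measure_finite measurable_point_measure_eq1)

lemma emeasure_atomic_measure:
  assumes "A \<in> sets borel"
  shows "emeasure (atomic_measure N m z) A = (\<Sum>i\<in>{1..N}. ennreal (m i) * indicator A (z i))"
  using nn_integral_atomic_measure[of "indicator A" N m z] assms by simp

lemma finite_measure_atomic_measure: "finite_measure (atomic_measure N m z)"
  by (rule finite_measureI) (simp add: emeasure_atomic_measure ennreal_mult_eq_top_iff)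

lemma measure_atomic_measure:
  assumes "A \<in> sets borel" "\<And>i. i \<in> {1..N} \<Longrightarrow> m i \<ge> 0"
  shows "measure (atomic_measure N m z) A = (\<Sum>i\<in>{1..N}. m i * indicator A (z i))"
proof -
  have "emeasure (atomic_measure N m z) A = (\<Sum>i\<in>{1..N}. ennreal (m i * indicator A (z i)))"
    unfolding emeasure_atomic_measure[OF assms(1)]
    by (intro sum.cong) (auto simp: indicator_def)
  also have "\<dots> = ennreal (\<Sum>i\<in>{1..N}. m i * indicator A (z i))"
    using assms(2) by (intro sum_ennreal) auto
  finally show ?thesis
    unfolding measure_def by (metis (no_types, lifting) assms(2) enn2real_ennreal indicator_pos_le mult_nonneg_nonneg sum_nonneg)
qed

lemma integral_atomic_measure:
  fixes f :: "'a::topological_space \<Rightarrow> real"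
  assumes "f \<in> borel_measurable borel" "\<And>i. i \<in> {1..N} \<Longrightarrow> m i \<ge> 0"
  shows "(LINT x|atomic_measure N m z. f x) = (\<Sum>i\<in>{1..N}. m i * f (z i))"
proof -
  have "(LINT x|atomic_measure N m z. f x) = (LINT i|point_measure {1..N} (\<lambda>i. ennreal (m i)). f (z i))"
    unfolding atomic_measure_def using assms(1)
    by (intro integral_distr) (auto simp: measurable_point_measure_eq1)
  also have "\<dots> = (\<Sum>i\<in>{1..N}. m i *\<^sub>R f (z i))"
    using assms(2) by (intro lebesgue_integral_point_measure_finite) auto
  finally show ?thesis by simp
qed

lemma distr_atomic_measure:
  assumes "g \<in> borel_measurable borel"
  shows "distr (atomic_measure N m z) borel g = atomic_measure N m (\<lambda>i. g (z i))"
  unfolding atomic_measure_def using assms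
  by (subst distr_distr) (auto simp: measurable_point_measure_eq1 comp_def)

text \<open>Serves to recover the set of atoms from the measure when two representations have to be
  matched, and to read the hypothesis on supports as one on finite point sets.\<close>

lemma supp_atomic_measure:
  fixes z :: "nat \<Rightarrow> 'a::t1_space"
  assumes "\<And>i. i \<in> {1..N} \<Longrightarrow> m i > 0"
  shows "supp (atomic_measure N m z) = z ` {1..N}"
proof (intro equalityI subsetI)
  fix x assume x: "x \<in> supp (atomic_measure N m z)"
  show "x \<in> z ` {1..N}"
  proof (rule ccontr)
    assume "x \<notin> z ` {1..N}"
    moreover have "open (- z ` {1..N})" by (intro open_Compl finite_imp_closed) auto
    ultimately have "emeasure (atomic_measure N m z) (- z ` {1..N}) > 0"
      using x by (auto simp: supp_def)
    moreover have "emeasure (atomic_measure N m z) (- z ` {1..N}) = 0"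
      using \<open>open (- z ` {1..N})\<close> by (subst emeasure_atomic_measure) auto
    ultimately show False by simp
  qed
next
  fix x assume "x \<in> z ` {1..N}"
  then obtain i where i: "i \<in> {1..N}" "x = z i" by auto
  have "emeasure (atomic_measure N m z) U > 0" if "open U" "x \<in> U" for U
  proof -
    have "0 < ennreal (m i) * indicator U (z i)" using assms[OF i(1)] that i by simp
    also have "\<dots> \<le> (\<Sum>i\<in>{1..N}. ennreal (m i) * indicator U (z i))"
      using i by (intro member_le_sum) auto
    finally show ?thesis using that by (simp add: emeasure_atomic_measure)
  qed
  then show "x \<in> supp (atomic_measure N m z)" by (simp add: supp_def)
qed

lemma measure_atomic_measure_singleton:
  fixes z :: "nat \<Rightarrow> 'a::t1_space"
  assumes "\<And>i. i \<in> {1..N} \<Longrightarrow> m i > 0" "inj_on z {1..N}" "i \<in> {1..N}"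
  shows "measure (atomic_measure N m z) {z i} = m i"
proof -
  have "measure (atomic_measure N m z) {z i} = (\<Sum>j\<in>{1..N}. m j * indicator {z i} (z j))"
    using assms by (intro measure_atomic_measure) (auto simp: less_imp_le)
  also have "\<dots> = (\<Sum>j\<in>{1..N}. if j = i then m j else 0)"
    using assms by (intro sum.cong) (auto simp: indicator_def dest: inj_onD)
  finally show ?thesis using assms by simp
qed

lemma atomic_measure_in_pos_measures:
  assumes "\<And>i. i \<in> {1..N} \<Longrightarrow> z i \<in> X"
  shows "atomic_measure N m z \<in> pos_measures X"
proof -
  have "emeasure (atomic_measure N m z) A = 0" if "A \<in> sets borel" "A \<inter> X = {}" for A
  proof -
    have "indicator A (z i) = (0::ennreal)" if "i \<in> {1..N}" for i
      using assms[OF that] \<open>A \<inter> X = {}\<close> by (auto simp: indicator_def)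
    then show ?thesis using that by (simp add: emeasure_atomic_measure)
  qed
  then show ?thesis using finite_measure_atomic_measure by (auto simp: pos_measures_def)
qed

lemma pos_measures_atomic_measureD:
  fixes z :: "nat \<Rightarrow> 'a::t1_space"
  assumes "atomic_measure N m z \<in> pos_measures X" "i \<in> {1..N}" "\<And>i. i \<in> {1..N} \<Longrightarrow> m i > 0"
  shows "z i \<in> X"
proof (rule ccontr)
  assume "z i \<notin> X"
  then have "emeasure (atomic_measure N m z) {z i} = 0" using assms by (auto simp: pos_measures_def)
  then have "(\<Sum>j\<in>{1..N}. ennreal (m j) * indicator {z i} (z j)) = 0"
    by (simp add: emeasure_atomic_measure)
  then have "ennreal (m i) * indicator {z i} (z i) = 0"
    using assms(2) by (metis (mono_tags, lifting) finite_atLeastAtMost sum_eq_0_iff)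
  then show False using assms(3)[OF assms(2)] by simp
qed

section \<open>Transport plans given by maps\<close>

lemma emeasure_density_triangle:
  assumes [measurable]: "f \<in> borel_measurable M" "g \<in> borel_measurable M" "h \<in> borel_measurable M"
    and "\<And>x. f x \<le> g x + h x" "A \<in> sets M"
  shows "emeasure (density M f) A \<le> emeasure (density M g) A + emeasure (density M h) A"
  using assms
  by (subst emeasure_density_add) (auto simp: emeasure_density intro!: nn_integral_mono mult_right_mono)

lemma wasserstein2_sq_le:
  assumes "\<pi> \<in> pos_measures UNIV" "distr \<pi> borel fst = \<nu>1" "distr \<pi> borel snd = \<nu>2"
  shows "wasserstein2_sq \<nu>1 \<nu>2 \<le> (\<integral>\<^sup>+p. ennreal ((dist (fst p) (snd p))\<^sup>2) \<partial>\<pi>)"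
  unfolding wasserstein2_sq_def by (rule INF_lower) (use assms in auto)

text \<open>The plan is the image of \<nu> under x -> (x, T x). Plans of this form suffice below,
  since the atomic target is always written as the image of some measure under a map.\<close>

lemma graph_coupling:
  fixes \<nu> :: "'a::euclidean_space measure"
  assumes "finite_measure \<nu>" and s: "sets \<nu> = sets borel" and T: "T \<in> borel_measurable borel"
  shows "wasserstein2_sq \<nu> (distr \<nu> borel T) \<le> (\<integral>\<^sup>+x. ennreal ((dist x (T x))\<^sup>2) \<partial>\<nu>)"
proof -
  interpret finite_measure \<nu> by fact
  have fst_snd: "(fst :: 'a \<times> 'a \<Rightarrow> 'a) \<in> borel_measurable borel" "(snd :: 'a \<times> 'a \<Rightarrow> 'a) \<in> borel_measurable borel"
    by (intro borel_measurable_continuous_onI continuous_intros)+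
  have T': "(\<lambda>x. (x, T x)) \<in> \<nu> \<rightarrow>\<^sub>M borel"
    unfolding borel_prod[symmetric] using T s by (simp add: measurable_cong_sets[OF s refl])
  let ?\<pi> = "distr \<nu> borel (\<lambda>x. (x, T x))"
  have fm: "finite_measure ?\<pi>" using T' by (rule finite_measure_distr)
  have 1: "?\<pi> \<in> pos_measures UNIV" using fm by (auto simp: pos_measures_def)
  have 2: "distr ?\<pi> borel fst = \<nu>"
    using T' s by (subst distr_distr) (auto simp: comp_def distr_id2 fst_snd)
  have 3: "distr ?\<pi> borel snd = distr \<nu> borel T"
    using T' by (subst distr_distr) (auto simp: comp_def fst_snd)
  have "wasserstein2_sq \<nu> (distr \<nu> borel T) \<le> (\<integral>\<^sup>+p. ennreal ((dist (fst p) (snd p))\<^sup>2) \<partial>?\<pi>)"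
    by (rule wasserstein2_sq_le[OF 1 2 3])
  also have "\<dots> = (\<integral>\<^sup>+x. ennreal ((dist x (T x))\<^sup>2) \<partial>\<nu>)"
    using T' by (subst nn_integral_distr)
      (auto intro!: borel_measurable_continuous_onI continuous_intros)
  finally show ?thesis .
qed

subsection \<open>The unbalanced Wasserstein divergence to an atomic measure\<close>

text \<open>The two contributions are bounded separately for a chosen intermediate measure \<nu>;
  the factor 1/2 of the mass penalty is given away.\<close>

lemma unbalanced_wasserstein2_sq_le:
  assumes "\<nu> \<in> pos_measures UNIV" "wasserstein2_sq \<nu> \<nu>2 \<le> ennreal a" "0 \<le> a" "0 \<le> b"
    and "tv_norm (\<lambda>A. measure \<nu>1 A - measure \<nu> A) \<le> b"
  shows "unbalanced_wasserstein2_sq 1 \<nu>1 \<nu>2 \<le> ennreal (a + b)"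
proof -
  have "unbalanced_wasserstein2_sq 1 \<nu>1 \<nu>2 \<le> wasserstein2_sq \<nu> \<nu>2 +
        ennreal (1/2 * 1\<^sup>2 * tv_norm (\<lambda>A. measure \<nu>1 A - measure \<nu> A))"
    unfolding unbalanced_wasserstein2_sq_def by (rule INF_lower) fact
  also have "\<dots> \<le> ennreal a + ennreal b"
    using assms by (intro add_mono ennreal_leI) auto
  finally show ?thesis using assms by simp
qed

lemma finite_measure_density_bounded:
  assumes "finite_measure M" "f \<in> borel_measurable M" "\<And>x. f x \<le> ennreal c"
  shows "finite_measure (density M f)"
proof (rule finite_measureI)
  have "emeasure (density M f) (space (density M f)) = (\<integral>\<^sup>+x. f x \<partial>M)"
    using assms by (simp add: emeasure_density nn_integral_set_ennreal cong: nn_integral_cong)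
  also have "\<dots> \<le> (\<integral>\<^sup>+x. ennreal c \<partial>M)" by (intro nn_integral_mono assms)
  also have "\<dots> < \<infinity>"
    using finite_measure.emeasure_finite[OF assms(1)] by (simp add: ennreal_mult_less_top less_top)
  finally show "emeasure (density M f) (space (density M f)) \<noteq> \<infinity>" by simp
qed

text \<open>By \<open>half\<close>, the factor \<open>c i\<close> that corrects the mass of the i-th
  ball is at most 2. The intermediate measure is \<nu> multiplied by \<open>c i\<close> on that ball
  and by 0 off all balls; collapsing each ball to its centre turns it into the atomic measure
  exactly. The summand \<open>2 * A\<close> is the transport cost, the bracket is the variation of
  the change of density.\<close>

lemma unbalanced_wasserstein2_sq_atomic_measure_near:
  fixes \<nu> :: "'a::euclidean_space measure"
  assumes m: "\<And>i. i \<in> {1..N} \<Longrightarrow> 0 < m i" and \<rho>: "0 < \<rho>" and A: "0 \<le> A"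
    and fin: "finite_measure \<nu>" and s: "sets \<nu> = sets borel"
    and sep: "\<And>i j. i \<in> {1..N} \<Longrightarrow> j \<in> {1..N} \<Longrightarrow> i \<noteq> j \<Longrightarrow> 2 * \<rho> \<le> dist (z i) (z j)"
    and int: "capped_cost \<nu> \<rho> N (\<lambda>x i. dist x (z i)) \<le> ennreal A"
    and mass: "\<And>i. i \<in> {1..N} \<Longrightarrow> \<bar>measure \<nu> (ball (z i) \<rho>) - m i\<bar> \<le> A"
    and half: "\<And>i. i \<in> {1..N} \<Longrightarrow> m i \<le> 2 * measure \<nu> (ball (z i) \<rho>)"
  shows "unbalanced_wasserstein2_sq 1 \<nu> (atomic_measure N m z) \<le> ennreal (2 * A + (A / \<rho>\<^sup>2 + N * A))"
proof -
  interpret finite_measure \<nu> by fact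
  have sp: "space \<nu> = UNIV" using sets_eq_imp_space_eq[OF s] by simp
  note [measurable_cong] = s
  define B where "B i = ball (z i) \<rho>" for i
  have B [measurable]: "B i \<in> sets borel" for i by (simp add: B_def)
  define c where "c i = m i / measure \<nu> (B i)" for i
  have pos: "0 < measure \<nu> (B i)" if "i \<in> {1..N}" for i
    using half[OF that] m[OF that] by (simp add: B_def)
  have c: "0 \<le> c i" "c i \<le> 2" if "i \<in> {1..N}" for i
    using pos[OF that] half[OF that] m[OF that] by (auto simp: c_def B_def field_simps)
  define h where "h x = (\<Sum>i\<in>{1..N}. c i * indicator (B i) x)" for x
  \<comment> \<open>Off the balls this is 0, an arbitrary value, which is harmless because
    \<open>h\<close> vanishes there.\<close>
  define T where "T x = (\<Sum>i\<in>{1..N}. indicator (B i) x *\<^sub>R z i)" for x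
  have disj: "j = i" if "i \<in> {1..N}" "j \<in> {1..N}" "x \<in> B i" "x \<in> B j" for i j x
  proof (rule ccontr)
    assume "j \<noteq> i"
    from sep[OF that(2,1) this] have "2 * \<rho> \<le> dist (z j) (z i)" .
    also have "\<dots> \<le> dist x (z j) + dist x (z i)" by (rule dist_triangle3)
    also have "\<dots> < 2 * \<rho>" using that by (simp add: B_def dist_commute)
    finally show False by simp
  qed
  have single: "(\<Sum>j\<in>{1..N}. g j * indicator (B j) x) = g i"
    "(\<Sum>j\<in>{1..N}. indicator (B j) x *\<^sub>R k j) = k i"
    "(\<Sum>j\<in>{1..N}. e j * indicator (B j) x) = e i"
    if "i \<in> {1..N}" "x \<in> B i" for i x and g :: "nat \<Rightarrow> real" and k :: "nat \<Rightarrow> 'a"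
      and e :: "nat \<Rightarrow> ennreal"
  proof -
    have ind: "indicator (B j) x = (if j = i then 1 else 0 :: real)"
      "indicator (B j) x = (if j = i then 1 else 0 :: ennreal)" if "j \<in> {1..N}" for j
      using disj[OF \<open>i \<in> _\<close> that \<open>x \<in> B i\<close>] \<open>x \<in> B i\<close> by (cases "j = i"; force)+
    have "(\<Sum>j\<in>{1..N}. g j * indicator (B j) x) = (\<Sum>j\<in>{1..N}. if j = i then g j else 0)"
      by (intro sum.cong) (auto simp: ind)
    then show "(\<Sum>j\<in>{1..N}. g j * indicator (B j) x) = g i" using that by simp
    have "(\<Sum>j\<in>{1..N}. e j * indicator (B j) x) = (\<Sum>j\<in>{1..N}. if j = i then e j else 0)"
      by (intro sum.cong) (auto simp: ind)
    then show "(\<Sum>j\<in>{1..N}. e j * indicator (B j) x) = e i" using that by simp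
    have "(\<Sum>j\<in>{1..N}. indicator (B j) x *\<^sub>R k j) = (\<Sum>j\<in>{1..N}. if j = i then k j else 0)"
      by (intro sum.cong) (auto simp: ind)
    then show "(\<Sum>j\<in>{1..N}. indicator (B j) x *\<^sub>R k j) = k i" using that by simp
  qed
  have cases: "(\<exists>i\<in>{1..N}. x \<in> B i \<and> h x = c i \<and> T x = z i) \<or> ((\<forall>i\<in>{1..N}. x \<notin> B i) \<and> h x = 0)" for x
  proof (cases "\<exists>i\<in>{1..N}. x \<in> B i")
    case True
    then obtain i where "i \<in> {1..N}" "x \<in> B i" by blast
    then show ?thesis using single(1)[of i x c] single(2)[of i x z] unfolding h_def T_def by blast
  next
    case False
    then show ?thesis by (simp add: h_def)
  qed
  have h02: "0 \<le> h x" "h x \<le> 2" for x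
    using cases[of x] c by (metis order_refl zero_le_numeral)+
  have h_meas [measurable]: "h \<in> borel_measurable borel" unfolding h_def by measurable
  have T_meas [measurable]: "T \<in> borel_measurable borel" unfolding T_def by measurable
  define \<nu>' where "\<nu>' = density \<nu> (\<lambda>x. ennreal (h x))"
  have fin': "finite_measure \<nu>'"
    unfolding \<nu>'_def using h02 by (intro finite_measure_density_bounded[OF fin _ ennreal_leI]) auto
  have s': "sets \<nu>' = sets borel" by (simp add: \<nu>'_def s)
  have target: "distr \<nu>' borel T = atomic_measure N m z"
  proof (rule measure_eqI)
    fix S assume "S \<in> sets (distr \<nu>' borel T)"
    then have S [measurable]: "S \<in> sets borel" by simp
    have "emeasure (distr \<nu>' borel T) S = emeasure \<nu>' (T -` S)"
      by (subst emeasure_distr) (auto simp: \<nu>'_def sp)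
    also have "\<dots> = (\<integral>\<^sup>+x. ennreal (h x) * indicator (T -` S) x \<partial>\<nu>)"
      unfolding \<nu>'_def using measurable_sets_borel[OF T_meas S]
      by (subst emeasure_density) (auto simp: s)
    also have "\<dots> = (\<integral>\<^sup>+x. (\<Sum>i\<in>{1..N}. ennreal (c i) * indicator S (z i) * indicator (B i) x) \<partial>\<nu>)"
    proof (rule nn_integral_cong)
      fix x
      show "ennreal (h x) * indicator (T -` S) x =
        (\<Sum>i\<in>{1..N}. ennreal (c i) * indicator S (z i) * indicator (B i) x)"
      proof (cases "\<exists>i\<in>{1..N}. x \<in> B i")
        case True
        then obtain i where i: "i \<in> {1..N}" "x \<in> B i" by auto
        then have "h x = c i" "T x = z i" using single by (auto simp: h_def T_def)
        then show ?thesis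
          using single(3)[OF i, of "\<lambda>i. ennreal (c i) * indicator S (z i)"] by (simp add: indicator_def)
      next
        case False
        then have "h x = 0" using cases[of x] by auto
        with False show ?thesis by simp
      qed
    qed
    also have "\<dots> = (\<Sum>i\<in>{1..N}. ennreal (c i) * indicator S (z i) * emeasure \<nu> (B i))"
      by (subst nn_integral_sum) (auto simp: nn_integral_cmult_indicator s)
    also have "\<dots> = (\<Sum>i\<in>{1..N}. ennreal (m i) * indicator S (z i))"
    proof (rule sum.cong)
      fix i assume i: "i \<in> {1..N}"
      have "ennreal (c i) * emeasure \<nu> (B i) = ennreal (c i * measure \<nu> (B i))"
        using c[OF i] by (simp add: emeasure_eq_measure ennreal_mult)
      also have "c i * measure \<nu> (B i) = m i" using pos[OF i] by (simp add: c_def)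
      finally show "ennreal (c i) * indicator S (z i) * emeasure \<nu> (B i) = ennreal (m i) * indicator S (z i)"
        by (simp add: indicator_def)
    qed simp
    finally show "emeasure (distr \<nu>' borel T) S = emeasure (atomic_measure N m z) S"
      using S by (simp add: emeasure_atomic_measure)
  qed simp
  have "wasserstein2_sq \<nu>' (atomic_measure N m z) \<le> (\<integral>\<^sup>+x. ennreal ((dist x (T x))\<^sup>2) \<partial>\<nu>')"
    using graph_coupling[OF fin' s' T_meas] target by simp
  also have "\<dots> = (\<integral>\<^sup>+x. ennreal (h x) * ennreal ((dist x (T x))\<^sup>2) \<partial>\<nu>)"
    unfolding \<nu>'_def by (subst nn_integral_density) auto
  \<comment> \<open>On a ball the distance to its centre is the capped minimum, because the other
    centres are at distance at least \<rho>; the factor 2 bounds \<open>h\<close>.\<close>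
  also have "\<dots> \<le> (\<integral>\<^sup>+x. ennreal 2 * ennreal ((capped_min \<rho> N (\<lambda>i. dist x (z i)))\<^sup>2) \<partial>\<nu>)"
  proof (rule nn_integral_mono)
    fix x
    show "ennreal (h x) * ennreal ((dist x (T x))\<^sup>2)
      \<le> ennreal 2 * ennreal ((capped_min \<rho> N (\<lambda>i. dist x (z i)))\<^sup>2)"
    proof (cases "\<exists>i\<in>{1..N}. x \<in> B i")
      case True
      then obtain i where i: "i \<in> {1..N}" "x \<in> B i" by auto
      then have Tx: "T x = z i" using single by (auto simp: T_def)
      have eq: "capped_min \<rho> N (\<lambda>i. dist x (z i)) = dist x (z i)"
      proof (rule capped_min_eqI[OF i(1)])
        show "dist x (z i) \<le> \<rho>" using i by (simp add: B_def dist_commute)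
        fix j assume j: "j \<in> {1..N}" "j \<noteq> i"
        then have "\<not> dist x (z j) < \<rho>" using disj[OF i(1) j(1) i(2)] by (auto simp: B_def dist_commute)
        then show "dist x (z i) \<le> dist x (z j)" using i by (simp add: B_def dist_commute)
      qed
      show ?thesis unfolding Tx eq using h02[of x] by (intro mult_right_mono ennreal_leI) auto
    next
      case False
      then have "h x = 0" using cases[of x] by auto
      then show ?thesis by simp
    qed
  qed
  also have "\<dots> \<le> ennreal 2 * ennreal A"
    using int by (subst nn_integral_cmult) (auto intro!: mult_left_mono)
  also have "\<dots> = ennreal (2 * A)" using A by (simp add: ennreal_mult)
  finally have W: "wasserstein2_sq \<nu>' (atomic_measure N m z) \<le> ennreal (2 * A)" .

  \<comment> \<open>This is the variation of \<open>\<nu> - \<nu>'\<close>, written as a density to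
    avoid a Hahn decomposition.\<close>
  define \<tau> where "\<tau> = density \<nu> (\<lambda>x. ennreal \<bar>1 - h x\<bar>)"
  have fint: "finite_measure \<tau>"
    unfolding \<tau>_def
    using h02 by (intro finite_measure_density_bounded[OF fin _ ennreal_leI[where y = 1]]) (auto simp: abs_le_iff algebra_simps)
  interpret \<nu>': finite_measure \<nu>' by fact
  interpret \<tau>: finite_measure \<tau> by fact
  have "tv_norm (\<lambda>S. measure \<nu> S - measure \<nu>' S) \<le> measure \<tau> UNIV + measure (null_measure borel) (UNIV::'a set)"
  proof (rule tv_norm_diff_le[OF fint])
    show "finite_measure (null_measure (borel :: 'a measure))" by (rule finite_measureI) simp
    show "sets \<tau> = sets borel" by (simp add: \<tau>_def s)
    fix S :: "'a set" assume S: "S \<in> sets borel"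
    have one: "density \<nu> (\<lambda>_. 1) = \<nu>" by (rule density_1)
    have dens: "1 \<le> ennreal (h x) + ennreal \<bar>1 - h x\<bar>" "ennreal (h x) \<le> 1 + ennreal \<bar>1 - h x\<bar>" for x
    proof -
      have "ennreal 1 \<le> ennreal (h x + \<bar>1 - h x\<bar>)" "ennreal (h x) \<le> ennreal (1 + \<bar>1 - h x\<bar>)"
        by (intro ennreal_leI; linarith)+
      then show "1 \<le> ennreal (h x) + ennreal \<bar>1 - h x\<bar>" "ennreal (h x) \<le> 1 + ennreal \<bar>1 - h x\<bar>"
        using h02(1)[of x] by simp_all
    qed
    have "emeasure \<nu> S \<le> emeasure \<nu>' S + emeasure \<tau> S"
      unfolding \<nu>'_def \<tau>_def
      using emeasure_density_triangle[of "\<lambda>_. 1" \<nu> "\<lambda>x. ennreal (h x)" "\<lambda>x. ennreal \<bar>1 - h x\<bar>" S] S dens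
      by (simp add: one s)
    then have 1: "measure \<nu> S \<le> measure \<nu>' S + measure \<tau> S"
      by (simp add: emeasure_eq_measure \<nu>'.emeasure_eq_measure \<tau>.emeasure_eq_measure flip: ennreal_plus)
    have "emeasure \<nu>' S \<le> emeasure (density \<nu> (\<lambda>_. 1)) S + emeasure \<tau> S"
      unfolding \<nu>'_def \<tau>_def
      using emeasure_density_triangle[of "\<lambda>x. ennreal (h x)" \<nu> "\<lambda>_. 1" "\<lambda>x. ennreal \<bar>1 - h x\<bar>" S] S dens
      by (simp add: s)
    then have "measure \<nu>' S \<le> measure \<nu> S + measure \<tau> S"
      by (simp add: one emeasure_eq_measure \<nu>'.emeasure_eq_measure \<tau>.emeasure_eq_measure flip: ennreal_plus)
    with 1 show "\<bar>measure \<nu> S - measure \<nu>' S\<bar> \<le> measure \<tau> S + measure (null_measure borel) S" by simp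
  qed simp
  moreover have "measure \<tau> UNIV \<le> A / \<rho>\<^sup>2 + N * A"
  proof -
    let ?O = "{x. \<forall>i\<in>{1..N}. \<rho> \<le> dist x (z i)}"
    have O [measurable]: "?O \<in> sets borel" by measurable
    have mO: "measure \<nu> ?O \<le> A / \<rho>\<^sup>2"
      using measure_capped_min_ge[OF fin _ int \<rho> order_refl A] by (simp add: sp)
    have "emeasure \<tau> UNIV = (\<integral>\<^sup>+x. ennreal \<bar>1 - h x\<bar> \<partial>\<nu>)"
      unfolding \<tau>_def by (subst emeasure_density) (use s in auto)
    \<comment> \<open>Off the balls the density of \<tau> is 1, and Chebyshev's inequality applies.
      On the i-th ball it is \<open>\<bar>1 - c i\<bar>\<close>, whose integral is exactly the mass
      error of that ball by the choice of \<open>c i\<close>.\<close>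
    also have "\<dots> \<le> (\<integral>\<^sup>+x. indicator ?O x + (\<Sum>i\<in>{1..N}. ennreal \<bar>1 - c i\<bar> * indicator (B i) x) \<partial>\<nu>)"
    proof (rule nn_integral_mono)
      fix x
      show "ennreal \<bar>1 - h x\<bar> \<le> indicator ?O x + (\<Sum>i\<in>{1..N}. ennreal \<bar>1 - c i\<bar> * indicator (B i) x)"
      proof (cases "\<exists>i\<in>{1..N}. x \<in> B i")
        case True
        then obtain i where i: "i \<in> {1..N}" "x \<in> B i" by auto
        then have "h x = c i" using single by (auto simp: h_def)
        then show ?thesis using single(3)[OF i, of "\<lambda>i. ennreal \<bar>1 - c i\<bar>"] by (simp add: add_increasing)
      next
        case False
        then have "h x = 0" using cases[of x] by auto
        moreover have "x \<in> ?O" using False by (auto simp: B_def dist_commute not_less)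
        ultimately show ?thesis by (simp add: add_increasing2)
      qed
    qed
    also have "\<dots> = emeasure \<nu> ?O + (\<Sum>i\<in>{1..N}. ennreal \<bar>1 - c i\<bar> * emeasure \<nu> (B i))"
    proof -
      have "(\<integral>\<^sup>+x. (\<Sum>i\<in>{1..N}. ennreal \<bar>1 - c i\<bar> * indicator (B i) x) \<partial>\<nu>)
          = (\<Sum>i\<in>{1..N}. \<integral>\<^sup>+x. ennreal \<bar>1 - c i\<bar> * indicator (B i) x \<partial>\<nu>)"
        by (rule nn_integral_sum) measurable
      also have "\<dots> = (\<Sum>i\<in>{1..N}. ennreal \<bar>1 - c i\<bar> * emeasure \<nu> (B i))"
        using s B by (intro sum.cong refl nn_integral_cmult_indicator) simp
      finally have eq: "(\<integral>\<^sup>+x. (\<Sum>i\<in>{1..N}. ennreal \<bar>1 - c i\<bar> * indicator (B i) x) \<partial>\<nu>)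
          = (\<Sum>i\<in>{1..N}. ennreal \<bar>1 - c i\<bar> * emeasure \<nu> (B i))" .
      have m1: "indicator ?O \<in> borel_measurable \<nu>" using O s by simp
      have m2: "(\<lambda>x. \<Sum>i\<in>{1..N}. ennreal \<bar>1 - c i\<bar> * indicator (B i) x) \<in> borel_measurable \<nu>" by measurable
      show ?thesis
        unfolding nn_integral_add[OF m1 m2] eq using O s by (subst nn_integral_indicator) (simp_all only:)
    qed
    also have "\<dots> \<le> ennreal (A / \<rho>\<^sup>2) + (\<Sum>i\<in>{1..N}. ennreal A)"
    proof (intro add_mono sum_mono)
      show "emeasure \<nu> ?O \<le> ennreal (A / \<rho>\<^sup>2)" using mO by (simp add: emeasure_eq_measure ennreal_leI)
      fix i assume i: "i \<in> {1..N}"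
      have "ennreal \<bar>1 - c i\<bar> * emeasure \<nu> (B i) = ennreal (\<bar>1 - c i\<bar> * measure \<nu> (B i))"
        by (simp add: emeasure_eq_measure ennreal_mult)
      also have "\<bar>1 - c i\<bar> * measure \<nu> (B i) = \<bar>(1 - c i) * measure \<nu> (B i)\<bar>" by (simp add: abs_mult)
      also have "(1 - c i) * measure \<nu> (B i) = measure \<nu> (B i) - m i"
        using pos[OF i] by (simp add: c_def field_simps)
      finally show "ennreal \<bar>1 - c i\<bar> * emeasure \<nu> (B i) \<le> ennreal A"
        using mass[OF i] by (simp add: B_def ennreal_leI)
    qed
    also have "\<dots> = ennreal (A / \<rho>\<^sup>2 + N * A)" using A by (simp add: ennreal_mult flip: ennreal_of_nat_eq_real_of_nat)
    finally have "ennreal (measure \<tau> UNIV) \<le> ennreal (A / \<rho>\<^sup>2 + N * A)"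
      by (simp add: \<tau>.emeasure_eq_measure)
    then show ?thesis using A by (subst (asm) ennreal_le_iff) auto
  qed
  ultimately have tv: "tv_norm (\<lambda>S. measure \<nu> S - measure \<nu>' S) \<le> A / \<rho>\<^sup>2 + N * A" by simp
  have "\<nu>' \<in> pos_measures UNIV" using s' fin' by (auto simp: pos_measures_def)
  then show ?thesis
    by (rule unbalanced_wasserstein2_sq_le[OF _ W _ _ tv]) (use A in auto)
qed

text \<open>If some ball holds less than half of its mass, then \<open>m k \<le> 2 * A\<close>, so A
  is bounded below and a crude bound is affordable: nothing is transported, the intermediate measure
  is the target itself, and the variation is at most the sum of the total masses.\<close>

lemma unbalanced_wasserstein2_sq_atomic_measure_far:
  fixes \<nu> :: "'a::euclidean_space measure"
  assumes m: "\<And>i. i \<in> {1..N} \<Longrightarrow> 0 < m i" and \<rho>: "0 < \<rho>" and A: "0 \<le> A"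
    and fin: "finite_measure \<nu>" and s: "sets \<nu> = sets borel"
    and int: "capped_cost \<nu> \<rho> N (\<lambda>x i. dist x (z i)) \<le> ennreal A"
    and mass: "\<And>i. i \<in> {1..N} \<Longrightarrow> \<bar>measure \<nu> (ball (z i) \<rho>) - m i\<bar> \<le> A"
    and k: "k \<in> {1..N}" "2 * measure \<nu> (ball (z k) \<rho>) < m k"
  shows "unbalanced_wasserstein2_sq 1 \<nu> (atomic_measure N m z)
    \<le> ennreal (A / \<rho>\<^sup>2 + N * A + 4 * (\<Sum>i\<in>{1..N}. m i) * (\<Sum>i\<in>{1..N}. 1 / m i) * A)"
proof -
  interpret finite_measure \<nu> by fact
  have sp: "space \<nu> = UNIV" using sets_eq_imp_space_eq[OF s] by simp
  note [measurable_cong] = s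
  let ?\<nu> = "atomic_measure N m z"
  let ?S = "\<Sum>i\<in>{1..N}. m i" and ?I = "\<Sum>i\<in>{1..N}. 1 / m i"
  let ?O = "{x. \<forall>i\<in>{1..N}. \<rho> \<le> dist x (z i)}"
  have O [measurable]: "?O \<in> sets borel" by measurable
  have mO: "measure \<nu> ?O \<le> A / \<rho>\<^sup>2"
    using measure_capped_min_ge[OF fin _ int \<rho> order_refl A] by (simp add: sp)
  have "UNIV \<subseteq> ?O \<union> (\<Union>i\<in>{1..N}. ball (z i) \<rho>)" by (auto simp: dist_commute not_less)
  then have "measure \<nu> UNIV \<le> measure \<nu> (?O \<union> (\<Union>i\<in>{1..N}. ball (z i) \<rho>))"
    by (intro finite_measure_mono) (auto simp: s)
  also have "\<dots> \<le> measure \<nu> ?O + measure \<nu> (\<Union>i\<in>{1..N}. ball (z i) \<rho>)"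
    by (intro measure_Un_le) (auto simp: s)
  also have "\<dots> \<le> A / \<rho>\<^sup>2 + (\<Sum>i\<in>{1..N}. measure \<nu> (ball (z i) \<rho>))"
    using mO by (intro add_mono measure_UNION_le) (auto simp: s)
  also have "\<dots> \<le> A / \<rho>\<^sup>2 + (\<Sum>i\<in>{1..N}. m i + A)"
    using mass by (intro add_left_mono sum_mono) (simp add: abs_le_iff algebra_simps)
  finally have 1: "measure \<nu> UNIV \<le> A / \<rho>\<^sup>2 + ?S + N * A" by (simp add: sum.distrib)
  have 2: "measure ?\<nu> UNIV = ?S" using m by (subst measure_atomic_measure) (auto simp: less_imp_le)
  \<comment> \<open>From here 1 is bounded by a multiple of A. Summing \<open>1 / m i\<close> over
    all i makes the multiple independent of the deficient index, and the constant mass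
    \<open>2 * ?S\<close> is absorbed in this way.\<close>
  have "m k \<le> 2 * A" using mass[OF k(1)] k(2) by linarith
  then have "1 \<le> 2 * A * (1 / m k)" using m[OF k(1)] by (simp add: field_simps)
  also have "\<dots> \<le> 2 * A * ?I"
    using A m k(1) by (intro mult_left_mono member_le_sum) (auto simp: less_imp_le)
  finally have "?S * 1 \<le> ?S * (2 * A * ?I)" using m by (intro mult_left_mono sum_nonneg) (auto simp: less_imp_le)
  then have 3: "2 * ?S \<le> 4 * ?S * ?I * A" by (simp add: mult_ac)
  have "tv_norm (\<lambda>S. measure \<nu> S - measure ?\<nu> S) \<le> measure \<nu> UNIV + measure ?\<nu> UNIV"
    by (rule tv_norm_diff_le) (use fin finite_measure_atomic_measure s in \<open>auto simp: abs_le_iff add_increasing add_increasing2\<close>)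
  with 1 2 3 have tv: "tv_norm (\<lambda>S. measure \<nu> S - measure ?\<nu> S) \<le> A / \<rho>\<^sup>2 + N * A + 4 * ?S * ?I * A" by linarith
  have "wasserstein2_sq ?\<nu> (distr ?\<nu> borel (\<lambda>x. x)) \<le> (\<integral>\<^sup>+x. ennreal ((dist x x)\<^sup>2) \<partial>?\<nu>)"
    by (rule graph_coupling) (auto simp: finite_measure_atomic_measure)
  then have W: "wasserstein2_sq ?\<nu> ?\<nu> \<le> ennreal 0" by (simp add: distr_id2)
  have "?\<nu> \<in> pos_measures UNIV" by (rule atomic_measure_in_pos_measures) simp
  then have "unbalanced_wasserstein2_sq 1 \<nu> ?\<nu> \<le> ennreal (0 + (A / \<rho>\<^sup>2 + N * A + 4 * ?S * ?I * A))"
    by (rule unbalanced_wasserstein2_sq_le[OF _ W _ _ tv])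
       (use A m in \<open>auto intro!: add_nonneg_nonneg mult_nonneg_nonneg sum_nonneg simp: less_imp_le\<close>)
  then show ?thesis by simp
qed

text \<open>The positions \<open>z\<close> are quantified after C: one constant must serve for all
  times and all directions, for which the masses agree but the atoms move.\<close>

proposition unbalanced_wasserstein2_sq_atomic_measure:
  assumes m: "\<And>i. i \<in> {1..N} \<Longrightarrow> 0 < m i" and \<rho>: "0 < \<rho>"
  obtains C where "0 < C"
    "\<And>(\<nu> :: 'a::euclidean_space measure) z A. finite_measure \<nu> \<Longrightarrow> sets \<nu> = sets borel \<Longrightarrow> 0 \<le> A \<Longrightarrow>
      (\<And>i j. i \<in> {1..N} \<Longrightarrow> j \<in> {1..N} \<Longrightarrow> i \<noteq> j \<Longrightarrow> 2 * \<rho> \<le> dist (z i) (z j)) \<Longrightarrow>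
      capped_cost \<nu> \<rho> N (\<lambda>x i. dist x (z i)) \<le> ennreal A \<Longrightarrow>
      (\<And>i. i \<in> {1..N} \<Longrightarrow> \<bar>measure \<nu> (ball (z i) \<rho>) - m i\<bar> \<le> A) \<Longrightarrow>
      unbalanced_wasserstein2_sq 1 \<nu> (atomic_measure N m z) \<le> ennreal (C * A)"
proof
  define F where "F = 4 * (\<Sum>i\<in>{1..N}. m i) * (\<Sum>i\<in>{1..N}. 1 / m i)"
  have F: "0 \<le> F" unfolding F_def using m by (auto intro!: mult_nonneg_nonneg sum_nonneg simp: less_imp_le)
  show "0 < 2 + 1 / \<rho>\<^sup>2 + N + F" using F by (simp add: add_pos_nonneg)
  fix \<nu> :: "'a measure" and z A
  assume *: "finite_measure \<nu>" "sets \<nu> = sets borel" "0 \<le> A"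
    and sep: "\<And>i j. i \<in> {1..N} \<Longrightarrow> j \<in> {1..N} \<Longrightarrow> i \<noteq> j \<Longrightarrow> 2 * \<rho> \<le> dist (z i) (z j)"
    and int: "capped_cost \<nu> \<rho> N (\<lambda>x i. dist x (z i)) \<le> ennreal A"
    and mass: "\<And>i. i \<in> {1..N} \<Longrightarrow> \<bar>measure \<nu> (ball (z i) \<rho>) - m i\<bar> \<le> A"
  show "unbalanced_wasserstein2_sq 1 \<nu> (atomic_measure N m z) \<le> ennreal ((2 + 1 / \<rho>\<^sup>2 + N + F) * A)"
  proof (cases "\<forall>i\<in>{1..N}. m i \<le> 2 * measure \<nu> (ball (z i) \<rho>)")
    case True
    have "unbalanced_wasserstein2_sq 1 \<nu> (atomic_measure N m z) \<le> ennreal (2 * A + (A / \<rho>\<^sup>2 + N * A))"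
      by (rule unbalanced_wasserstein2_sq_atomic_measure_near[OF m \<rho> *(3,1,2) sep int mass])
         (use True in auto)
    also have "\<dots> \<le> ennreal ((2 + 1 / \<rho>\<^sup>2 + N + F) * A)"
      using F *(3) by (intro ennreal_leI) (simp add: algebra_simps)
    finally show ?thesis .
  next
    case False
    then obtain k where "k \<in> {1..N}" "2 * measure \<nu> (ball (z k) \<rho>) < m k" by (auto simp: not_le)
    from unbalanced_wasserstein2_sq_atomic_measure_far[OF m \<rho> *(3,1,2) int mass this]
    have "unbalanced_wasserstein2_sq 1 \<nu> (atomic_measure N m z) \<le> ennreal (A / \<rho>\<^sup>2 + N * A + F * A)"
      by (simp add: F_def)
    also have "\<dots> \<le> ennreal ((2 + 1 / \<rho>\<^sup>2 + N + F) * A)"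
      using F *(3) by (intro ennreal_leI) (simp add: algebra_simps)
    finally show ?thesis .
  qed
qed

subsection \<open>Certificates for atomic measures\<close>

lemma signed_atomic_eq:
  "A \<in> sets borel \<Longrightarrow> signed_atomic N s z A = (\<Sum>i\<in>{1..N}. s i * indicator A (z i))"
  unfolding signed_atomic_def by (intro sum.cong) (auto simp: measure_return)

text \<open>The supremum over Borel subsets is attained at the atoms of positive weight. Injectivity
  excludes that weights of opposite sign meet at one point and cancel.\<close>

lemma jordan_pos_signed_atomic:
  fixes z :: "nat \<Rightarrow> 'a::t1_space"
  assumes "inj_on z {1..N}"
  shows "jordan_pos (signed_atomic N s z) = atomic_measure N (\<lambda>i. max 0 (s i)) z"
proof -
  let ?\<nu> = "atomic_measure N (\<lambda>i. max 0 (s i)) z"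
  have SUP: "(SUP B \<in> {B \<in> sets borel. B \<subseteq> A}. signed_atomic N s z B) = measure ?\<nu> A"
    if A: "A \<in> sets borel" for A
  proof (rule cSup_eq_maximum)
    have m: "measure ?\<nu> A = (\<Sum>i\<in>{1..N}. max 0 (s i) * indicator A (z i))"
      by (rule measure_atomic_measure[OF A]) simp
    let ?F = "z ` {i\<in>{1..N}. 0 < s i}"
    let ?B = "A \<inter> ?F"
    have B: "?B \<in> sets borel" using A by (intro sets.Int borel_closed finite_imp_closed) auto
    have "indicator ?B (z i) = (if 0 < s i then indicator A (z i) else 0 :: real)" if "i \<in> {1..N}" for i
      using assms that by (auto simp: indicator_def dest: inj_onD)
    then have "signed_atomic N s z ?B = measure ?\<nu> A"
      unfolding m signed_atomic_eq[OF B] by (intro sum.cong) auto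
    with B show "measure ?\<nu> A \<in> signed_atomic N s z ` {B \<in> sets borel. B \<subseteq> A}"
      by (intro image_eqI[where x = ?B]) auto
    fix r assume "r \<in> signed_atomic N s z ` {B \<in> sets borel. B \<subseteq> A}"
    then obtain C where C: "C \<in> sets borel" "C \<subseteq> A" "r = signed_atomic N s z C" by auto
    show "r \<le> measure ?\<nu> A"
      unfolding m C signed_atomic_eq[OF C(1)]
      using C(2) by (intro sum_mono) (auto simp: indicator_def)
  qed
  have "jordan_pos (signed_atomic N s z) = measure_of UNIV (sets borel) (emeasure ?\<nu>)"
    unfolding jordan_pos_def
  proof (rule measure_of_eq)
    fix A :: "'a set" assume "A \<in> sigma_sets UNIV (sets borel)"
    then have "A \<in> sets borel" using sets.sigma_sets_eq[of "borel :: 'a measure"] by simp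
    then show "ennreal (SUP B \<in> {B \<in> sets borel. B \<subseteq> A}. signed_atomic N s z B) = emeasure ?\<nu> A"
      by (simp add: SUP finite_measure.emeasure_eq_measure[OF finite_measure_atomic_measure])
  qed auto
  also have "\<dots> = ?\<nu>" using measure_of_of_measure[of ?\<nu>] by simp
  finally show ?thesis .
qed

lemma signed_integral_signed_atomic:
  fixes z :: "nat \<Rightarrow> 'a::t2_space"
  assumes "inj_on z {1..N}" "\<And>i. i \<in> {1..N} \<Longrightarrow> z i \<in> \<Omega>" "compact \<Omega>" "continuous_on \<Omega> \<phi>"
  shows "signed_integral \<Omega> (signed_atomic N s z) \<phi> = (\<Sum>i\<in>{1..N}. s i * \<phi> (z i))"
proof -
  have neg: "(\<lambda>A. - signed_atomic N s z A) = signed_atomic N (\<lambda>i. - s i) z"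
    by (simp add: signed_atomic_def fun_eq_iff sum_negf)
  have meas: "(\<lambda>x. indicator \<Omega> x *\<^sub>R \<phi> x) \<in> borel_measurable borel"
    using assms by (intro borel_measurable_continuous_on_indicator borel_compact)
  have "signed_integral \<Omega> (signed_atomic N s z) \<phi> =
    (\<Sum>i\<in>{1..N}. max 0 (s i) * (indicator \<Omega> (z i) *\<^sub>R \<phi> (z i)))
    - (\<Sum>i\<in>{1..N}. max 0 (- s i) * (indicator \<Omega> (z i) *\<^sub>R \<phi> (z i)))"
    unfolding signed_integral_def neg jordan_pos_signed_atomic[OF assms(1)] set_lebesgue_integral_def
    by (intro arg_cong2[where f = minus] integral_atomic_measure meas) auto
  also have "\<dots> = (\<Sum>i\<in>{1..N}. s i * \<phi> (z i))"
    unfolding sum_subtractf[symmetric] using assms(2) by (intro sum.cong) (auto simp: max_def)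
  finally show ?thesis .
qed

text \<open>Separating the positive atoms from the rest already gives one unit per atom. The lower
  bound is the direction that forces a subgradient to attain the prescribed signs.\<close>

lemma tv_norm_signed_atomic_ge:
  fixes z :: "nat \<Rightarrow> 'a::t1_space"
  assumes "inj_on z {1..N}" "\<And>i. i \<in> {1..N} \<Longrightarrow> s i \<in> {-1, 1}"
  shows "real N \<le> tv_norm (signed_atomic N s z)"
proof -
  let ?\<mu> = "signed_atomic N s z"
  let ?\<P> = "{P. finite P \<and> P \<subseteq> sets (borel :: 'a measure) \<and> partition_on UNIV P}"
  define A where "A = z ` {i\<in>{1..N}. s i = 1}"
  \<comment> \<open>\<open>partition_on\<close> does not admit the empty set, and one of the two
    parts may be empty; its term in the sum is 0.\<close>
  define P where "P = {A, - A} - {{}}"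
  have A: "A \<in> sets borel" unfolding A_def by (intro borel_closed finite_imp_closed) auto
  have P: "P \<in> ?\<P>" using A by (auto simp: P_def partition_on_def disjoint_def)
  have "(\<Sum>i\<in>{1..N}. s i * indicator A (z i) - s i * indicator (- A) (z i)) = (\<Sum>i\<in>{1..N}. 1)"
  proof (rule sum.cong)
    fix i assume i: "i \<in> {1..N}"
    have "z i \<in> A \<longleftrightarrow> s i = 1" using assms(1) i by (auto simp: A_def dest: inj_onD)
    then show "s i * indicator A (z i) - s i * indicator (- A) (z i) = 1"
      using assms(2)[OF i] by (auto simp: indicator_def)
  qed simp
  then have "real N = ?\<mu> A - ?\<mu> (- A)"
    using A by (simp add: signed_atomic_eq sum_subtractf)
  also have "\<dots> \<le> \<bar>?\<mu> A\<bar> + \<bar>?\<mu> (- A)\<bar>" by linarith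
  also have "\<dots> = (\<Sum>B\<in>{A, - A}. \<bar>?\<mu> B\<bar>)" by (subst sum.insert) auto
  also have "\<dots> = (\<Sum>B\<in>P. \<bar>?\<mu> B\<bar>)"
    unfolding P_def by (intro sum.mono_neutral_right) (auto simp: signed_atomic_def)
  also have "\<dots> \<le> tv_norm ?\<mu>"
    unfolding tv_norm_def
  \<comment> \<open>A real supremum dominates its members only if the family is bounded above; the
    measure with unit masses at the atoms provides the bound.\<close>
  proof (rule cSUP_upper[OF P], rule bdd_aboveI2)
    fix P assume P: "P \<in> ?\<P>"
    let ?\<nu> = "atomic_measure N (\<lambda>_. 1) z"
    have "(\<Sum>B\<in>P. \<bar>?\<mu> B\<bar>) \<le> (\<Sum>B\<in>P. measure ?\<nu> B)"
    proof (rule sum_mono)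
      fix B assume "B \<in> P"
      then have B: "B \<in> sets borel" using P by auto
      have "\<bar>?\<mu> B\<bar> \<le> (\<Sum>i\<in>{1..N}. \<bar>s i * indicator B (z i)\<bar>)"
        unfolding signed_atomic_eq[OF B] by (rule sum_abs)
      also have "\<dots> \<le> (\<Sum>i\<in>{1..N}. 1 * indicator B (z i))"
        using assms(2) by (intro sum_mono) (force simp: indicator_def)
      also have "\<dots> = measure ?\<nu> B" using B by (subst measure_atomic_measure) auto
      finally show "\<bar>?\<mu> B\<bar> \<le> measure ?\<nu> B" .
    qed
    also have "\<dots> = measure ?\<nu> UNIV"
      using P by (intro sum_measure_partition finite_measure_atomic_measure) auto
    finally show "(\<Sum>B\<in>P. \<bar>?\<mu> B\<bar>) \<le> measure ?\<nu> UNIV" .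
  qed
  finally show ?thesis .
qed

text \<open>The N numbers \<open>s i * \<phi> (z i)\<close> are at most 1 and their sum is at least
  N, so each of them equals 1.\<close>

lemma tv_subdifferential_signed_atomic:
  fixes z :: "nat \<Rightarrow> 'a::euclidean_space"
  assumes z: "inj_on z {1..N}" "\<And>i. i \<in> {1..N} \<Longrightarrow> z i \<in> \<Omega>" and "compact \<Omega>"
    and s: "\<And>i. i \<in> {1..N} \<Longrightarrow> s i \<in> {-1, 1}"
    and \<phi>: "\<phi> \<in> tv_subdifferential \<Omega> (signed_atomic N s z)"
    and i: "i \<in> {1..N}"
  shows "\<phi> (z i) = s i"
proof -
  have cont: "continuous_on \<Omega> \<phi>" and le: "\<bar>\<phi> (z i)\<bar> \<le> 1" if "i \<in> {1..N}" for i
    using \<phi> z(2)[OF that] by (auto simp: tv_subdifferential_def)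
  have "real N \<le> signed_integral \<Omega> (signed_atomic N s z) \<phi>"
    using tv_norm_signed_atomic_ge[OF z(1) s] \<phi> by (simp add: tv_subdifferential_def)
  also have "\<dots> = (\<Sum>i\<in>{1..N}. s i * \<phi> (z i))"
    by (rule signed_integral_signed_atomic) (use assms cont i in auto)
  finally have "(\<Sum>i\<in>{1..N}. 1 - s i * \<phi> (z i)) \<le> 0" by (simp add: sum_subtractf)
  moreover have nn: "0 \<le> 1 - s i * \<phi> (z i)" if "i \<in> {1..N}" for i
    using s[OF that] le[OF that] by auto
  ultimately have "1 - s i * \<phi> (z i) = 0"
    using i by (metis (mono_tags, lifting) finite_atLeastAtMost order_antisym sum_nonneg sum_nonneg_eq_0_iff)
  then show ?thesis using s[OF i] by auto
qed

section \<open>Integrals of continuous functions over \<Omega> and what certificates say about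
  them\<close>

lemma measure_in_signed_measures:
  fixes X :: "'a::topological_space set"
  assumes "\<nu> \<in> pos_measures X"
  shows "measure \<nu> \<in> signed_measures X"
proof -
  interpret finite_measure \<nu> using assms by (rule pos_measuresD)
  show ?thesis
    unfolding signed_measures_def
  proof (intro CollectI conjI allI impI ballI)
    fix A :: "nat \<Rightarrow> 'a set" assume "range A \<subseteq> sets borel" "disjoint_family A"
    then show "(\<lambda>i. measure \<nu> (A i)) sums measure \<nu> (\<Union>i. A i)"
      by (intro finite_measure_UNION) (auto simp: pos_measuresD[OF assms])
  next
    fix A :: "'a set" assume "A \<in> sets borel" "A \<inter> X = {}"
    then show "measure \<nu> A = 0" using assms by (auto simp: pos_measures_def measure_def)
  next
    fix A :: "'a set" assume "A \<notin> sets borel"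
    then show "measure \<nu> A = 0" by (simp add: measure_notin_sets pos_measuresD[OF assms])
  qed
qed

lemma set_integrable_continuous_on_compact:
  fixes f :: "'a::euclidean_space \<Rightarrow> real"
  assumes "\<nu> \<in> pos_measures X" "compact \<Omega>" "continuous_on \<Omega> f"
  shows "set_integrable \<nu> \<Omega> f"
proof -
  interpret finite_measure \<nu> using assms(1) by (rule pos_measuresD)
  obtain b where b: "\<And>x. x \<in> \<Omega> \<Longrightarrow> norm (f x) \<le> b"
    using compact_imp_bounded[OF compact_continuous_image[OF assms(3,2)]] by (auto simp: bounded_iff)
  have meas: "(\<lambda>x. indicator \<Omega> x *\<^sub>R f x) \<in> borel_measurable \<nu>"
    unfolding measurable_cong_sets[OF pos_measuresD(1)[OF assms(1)] refl]
    using assms by (intro borel_measurable_continuous_on_indicator borel_compact)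
  show ?thesis
    unfolding set_integrable_def
    by (rule integrable_const_bound[where B = "\<bar>b\<bar>"]) (use b meas in \<open>force simp: indicator_def\<close>)+
qed

text \<open>Duality writes both integrals as inner products with \<open>h\<close>, and the
  Cauchy-Schwarz inequality does the rest. This converts closeness of observations into closeness of
  integrals of functions in the range of \<open>B\<close>.\<close>

lemma dual_integral_diff:
  fixes B :: "'h::real_inner \<Rightarrow> 'a::euclidean_space \<Rightarrow> real"
  assumes "is_dual_of \<Omega> Ob B" "u \<in> pos_measures \<Omega>" "\<nu> \<in> pos_measures \<Omega>"
    and "norm (Ob (measure u) - Ob (measure \<nu>)) \<le> k"
  shows "\<bar>(LINT x:\<Omega>|u. B h x) - (LINT x:\<Omega>|\<nu>. B h x)\<bar> \<le> norm h * k"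
proof -
  have eq: "(LINT x:\<Omega>|u. B h x) = Ob (measure u) \<bullet> h" if "u \<in> pos_measures \<Omega>" for u
    using assms(1) measure_in_signed_measures[OF that] signed_integral_measure[of u] pos_measuresD[OF that]
    by (simp add: is_dual_of_def)
  have "\<bar>(Ob (measure u) - Ob (measure \<nu>)) \<bullet> h\<bar> \<le> norm (Ob (measure u) - Ob (measure \<nu>)) * norm h"
    by (rule Cauchy_Schwarz_ineq2)
  also have "\<dots> \<le> k * norm h" using assms(4) by (intro mult_right_mono) auto
  finally show ?thesis by (simp add: eq assms inner_diff_left mult.commute)
qed

lemma set_integral_const_pos_measures:
  assumes "u \<in> pos_measures \<Omega>" "closed \<Omega>"
  shows "(LINT x:\<Omega>|u. (c::real)) = c * measure u UNIV"
proof -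
  interpret finite_measure u using assms(1) by (rule pos_measuresD)
  have "(LINT x:\<Omega>|u. c) = (LINT x|u. c)"
    unfolding set_lebesgue_integral_def
  proof (rule integral_cong_AE)
    have "\<Omega> \<in> sets u" using assms(2) by (simp add: pos_measuresD[OF assms(1)])
    then show "(\<lambda>x. indicator \<Omega> x *\<^sub>R c) \<in> borel_measurable u" by measurable
    show "AE x in u. indicator \<Omega> x *\<^sub>R c = c"
      using AE_pos_measures[OF assms(1) subset_refl assms(2)] by eventually_elim simp
  qed simp
  then show ?thesis by (simp add: pos_measuresD[OF assms(1)])
qed

lemma capped_min_integrable:
  assumes "u \<in> pos_measures X" "0 \<le> r"
    "\<And>i. i \<in> {1..N} \<Longrightarrow> (\<lambda>x. f x i) \<in> borel_measurable borel" "\<And>x i. i \<in> {1..N} \<Longrightarrow> 0 \<le> f x i"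
  shows "integrable u (\<lambda>x. (capped_min r N (f x))\<^sup>2)"
proof -
  interpret finite_measure u using assms(1) by (rule pos_measuresD)
  show ?thesis
  proof (rule integrable_const_bound[where B = "r\<^sup>2"])
    show "AE x in u. norm ((capped_min r N (f x))\<^sup>2) \<le> r\<^sup>2"
      using assms(2,4) by (auto intro!: power_mono capped_min_le_cap capped_min_nonneg)
    have "(\<lambda>x. capped_min r N (f x)) \<in> borel_measurable u"
      using assms(3) unfolding measurable_cong_sets[OF pos_measuresD(1)[OF assms(1)] refl]
      by (rule capped_min_measurable)
    then show "(\<lambda>x. (capped_min r N (f x))\<^sup>2) \<in> borel_measurable u" by measurable
  qed
qed

text \<open>Integrate \<open>\<kappa> * c^2 \<le> 1 + B h\<close> over \<open>u\<close>, with c the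
  capped distance. The integral of 1 exceeds the mass of \<nu> by at most k, and the integral of
  \<open>B h\<close> exceeds minus that mass, its value for \<nu>, by at most
  \<open>norm h * k\<close>. The two masses cancel.\<close>

lemma certificate_integral_bound:
  fixes B :: "'h::real_inner \<Rightarrow> 'a::euclidean_space \<Rightarrow> real"
  assumes "compact \<Omega>" "bounded_linear_to_C \<Omega> B" "is_dual_of \<Omega> Ob B"
    and \<nu>: "\<nu> \<in> pos_measures \<Omega>" "(\<lambda>x. - B h x) \<in> tv_subdifferential \<Omega> (measure \<nu>)"
    and "0 < \<kappa>" "0 \<le> r"
    and quad: "\<And>x. x \<in> \<Omega> \<Longrightarrow> - B h x \<le> 1 - \<kappa> * (capped_min r N (\<lambda>i. dist x (z i)))\<^sup>2"
    and u: "u \<in> pos_measures \<Omega>" "norm (Ob (measure u) - Ob (measure \<nu>)) \<le> k"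
      "measure u UNIV \<le> measure \<nu> UNIV + k"
  shows "(LINT x|u. (capped_min r N (\<lambda>i. dist x (z i)))\<^sup>2) \<le> (1 + norm h) / \<kappa> * k"
proof -
  let ?c = "\<lambda>x. (capped_min r N (\<lambda>i. dist x (z i)))\<^sup>2"
  interpret u: finite_measure u using u(1) by (rule pos_measuresD)
  have cl: "closed \<Omega>" using assms(1) by (rule compact_imp_closed)
  have cont: "continuous_on \<Omega> (B h)" using assms(2) by (simp add: bounded_linear_to_C_def)
  have int: "set_integrable u \<Omega> (B h)" using u(1) assms(1) cont by (rule set_integrable_continuous_on_compact)
  have intc: "integrable u ?c" by (rule capped_min_integrable[OF u(1) assms(7)]) auto
  have \<Omega>: "\<Omega> \<in> sets u" using cl pos_measuresD(1)[OF u(1)] by simp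
  have ind\<Omega>: "integrable u (indicator \<Omega> :: _ \<Rightarrow> real)"
    by (rule integrable_real_indicator[OF \<Omega>]) (simp add: u.emeasure_eq_measure)
  have "(LINT x:\<Omega>|\<nu>. - B h x) = measure \<nu> UNIV"
    using \<nu> signed_integral_measure[of \<nu> \<Omega>] tv_norm_measure[of \<nu>] pos_measuresD[OF \<nu>(1)]
    by (simp add: tv_subdifferential_def)
  then have 1: "(LINT x:\<Omega>|\<nu>. B h x) = - measure \<nu> UNIV" by (simp add: set_lebesgue_integral_def)
  have "\<kappa> * (LINT x|u. ?c x) = (LINT x|u. \<kappa> * ?c x)" by simp
  also have "\<dots> \<le> (LINT x|u. indicator \<Omega> x *\<^sub>R 1 + indicator \<Omega> x *\<^sub>R B h x)"
  proof (rule integral_mono_AE)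
    show "integrable u (\<lambda>x. indicator \<Omega> x *\<^sub>R 1 + indicator \<Omega> x *\<^sub>R B h x)"
      using int ind\<Omega> by (intro Bochner_Integration.integrable_add) (auto simp: set_integrable_def)
    show "AE x in u. \<kappa> * ?c x \<le> indicator \<Omega> x *\<^sub>R 1 + indicator \<Omega> x *\<^sub>R B h x"
      using AE_pos_measures[OF u(1) subset_refl cl]
    proof eventually_elim
      case (elim x)
      then show ?case using quad[OF elim] by simp
    qed
  qed (use intc in simp)
  also have "\<dots> = (LINT x:\<Omega>|u. 1) + (LINT x:\<Omega>|u. B h x)"
    unfolding set_lebesgue_integral_def
    using int ind\<Omega> by (intro Bochner_Integration.integral_add) (auto simp: set_integrable_def)
  also have "\<dots> \<le> (measure \<nu> UNIV + k) + (- measure \<nu> UNIV + norm h * k)"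
    using dual_integral_diff[OF assms(3) u(1) \<nu>(1) u(2), of h] u(3) 1
    by (simp add: set_integral_const_pos_measures[OF u(1) cl])
  also have "\<dots> = (1 + norm h) * k" by (simp add: algebra_simps)
  finally show ?thesis using \<open>0 < \<kappa>\<close> by (simp add: field_simps)
qed

text \<open>Half the difference of the certificates for two sign patterns that differ at \<open>z\<^sub>i\<close> only
  is close to the indicator function of a ball about \<open>z\<^sub>i\<close>.\<close>

lemma certificate_mass_bound:
  fixes B :: "'h::real_inner \<Rightarrow> 'a::euclidean_space \<Rightarrow> real"
  assumes "compact \<Omega>" "bounded_linear_to_C \<Omega> B" "is_dual_of \<Omega> Ob B"
    and m: "\<And>i. i \<in> {1..N} \<Longrightarrow> 0 < m i" and z: "inj_on z {1..N}"
    and \<nu>: "\<nu> \<in> pos_measures \<Omega>" "\<nu> = atomic_measure N m z"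
    and i: "i \<in> {1..N}" and \<rho>: "0 < \<rho>" "\<rho> \<le> R" and "0 < \<mu>"
    and sep: "\<And>i j. i \<in> {1..N} \<Longrightarrow> j \<in> {1..N} \<Longrightarrow> i \<noteq> j \<Longrightarrow> 2 * \<rho> \<le> dist (z i) (z j)"
    and g: "(\<lambda>x. - B g x) \<in> tv_subdifferential \<Omega> (signed_atomic N (\<lambda>_. 1) z)"
      "\<And>j x. j \<in> {1..N} \<Longrightarrow> x \<in> \<Omega> \<Longrightarrow> dist x (z j) < R \<Longrightarrow> B g (z j) * B g x \<ge> 1 - \<mu> * (dist x (z j))\<^sup>2"
    and h: "(\<lambda>x. - B h x) \<in> tv_subdifferential \<Omega> (signed_atomic N ((\<lambda>_. 1)(i := -1)) z)"
      "\<And>j x. j \<in> {1..N} \<Longrightarrow> x \<in> \<Omega> \<Longrightarrow> dist x (z j) < R \<Longrightarrow> B h (z j) * B h x \<ge> 1 - \<mu> * (dist x (z j))\<^sup>2"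
    and u: "u \<in> pos_measures \<Omega>" "norm (Ob (measure u) - Ob (measure \<nu>)) \<le> k"
  shows "\<bar>measure u (ball (z i) \<rho>) - m i\<bar>
    \<le> (\<mu> + 1 / \<rho>\<^sup>2) * (LINT x|u. (capped_min R N (\<lambda>j. dist x (z j)))\<^sup>2) + norm (h - g) / 2 * k"
proof -
  let ?c = "\<lambda>x. capped_min R N (\<lambda>i. dist x (z i))"
  interpret u: finite_measure u using u(1) by (rule pos_measuresD)
  have cl: "closed \<Omega>" using assms(1) by (rule compact_imp_closed)
  have \<Omega>: "\<Omega> \<in> sets u" using cl pos_measuresD(1)[OF u(1)] by simp
  have ball: "ball (z i) \<rho> \<in> sets u" using pos_measuresD(1)[OF u(1)] by simp
  have z\<Omega>: "z j \<in> \<Omega>" if "j \<in> {1..N}" for j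
    using pos_measures_atomic_measureD \<nu> m that by metis
  \<comment> \<open>With the sign convention of the certificates, \<open>B g\<close> is -1 at all
    atoms and \<open>B h\<close> differs only at \<open>z i\<close>, where it is 1. Hence
    \<open>B w\<close> is 1 at \<open>z i\<close> and 0 at the other atoms.\<close>
  define w where "w = (1/2) *\<^sub>R (h + (-1) *\<^sub>R g)"
  have Bw: "B w x = (B h x - B g x) / 2" if "x \<in> \<Omega>" for x
  proof -
    have add: "B (a + b) x = B a x + B b x" and scale: "B (c *\<^sub>R a) x = c * B a x" for a b c
      using assms(2) that by (auto simp: bounded_linear_to_C_def)
    show ?thesis unfolding w_def scale add by simp
  qed
  have nw: "norm w = norm (h - g) / 2" by (simp add: w_def)
  have cont: "continuous_on \<Omega> (B w)" using assms(2) by (simp add: bounded_linear_to_C_def)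
  have int: "set_integrable u \<Omega> (B w)" using u(1) assms(1) cont by (rule set_integrable_continuous_on_compact)
  have intc: "integrable u (\<lambda>x. (?c x)\<^sup>2)" by (rule capped_min_integrable[OF u(1)]) (use \<rho> in auto)
  have gz: "B g (z j) = -1" if "j \<in> {1..N}" for j
    using tv_subdifferential_signed_atomic[OF z z\<Omega> assms(1) _ g(1) that] by simp
  have hz: "B h (z j) = (if j = i then 1 else -1)" if "j \<in> {1..N}" for j
  proof -
    have "- B h (z j) = ((\<lambda>_. 1)(i := -1)) j"
      by (rule tv_subdifferential_signed_atomic[OF z z\<Omega> assms(1) _ h(1) that]) auto
    then show ?thesis by (auto split: if_splits)
  qed
  have abs: "\<bar>B g x\<bar> \<le> 1" "\<bar>B h x\<bar> \<le> 1" if "x \<in> \<Omega>" for x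
    using g(1) h(1) that unfolding tv_subdifferential_def by force+
  \<comment> \<open>Two regimes produce the coefficient \<open>\<mu> + 1 / \<rho>\<^sup>2\<close>.
    Within \<rho> of an atom both certificates deviate from their signs by at most \<mu> times the
    squared distance, and \<open>sep\<close> decides the value of the indicator. Farther away the
    error is at most 1, which is at most the squared capped distance divided by
    \<open>\<rho>\<^sup>2\<close>.\<close>
  have pt: "\<bar>indicator (ball (z i) \<rho>) x - B w x\<bar> \<le> (\<mu> + 1 / \<rho>\<^sup>2) * (?c x)\<^sup>2" if x: "x \<in> \<Omega>" for x
  proof (cases "?c x < \<rho>")
    case True
    then have "?c x \<noteq> R" using \<rho> by simp
    then obtain j where j: "j \<in> {1..N}" "?c x = dist x (z j)"
      using capped_min_cases[of R N "\<lambda>i. dist x (z i)"] by blast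
    have lt: "dist x (z j) < \<rho>" "dist x (z j) < R" using True j \<rho> by auto
    have bg: "- B g x \<ge> 1 - \<mu> * (?c x)\<^sup>2" using g(2)[OF j(1) x lt(2)] gz[OF j(1)] j(2) by simp
    have ind: "indicator (ball (z i) \<rho>) x = (if j = i then 1 else 0 :: real)"
    proof (cases "j = i")
      case False
      then have "2 * \<rho> \<le> dist (z i) (z j)" using sep i j by metis
      also have "\<dots> \<le> dist x (z i) + dist x (z j)" by (rule dist_triangle3)
      finally show ?thesis using False lt by (auto simp: indicator_def dist_commute)
    qed (use lt in \<open>auto simp: indicator_def dist_commute\<close>)
    have "\<bar>indicator (ball (z i) \<rho>) x - B w x\<bar> \<le> \<mu> * (?c x)\<^sup>2"
    proof (cases "j = i")
      case True
      have "B h x \<ge> 1 - \<mu> * (?c x)\<^sup>2" using h(2)[OF j(1) x lt(2)] hz[OF j(1)] j(2) True by simp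
      then show ?thesis using bg abs[OF x] True unfolding ind Bw[OF x] by (simp add: abs_le_iff field_simps)
    next
      case False
      have "- B h x \<ge> 1 - \<mu> * (?c x)\<^sup>2" using h(2)[OF j(1) x lt(2)] hz[OF j(1)] j(2) False by simp
      then show ?thesis using bg abs[OF x] False unfolding ind Bw[OF x] by (simp add: abs_le_iff field_simps)
    qed
    also have "\<dots> \<le> (\<mu> + 1 / \<rho>\<^sup>2) * (?c x)\<^sup>2" using \<rho> by (intro mult_right_mono) auto
    finally show ?thesis .
  next
    case False
    have "x \<notin> ball (z i) \<rho>" using False capped_min_le[OF i, of R "\<lambda>i. dist x (z i)"] by (simp add: dist_commute)
    then have "\<bar>indicator (ball (z i) \<rho>) x - B w x\<bar> \<le> 1" using abs[OF x] unfolding Bw[OF x] by (simp add: abs_le_iff)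
    also have "1 \<le> (1 / \<rho>\<^sup>2) * (?c x)\<^sup>2" using False \<rho> by (simp add: field_simps power_mono)
    also have "\<dots> \<le> (\<mu> + 1 / \<rho>\<^sup>2) * (?c x)\<^sup>2" using \<open>0 < \<mu>\<close> by (intro mult_right_mono) auto
    finally show ?thesis .
  qed
  have ind_int: "integrable u (indicator (ball (z i) \<rho>) :: _ \<Rightarrow> real)"
    by (rule integrable_real_indicator[OF ball]) (simp add: u.emeasure_eq_measure)
  have "\<bar>measure u (ball (z i) \<rho>) - (LINT x:\<Omega>|u. B w x)\<bar>
      = \<bar>(LINT x|u. indicator (ball (z i) \<rho>) x - indicator \<Omega> x *\<^sub>R B w x)\<bar>"
    using int ball ind_int unfolding set_lebesgue_integral_def
    by (subst Bochner_Integration.integral_diff) (auto simp: set_integrable_def pos_measuresD[OF u(1)])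
  also have "\<dots> \<le> (LINT x|u. \<bar>indicator (ball (z i) \<rho>) x - indicator \<Omega> x *\<^sub>R B w x\<bar>)"
    by (rule integral_abs_bound)
  also have "\<dots> \<le> (LINT x|u. (\<mu> + 1 / \<rho>\<^sup>2) * (?c x)\<^sup>2)"
  proof (rule integral_mono_AE)
    show "integrable u (\<lambda>x. \<bar>indicator (ball (z i) \<rho>) x - indicator \<Omega> x *\<^sub>R B w x\<bar>)"
      using int ind_int by (intro Bochner_Integration.integrable_abs Bochner_Integration.integrable_diff) (auto simp: set_integrable_def)
    show "AE x in u. \<bar>indicator (ball (z i) \<rho>) x - indicator \<Omega> x *\<^sub>R B w x\<bar> \<le> (\<mu> + 1 / \<rho>\<^sup>2) * (?c x)\<^sup>2"
      using AE_pos_measures[OF u(1) subset_refl cl] by eventually_elim (use pt in simp)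
  qed (use intc in simp)
  also have "\<dots> = (\<mu> + 1 / \<rho>\<^sup>2) * (LINT x|u. (?c x)\<^sup>2)" by simp
  finally have 1: "\<bar>measure u (ball (z i) \<rho>) - (LINT x:\<Omega>|u. B w x)\<bar> \<le> (\<mu> + 1 / \<rho>\<^sup>2) * (LINT x|u. (?c x)\<^sup>2)" .
  \<comment> \<open>On the exact measure the test function \<open>B w\<close> picks out the mass of
    the i-th atom.\<close>
  have "(LINT x:\<Omega>|\<nu>. B w x) = (\<Sum>j\<in>{1..N}. m j * (indicator \<Omega> (z j) *\<^sub>R B w (z j)))"
    unfolding \<nu>(2) set_lebesgue_integral_def using cont assms(1) m
    by (intro integral_atomic_measure borel_measurable_continuous_on_indicator borel_compact) (auto simp: less_imp_le)
  also have "\<dots> = (\<Sum>j\<in>{1..N}. if j = i then m j else 0)"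
    by (intro sum.cong) (auto simp: z\<Omega> Bw gz hz)
  also have "\<dots> = m i" using i by simp
  finally have "\<bar>(LINT x:\<Omega>|u. B w x) - m i\<bar> \<le> norm (h - g) / 2 * k"
    using dual_integral_diff[OF assms(3) u(1) \<nu>(1) u(2), of w] by (simp add: nw)
  with 1 show ?thesis by linarith
qed

text \<open>Of all sign patterns only the constant one and its N single flips are used. The radius
  \<open>R\<close> of the cost is fixed by the certificates, while \<rho> is left to be chosen: it
  must later be common to several times, and K depends on it through
  \<open>1 / \<rho>\<^sup>2\<close>.\<close>

lemma stably_reconstructible_bounds:
  fixes B :: "'h::real_inner \<Rightarrow> 'a::euclidean_space \<Rightarrow> real"
  assumes "compact \<Omega>" "bounded_linear_to_C \<Omega> B" "is_dual_of \<Omega> Ob B"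
    and stab: "stably_reconstructible \<Omega> B \<nu>"
    and m: "\<And>i. i \<in> {1..N} \<Longrightarrow> 0 < m i" and z: "inj_on z {1..N}"
    and \<nu>: "\<nu> = atomic_measure N m z"
  obtains h R where "0 < R" "(\<lambda>x. - B h x) \<in> tv_subdifferential \<Omega> (measure \<nu>)"
    "\<And>\<rho>. 0 < \<rho> \<Longrightarrow> \<rho> \<le> R \<Longrightarrow>
      (\<And>i j. i \<in> {1..N} \<Longrightarrow> j \<in> {1..N} \<Longrightarrow> i \<noteq> j \<Longrightarrow> 2 * \<rho> \<le> dist (z i) (z j)) \<Longrightarrow>
      \<exists>K>0. \<forall>u\<in>pos_measures \<Omega>. \<forall>k\<ge>0. norm (Ob (measure u) - Ob (measure \<nu>)) \<le> k \<longrightarrow>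
        measure u UNIV \<le> measure \<nu> UNIV + k \<longrightarrow>
        capped_cost u R N (\<lambda>x i. dist x (z i)) \<le> ennreal (K * k) \<and>
        (\<forall>i\<in>{1..N}. \<bar>measure u (ball (z i) \<rho>) - m i\<bar> \<le> K * k)"
proof -
  have \<nu>p: "\<nu> \<in> pos_measures \<Omega>" using stab by (simp add: stably_reconstructible_def)
  obtain N' m' z' where z': "inj_on z' {1..N'}" and m': "\<And>i. i \<in> {1..N'} \<Longrightarrow> 0 < m' i"
    and \<nu>': "\<nu> = atomic_measure N' m' z'" and
    ex: "\<exists>\<kappa>>0. \<exists>\<mu>>0. \<exists>R>0. \<forall>s. (\<forall>i\<in>{1..N'}. s i \<in> {-1, 1}) \<longrightarrow>
         (\<exists>v vs.
            (\<lambda>x. - B v x) \<in> tv_subdifferential \<Omega> (measure \<nu>) \<and>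
            (\<lambda>x. - B vs x) \<in> tv_subdifferential \<Omega> (signed_atomic N' s z') \<and>
            (\<forall>x\<in>\<Omega>. - B v x \<le> 1 - \<kappa> * (Min (insert R ((\<lambda>i. dist x (z' i)) ` {1..N'})))\<^sup>2) \<and>
            (\<forall>i\<in>{1..N'}. \<forall>x\<in>\<Omega>. dist x (z' i) < R \<longrightarrow>
               B vs (z' i) * B vs x \<ge> 1 - \<mu> * (dist x (z' i))\<^sup>2))"
    using stab unfolding stably_reconstructible_def by blast
  from ex obtain \<kappa> \<mu> R where pos: "0 < \<kappa>" "0 < \<mu>" "0 < R" and
    cert: "\<And>s. (\<forall>i\<in>{1..N'}. s i \<in> {-1, 1}) \<Longrightarrow>
         (\<exists>v vs.
            (\<lambda>x. - B v x) \<in> tv_subdifferential \<Omega> (measure \<nu>) \<and>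
            (\<lambda>x. - B vs x) \<in> tv_subdifferential \<Omega> (signed_atomic N' s z') \<and>
            (\<forall>x\<in>\<Omega>. - B v x \<le> 1 - \<kappa> * (Min (insert R ((\<lambda>i. dist x (z' i)) ` {1..N'})))\<^sup>2) \<and>
            (\<forall>i\<in>{1..N'}. \<forall>x\<in>\<Omega>. dist x (z' i) < R \<longrightarrow>
               B vs (z' i) * B vs x \<ge> 1 - \<mu> * (dist x (z' i))\<^sup>2))"
    by blast
  \<comment> \<open>The representation inside \<open>stably_reconstructible\<close> may enumerate
    the atoms differently. Equal supports give equal sets of atoms, hence equal capped
    distances.\<close>
  have img: "z ` {1..N} = z' ` {1..N'}"
    using supp_atomic_measure[of N m z] supp_atomic_measure[of N' m' z'] m m' \<nu> \<nu>' by simp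
  have cap: "capped_min R N (\<lambda>i. dist x (z i)) = capped_min R N' (\<lambda>i. dist x (z' i))" for x
  proof -
    have "(\<lambda>i. dist x (z i)) ` {1..N} = dist x ` (z ` {1..N})" by (simp add: image_image)
    also have "\<dots> = (\<lambda>i. dist x (z' i)) ` {1..N'}" unfolding img by (simp add: image_image)
    finally show ?thesis by (simp add: capped_min_def)
  qed
  \<comment> \<open>The definition lets the certificate of \<nu> vary with the sign pattern; the one
    that accompanies the constant pattern is kept.\<close>
  obtain h g where h: "(\<lambda>x. - B h x) \<in> tv_subdifferential \<Omega> (measure \<nu>)"
      "\<And>x. x \<in> \<Omega> \<Longrightarrow> - B h x \<le> 1 - \<kappa> * (capped_min R N (\<lambda>i. dist x (z i)))\<^sup>2"
    and g: "(\<lambda>x. - B g x) \<in> tv_subdifferential \<Omega> (signed_atomic N' (\<lambda>_. 1) z')"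
      "\<And>j x. j \<in> {1..N'} \<Longrightarrow> x \<in> \<Omega> \<Longrightarrow> dist x (z' j) < R \<Longrightarrow> B g (z' j) * B g x \<ge> 1 - \<mu> * (dist x (z' j))\<^sup>2"
    using cert[of "\<lambda>_. 1", folded capped_min_def, folded cap] by blast
  have "\<forall>i\<in>{1..N'}. \<exists>w. (\<lambda>x. - B w x) \<in> tv_subdifferential \<Omega> (signed_atomic N' ((\<lambda>_. 1)(i := -1)) z') \<and>
      (\<forall>j\<in>{1..N'}. \<forall>x\<in>\<Omega>. dist x (z' j) < R \<longrightarrow> B w (z' j) * B w x \<ge> 1 - \<mu> * (dist x (z' j))\<^sup>2)"
  proof
    fix i assume "i \<in> {1..N'}"
    have "\<forall>j\<in>{1..N'}. ((\<lambda>_. 1)(i := -1)) j \<in> {-1, 1::real}" by simp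
    from cert[OF this]
    show "\<exists>w. (\<lambda>x. - B w x) \<in> tv_subdifferential \<Omega> (signed_atomic N' ((\<lambda>_. 1)(i := -1)) z') \<and>
      (\<forall>j\<in>{1..N'}. \<forall>x\<in>\<Omega>. dist x (z' j) < R \<longrightarrow> B w (z' j) * B w x \<ge> 1 - \<mu> * (dist x (z' j))\<^sup>2)"
      by blast
  qed
  from bchoice[OF this] obtain w where
    w: "\<And>i. i \<in> {1..N'} \<Longrightarrow> (\<lambda>x. - B (w i) x) \<in> tv_subdifferential \<Omega> (signed_atomic N' ((\<lambda>_. 1)(i := -1)) z')"
      "\<And>i j x. i \<in> {1..N'} \<Longrightarrow> j \<in> {1..N'} \<Longrightarrow> x \<in> \<Omega> \<Longrightarrow> dist x (z' j) < R \<Longrightarrow>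
        B (w i) (z' j) * B (w i) x \<ge> 1 - \<mu> * (dist x (z' j))\<^sup>2"
    by blast
  show thesis
  proof (rule that[OF pos(3) h(1)])
    fix \<rho> assume \<rho>: "0 < \<rho>" "\<rho> \<le> R"
      and sep: "\<And>i j. i \<in> {1..N} \<Longrightarrow> j \<in> {1..N} \<Longrightarrow> i \<noteq> j \<Longrightarrow> 2 * \<rho> \<le> dist (z i) (z j)"
    have sep': "2 * \<rho> \<le> dist (z' i') (z' j')" if ij: "i' \<in> {1..N'}" "j' \<in> {1..N'}" "i' \<noteq> j'" for i' j'
    proof -
      have "z' i' \<in> z ` {1..N}" "z' j' \<in> z ` {1..N}" unfolding img using ij by blast+
      then obtain i j where i: "i \<in> {1..N}" "z' i' = z i" and j: "j \<in> {1..N}" "z' j' = z j" by blast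
      have "z' i' \<noteq> z' j'" using z' ij by (auto dest: inj_onD)
      then have "i \<noteq> j" using i j by metis
      then show ?thesis using sep[OF i(1) j(1)] by (simp add: i j)
    qed
    \<comment> \<open>\<open>a\<close> comes from the cost estimate and \<open>b i\<close> from the
      mass estimate at atom i; their sum dominates each of them.\<close>
    define a where "a = (1 + norm h) / \<kappa>"
    define b where "b i = (\<mu> + 1 / \<rho>\<^sup>2) * a + norm (w i - g) / 2" for i
    define K where "K = a + (\<Sum>i\<in>{1..N'}. b i)"
    have a: "0 < a" using pos unfolding a_def by (intro divide_pos_pos add_pos_nonneg) auto
    have b: "0 \<le> b i" for i using a pos by (auto simp: b_def)
    have aK: "a \<le> K" using b by (simp add: K_def sum_nonneg)
    have bK: "b i \<le> K" if "i \<in> {1..N'}" for i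
      using member_le_sum[OF that, of b] a b by (simp add: K_def)
    show "\<exists>K>0. \<forall>u\<in>pos_measures \<Omega>. \<forall>k\<ge>0. norm (Ob (measure u) - Ob (measure \<nu>)) \<le> k \<longrightarrow>
        measure u UNIV \<le> measure \<nu> UNIV + k \<longrightarrow>
        capped_cost u R N (\<lambda>x i. dist x (z i)) \<le> ennreal (K * k) \<and>
        (\<forall>i\<in>{1..N}. \<bar>measure u (ball (z i) \<rho>) - m i\<bar> \<le> K * k)"
    proof (intro exI[of _ K] conjI ballI allI impI)
      show "0 < K" using a aK by simp
      fix u k assume u: "u \<in> pos_measures \<Omega>" and k: "0 \<le> k" "norm (Ob (measure u) - Ob (measure \<nu>)) \<le> k"
        "measure u UNIV \<le> measure \<nu> UNIV + k"
      let ?I = "LINT x|u. (capped_min R N (\<lambda>i. dist x (z i)))\<^sup>2"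
      have I: "?I \<le> a * k"
        unfolding a_def
        by (rule certificate_integral_bound[OF assms(1-3) \<nu>p h(1) pos(1) _ h(2) u k(2,3)]) (use pos in auto)
      have "capped_cost u R N (\<lambda>x i. dist x (z i)) = ennreal ?I"
        using pos by (intro nn_integral_eq_integral capped_min_integrable[OF u]) auto
      also have "\<dots> \<le> ennreal (K * k)" using I mult_right_mono[OF aK k(1)] by (intro ennreal_leI) simp
      finally show "capped_cost u R N (\<lambda>x i. dist x (z i)) \<le> ennreal (K * k)" .
      fix i assume i: "i \<in> {1..N}"
      then have "z i \<in> z' ` {1..N'}" unfolding img[symmetric] by blast
      then obtain i' where i': "i' \<in> {1..N'}" "z i = z' i'" by blast
      \<comment> \<open>Both are the mass of the same singleton under \<nu>.\<close>
      have "m i = m' i'"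
        using measure_atomic_measure_singleton[of N m z i] measure_atomic_measure_singleton[of N' m' z' i']
          m m' z z' i i' \<nu> \<nu>' by simp
      then have "\<bar>measure u (ball (z i) \<rho>) - m i\<bar> \<le> (\<mu> + 1 / \<rho>\<^sup>2) * ?I + norm (w i' - g) / 2 * k"
        unfolding i'(2) cap
        using certificate_mass_bound[OF assms(1-3) m' z' \<nu>p \<nu>' i'(1) \<rho> pos(2) sep' g w(1)[OF i'(1)] w(2)[OF i'(1)] u k(2)]
        by simp
      also have "\<dots> \<le> (\<mu> + 1 / \<rho>\<^sup>2) * (a * k) + norm (w i' - g) / 2 * k"
        using I pos by (intro add_right_mono mult_left_mono) auto
      also have "\<dots> = b i' * k" by (simp add: b_def algebra_simps)
      also have "\<dots> \<le> K * k" using bK[OF i'(1)] k(1) by (rule mult_right_mono)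
      finally show "\<bar>measure u (ball (z i) \<rho>) - m i\<bar> \<le> K * k" .
    qed
  qed
qed

text \<open>U and M stand for the total masses of the minimizer and of the exact configuration, r
  and n for residuals and noise. Optimality bounds the squared residual by \<open>M - U\<close>, and
  the certificate bounds \<open>M - U\<close> linearly by residual and noise, so that the residual w
  satisfies a quadratic inequality with coefficients of order \<open>sqrt \<delta>\<close>.\<close>

lemma discrepancy_bound:
  fixes r n :: "'t \<Rightarrow> real"
  assumes "finite T" "t0 \<in> T" and nn: "\<And>t. t \<in> T \<Longrightarrow> 0 \<le> r t" "\<And>t. t \<in> T \<Longrightarrow> 0 \<le> n t"
    and \<delta>: "\<delta> = 1/2 * (\<Sum>t\<in>T. (n t)\<^sup>2)" "0 < \<delta>"
    and opt: "U + 1 / (2 * sqrt \<delta>) * (\<Sum>t\<in>T. (r t)\<^sup>2) \<le> M + sqrt \<delta>"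
    and low: "M - U \<le> a * (r t0 + n t0)" "0 \<le> a"
  shows "U \<le> M + sqrt \<delta>" "t \<in> T \<Longrightarrow> r t + n t \<le> (6 * a + 4) * sqrt \<delta>"
proof -
  define k where "k = sqrt \<delta>"
  have k: "0 < k" "k\<^sup>2 = \<delta>" using \<delta>(2) by (auto simp: k_def)
  define E where "E = (\<Sum>t\<in>T. (r t)\<^sup>2)"
  have E: "0 \<le> E" by (simp add: E_def sum_nonneg)
  have opt': "U + E / (2 * k) \<le> M + k" using opt by (simp add: k_def E_def)
  moreover have "0 \<le> E / (2 * k)" using E k by simp
  ultimately show "U \<le> M + sqrt \<delta>" by (simp add: k_def)
  define w where "w = sqrt E"
  have w: "0 \<le> w" "w\<^sup>2 = E" using E by (auto simp: w_def)
  have r: "r t \<le> w" if "t \<in> T" for t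
  proof -
    have "(r t)\<^sup>2 \<le> w\<^sup>2"
      unfolding w E_def using that assms(1) by (intro member_le_sum) auto
    then show ?thesis using w(1) by (rule power2_le_imp_le)
  qed
  have n: "n t \<le> 2 * k" if "t \<in> T" for t
  proof -
    have "(n t)\<^sup>2 \<le> (\<Sum>t\<in>T. (n t)\<^sup>2)" using that assms(1) by (intro member_le_sum) auto
    also have "\<dots> = 2 * k\<^sup>2" using \<delta>(1) k by simp
    also have "\<dots> \<le> (2 * k)\<^sup>2" by (simp add: power2_eq_square)
    finally show ?thesis by (rule power2_le_imp_le) (use k in simp)
  qed
  have "E \<le> 2 * k * (M - U) + 2 * k\<^sup>2"
    using opt' k by (simp add: field_simps power2_eq_square)
  also have "\<dots> \<le> 2 * k * (a * (w + 2 * k)) + 2 * k\<^sup>2"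
  proof -
    have "M - U \<le> a * (w + 2 * k)"
      using low mult_left_mono[OF add_mono[OF r[OF assms(2)] n[OF assms(2)]] low(2)] by linarith
    then show ?thesis using k(1) by simp
  qed
  finally have q: "w\<^sup>2 \<le> 2 * k * (a * (w + 2 * k)) + 2 * k\<^sup>2" by (simp add: w)
  \<comment> \<open>If w exceeds k, replacing one k by w in each lower order term allows division by
    w, which leaves \<open>6 * a + 2\<close>. Adding the noise, at most \<open>2 * k\<close>, gives
    \<open>6 * a + 4\<close> below.\<close>
  have wk: "w \<le> (6 * a + 2) * k"
  proof (cases "w \<le> k")
    case True
    also have "k \<le> (6 * a + 2) * k" using k(1) low(2) by (simp add: algebra_simps)
    finally show ?thesis .
  next
    case False
    have "2 * k * (a * (w + 2 * k)) + 2 * k\<^sup>2 \<le> 2 * k * (a * (w + 2 * w)) + 2 * (k * w)"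
      unfolding power2_eq_square using False k(1) low(2) by (intro add_mono mult_left_mono) auto
    with q have "w * w \<le> (6 * a + 2) * k * w" by (simp add: power2_eq_square algebra_simps)
    then show ?thesis using False k(1) by simp
  qed
  assume "t \<in> T"
  then have "r t + n t \<le> w + 2 * k" using r n by (simp add: add_mono)
  also have "\<dots> \<le> (6 * a + 4) * k" using wk by (simp add: algebra_simps)
  finally show "r t + n t \<le> (6 * a + 4) * sqrt \<delta>" by (simp add: k_def)
qed

subsection \<open>Feasible points and disintegrations\<close>

lemma measurable_Mv: "(\<lambda>(x, v). x + t *\<^sub>R v) \<in> borel_measurable (borel :: ('a::euclidean_space \<times> 'a) measure)"
  unfolding split_beta by (intro borel_measurable_continuous_onI continuous_intros)

lemma measurable_Rd: "(\<lambda>x. \<theta> \<bullet> x) \<in> borel_measurable (borel :: 'a::euclidean_space measure)"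
  by (intro borel_measurable_continuous_onI continuous_intros)

lemma measurable_Rj:
  "(\<lambda>(x, v). (\<theta> \<bullet> x, \<theta> \<bullet> v)) \<in> borel_measurable (borel :: ('a::euclidean_space \<times> 'a) measure)"
  unfolding split_beta by (intro borel_measurable_continuous_onI continuous_intros)

lemma slicesD:
  "slices H \<Gamma> \<gamma> \<gamma>s \<Longrightarrow> A \<in> sets borel \<Longrightarrow> B \<in> sets borel \<Longrightarrow>
    emeasure \<gamma> (A \<times> B) = (\<integral>\<^sup>+\<theta>\<in>A. emeasure (\<gamma>s \<theta>) B \<partial>H)"
  by (simp add: slices_def)

text \<open>Feasibility yields one disintegration that satisfies the constraint, but the theorem
  speaks about every disintegration. For a fixed Borel set both families are densities of the same
  measure; a countable generator closed under intersections makes the exceptional null set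
  independent of the Borel set.\<close>

lemma slices_AE_eq:
  fixes H :: "'a::euclidean_space measure"
  assumes H: "H \<in> pos_measures \<Theta>" and 1: "slices H \<Gamma> \<gamma> \<gamma>1" and 2: "slices H \<Gamma> \<gamma> \<gamma>2"
    and fin: "finite_measure \<gamma>"
  shows "AE \<theta> in H. \<gamma>1 \<theta> = \<gamma>2 \<theta>"
proof -
  interpret H: finite_measure H using H by (rule pos_measuresD)
  note sH = pos_measuresD(1)[OF H]
  obtain B0 :: "(real \<times> real) set set" where B0: "countable B0" "topological_basis B0"
    using ex_countable_basis by blast
  \<comment> \<open>Finite intersections of sets of a countable basis remain countable in number,
    and the whole space is included as an exhausting sequence for the uniqueness of
    measures.\<close>
  define \<B> where "\<B> = insert UNIV (Inter ` {F. finite F \<and> F \<subseteq> B0})"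
  have cB: "countable \<B>"
    unfolding \<B>_def using countable_Collect_finite_subset[OF B0(1)] by auto
  have B0_open: "open X" if "X \<in> B0" for X using B0(2) that by (rule topological_basis_open)
  have B_open: "open X" if "X \<in> \<B>" for X
    using that B0_open by (auto simp: \<B>_def intro!: open_Inter)
  then have B_borel: "X \<in> sets borel" if "X \<in> \<B>" for X using that by simp
  have "Int_stable \<B>"
  proof (rule Int_stableI)
    fix X Y assume "X \<in> \<B>" "Y \<in> \<B>"
    moreover have "\<Inter>F \<inter> \<Inter>G = \<Inter>(F \<union> G)" for F G :: "(real \<times> real) set set" by auto
    ultimately show "X \<inter> Y \<in> \<B>" unfolding \<B>_def by auto
  qed
  moreover have gen: "sets (borel :: (real \<times> real) measure) = sigma_sets UNIV \<B>"
  proof (rule antisym)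
    have "sets (borel :: (real \<times> real) measure) = sigma_sets UNIV B0"
      by (subst borel_eq_countable_basis[OF B0]) simp
    also have "\<dots> \<subseteq> sigma_sets UNIV \<B>"
    proof (rule sigma_sets_mono')
      show "B0 \<subseteq> \<B>"
      proof
        fix X assume "X \<in> B0"
        then show "X \<in> \<B>" unfolding \<B>_def by (intro insertI2 image_eqI[where x = "{X}"]) auto
      qed
    qed
    finally show "sets (borel :: (real \<times> real) measure) \<subseteq> sigma_sets UNIV \<B>" .
    show "sigma_sets UNIV \<B> \<subseteq> sets (borel :: (real \<times> real) measure)"
      using B_borel sets.sigma_sets_subset[of \<B> "borel :: (real \<times> real) measure"] by auto
  qed
  moreover have "AE \<theta> in H. \<forall>X\<in>\<B>. emeasure (\<gamma>1 \<theta>) X = emeasure (\<gamma>2 \<theta>) X"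
    unfolding AE_ball_countable[OF cB]
  proof
    fix X assume X: "X \<in> \<B>"
    let ?f = "\<lambda>\<theta>. emeasure (\<gamma>1 \<theta>) X" and ?g = "\<lambda>\<theta>. emeasure (\<gamma>2 \<theta>) X"
    have fg: "?f \<in> borel_measurable H" "?g \<in> borel_measurable H"
      using 1 2 B_borel[OF X] unfolding slices_def measurable_cong_sets[OF sH refl] by auto
    have "density H ?f = density H ?g"
    proof (rule measure_eqI)
      fix A assume "A \<in> sets (density H ?f)"
      then have A: "A \<in> sets borel" by (simp add: sH)
      have eq: "emeasure \<gamma> (A \<times> X) = (\<integral>\<^sup>+\<theta>\<in>A. ?f \<theta> \<partial>H)" "emeasure \<gamma> (A \<times> X) = (\<integral>\<^sup>+\<theta>\<in>A. ?g \<theta> \<partial>H)"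
        using 1 2 A B_borel[OF X] by (auto simp: slices_def)
      show "emeasure (density H ?f) A = emeasure (density H ?g) A"
        using A eq fg by (simp add: emeasure_density sH)
    qed simp
    moreover have "(\<integral>\<^sup>+\<theta>. ?f \<theta> \<partial>H) \<noteq> \<infinity>"
    proof -
      have "emeasure \<gamma> (UNIV \<times> X) = (\<integral>\<^sup>+\<theta>\<in>UNIV. ?f \<theta> \<partial>H)"
        by (rule slicesD[OF 1 _ B_borel[OF X]]) simp
      then show ?thesis using finite_measure.emeasure_finite[OF fin, of "UNIV \<times> X"] by simp
    qed
    ultimately show "AE \<theta> in H. ?f \<theta> = ?g \<theta>"
      using H.density_unique[OF fg] by simp
  qed
  ultimately show ?thesis
  proof (elim eventually_mono)
    fix \<theta> assume eq: "\<forall>X\<in>\<B>. emeasure (\<gamma>1 \<theta>) X = emeasure (\<gamma>2 \<theta>) X"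
    have p: "\<gamma>1 \<theta> \<in> pos_measures \<Gamma>" "\<gamma>2 \<theta> \<in> pos_measures \<Gamma>" using 1 2 by (auto simp: slices_def)
    interpret g1: finite_measure "\<gamma>1 \<theta>" using p(1) by (rule pos_measuresD)
    show "\<gamma>1 \<theta> = \<gamma>2 \<theta>"
      using \<open>Int_stable \<B>\<close>
    proof (rule measure_eqI_generator_eq[where \<Omega> = UNIV and A = "\<lambda>_. UNIV"])
      show "range (\<lambda>_::nat. UNIV) \<subseteq> \<B>" by (auto simp: \<B>_def)
    qed (use eq gen pos_measuresD(1)[OF p(1)] pos_measuresD(1)[OF p(2)] in auto)
  qed
qed

text \<open>Pushforwards preserve total mass, and the directions carry a probability measure, so
  integrating the constraint over the directions suffices. This links the objective, which penalizes
  \<gamma>, to the certificates, which concern \<open>u t\<close>.\<close>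

lemma feasible_mass:
  fixes H :: "'a::euclidean_space measure"
  assumes feas: "feasible \<Omega> \<Sigma> \<Theta> H (u, \<gamma>)" and H: "H \<in> pos_measures \<Theta>" "prob_space H" and t: "t \<in> \<Sigma>"
  shows "measure (u t) UNIV = measure \<gamma> UNIV"
proof -
  interpret H: prob_space H by fact
  obtain \<gamma>s where \<gamma>s: "slices H (proj_domain \<Theta> \<Omega> \<Sigma>) \<gamma> \<gamma>s"
    and AE: "AE \<theta> in H. Mv t (\<gamma>s \<theta>) = Rd \<theta> (u t)" and u: "u t \<in> pos_measures \<Omega>"
    using feas t by (auto simp: feasible_def)
  have p: "\<gamma>s \<theta> \<in> pos_measures (proj_domain \<Theta> \<Omega> \<Sigma>)" for \<theta> using \<gamma>s by (simp add: slices_def)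
  have "emeasure \<gamma> UNIV = emeasure \<gamma> (UNIV \<times> UNIV)" by simp
  also have "\<dots> = (\<integral>\<^sup>+\<theta>\<in>UNIV. emeasure (\<gamma>s \<theta>) UNIV \<partial>H)"
    by (rule slicesD[OF \<gamma>s]) simp_all
  also have "\<dots> = (\<integral>\<^sup>+\<theta>. emeasure (u t) UNIV \<partial>H)"
  proof (rule nn_integral_cong_AE)
    show "AE \<theta> in H. emeasure (\<gamma>s \<theta>) UNIV * indicator UNIV \<theta> = emeasure (u t) UNIV"
      using AE
    proof eventually_elim
      case (elim \<theta>)
      have "emeasure (Mv t (\<gamma>s \<theta>)) UNIV = emeasure (\<gamma>s \<theta>) UNIV"
        unfolding Mv_def using measurable_Mv[of t, where 'a = real, simplified]
        by (subst emeasure_distr) (auto simp: pos_measuresD[OF p] measurable_cong_sets[OF pos_measuresD(1)[OF p] refl])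
      moreover have "emeasure (Rd \<theta> (u t)) UNIV = emeasure (u t) UNIV"
        unfolding Rd_def using measurable_Rd[of \<theta>]
        by (subst emeasure_distr) (auto simp: pos_measuresD[OF u] measurable_cong_sets[OF pos_measuresD(1)[OF u] refl])
      ultimately show ?case using elim by simp
    qed
  qed
  also have "\<dots> = emeasure (u t) UNIV" by (simp add: H.emeasure_space_1)
  finally show ?thesis by (simp add: measure_def)
qed

lemma Mv_atomic_measure: "Mv t (atomic_measure N m (\<lambda>i. (x i, v i))) = atomic_measure N m (\<lambda>i. x i + t *\<^sub>R v i)"
  unfolding Mv_def by (simp add: distr_atomic_measure[OF measurable_Mv])

lemma Rd_atomic_measure: "Rd \<theta> (atomic_measure N m z) = atomic_measure N m (\<lambda>i. \<theta> \<bullet> z i)"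
  unfolding Rd_def by (simp add: distr_atomic_measure[OF measurable_Rd])

lemma Rj_atomic_measure:
  "Rj \<theta> (atomic_measure N m (\<lambda>i. (x i, v i))) = atomic_measure N m (\<lambda>i. (\<theta> \<bullet> x i, \<theta> \<bullet> v i))"
  unfolding Rj_def by (simp add: distr_atomic_measure[OF measurable_Rj])

text \<open>The competitor is the image of the product of \<open>H\<close> and \<open>lam\<close>
  under the projection of positions and velocities along each direction; its slice at \<theta> is
  \<open>Rj \<theta> lam\<close>.\<close>

lemma feasible_atomic_measure:
  fixes x v :: "nat \<Rightarrow> 'a::euclidean_space" and m :: "nat \<Rightarrow> real" and N :: nat
  defines "lam \<equiv> atomic_measure N m (\<lambda>i. (x i, v i))"
  assumes "compact \<Theta>" and H: "H \<in> pos_measures \<Theta>" "prob_space H"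
    and xv: "\<And>i. i \<in> {1..N} \<Longrightarrow> (x i, v i) \<in> phase_domain \<Omega> \<Sigma>"
  obtains \<gamma> where "feasible \<Omega> \<Sigma> \<Theta> H (\<lambda>t. Mv t lam, \<gamma>)"
proof -
  let ?\<Gamma> = "proj_domain \<Theta> \<Omega> \<Sigma>"
  interpret H: prob_space H by fact
  interpret lam: finite_measure lam unfolding lam_def by (rule finite_measure_atomic_measure)
  have sets_lam: "sets lam = sets borel" by (simp add: lam_def)
  define g where "g = (\<lambda>(\<theta>, x, v). (\<theta>, \<theta> \<bullet> x, \<theta> \<bullet> v) :: 'a \<times> real \<times> real)"
  define \<gamma> where "\<gamma> = distr (H \<Otimes>\<^sub>M lam) borel g"
  have sets_pair: "sets (H \<Otimes>\<^sub>M lam) = sets borel"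
    by (subst borel_prod[symmetric]) (rule sets_pair_measure_cong[OF pos_measuresD(1)[OF H(1)] sets_lam])
  have sp_pair: "space (H \<Otimes>\<^sub>M lam) = UNIV" using sets_eq_imp_space_eq[OF sets_pair] by simp
  have g: "g \<in> borel_measurable (H \<Otimes>\<^sub>M lam)"
    unfolding measurable_cong_sets[OF sets_pair refl] g_def split_beta
    by (intro borel_measurable_continuous_onI continuous_intros)
  have em: "emeasure \<gamma> S = (\<integral>\<^sup>+\<theta>. emeasure lam {p. g (\<theta>, p) \<in> S} \<partial>H)" if "S \<in> sets borel" for S
  proof -
    have "emeasure \<gamma> S = emeasure (H \<Otimes>\<^sub>M lam) (g -` S)"
      unfolding \<gamma>_def using that g by (simp add: emeasure_distr sp_pair)
    also have "\<dots> = (\<integral>\<^sup>+\<theta>. emeasure lam (Pair \<theta> -` (g -` S)) \<partial>H)"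
      by (rule lam.emeasure_pair_measure_alt) (use measurable_sets[OF g that] sp_pair in simp)
    finally show ?thesis by (simp add: vimage_def)
  qed
  have AE\<Theta>: "AE \<theta> in H. \<theta> \<in> \<Theta>"
    by (rule AE_pos_measures[OF H(1) subset_refl compact_imp_closed[OF assms(2)]])
  \<comment> \<open>\<open>slices\<close> demands that every slice lives on the projected domain,
    and projections along directions outside \<Theta> need not. Those directions are negligible, so
    any admissible value will do.\<close>
  define \<gamma>s where "\<gamma>s \<theta> = (if \<theta> \<in> \<Theta> then Rj \<theta> lam else null_measure borel)" for \<theta>
  have \<gamma>s: "\<gamma>s \<theta> \<in> pos_measures ?\<Gamma>" for \<theta>
  proof (cases "\<theta> \<in> \<Theta>")
    case True
    then have "atomic_measure N m (\<lambda>i. (\<theta> \<bullet> x i, \<theta> \<bullet> v i)) \<in> pos_measures ?\<Gamma>"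
      using xv by (intro atomic_measure_in_pos_measures) (auto simp: proj_domain_def)
    then show ?thesis using True by (simp add: \<gamma>s_def lam_def Rj_atomic_measure)
  next
    case False
    then show ?thesis by (auto simp: \<gamma>s_def pos_measures_def intro!: finite_measureI)
  qed
  have em\<gamma>s: "emeasure (\<gamma>s \<theta>) B = indicator \<Theta> \<theta> * (\<Sum>i\<in>{1..N}. ennreal (m i) * indicator B (\<theta> \<bullet> x i, \<theta> \<bullet> v i))"
    if "B \<in> sets borel" for \<theta> B
    using that by (simp add: \<gamma>s_def lam_def Rj_atomic_measure emeasure_atomic_measure)
  have "slices H ?\<Gamma> \<gamma> \<gamma>s"
    unfolding slices_def
  proof (intro conjI allI ballI)
    fix B :: "(real \<times> real) set" assume B [measurable]: "B \<in> sets borel"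
    have [measurable]: "(\<lambda>\<theta>. (\<theta> \<bullet> x i, \<theta> \<bullet> v i)) \<in> borel_measurable borel" for i
      by (intro borel_measurable_continuous_onI continuous_intros)
    have [measurable]: "\<Theta> \<in> sets borel" using assms(2) by (rule borel_compact)
    show "(\<lambda>\<theta>. emeasure (\<gamma>s \<theta>) B) \<in> borel_measurable borel"
      unfolding em\<gamma>s[OF B] by measurable
    fix A :: "'a set" assume A [measurable]: "A \<in> sets borel"
    have AB: "A \<times> B \<in> sets borel" by (subst borel_prod[symmetric]) (rule pair_measureI[OF A B])
    show "emeasure \<gamma> (A \<times> B) = (\<integral>\<^sup>+\<theta>\<in>A. emeasure (\<gamma>s \<theta>) B \<partial>H)"
      unfolding em[OF AB]
    proof (rule nn_integral_cong_AE)
      show "AE \<theta> in H. emeasure lam {p. g (\<theta>, p) \<in> A \<times> B} = emeasure (\<gamma>s \<theta>) B * indicator A \<theta>"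
        using AE\<Theta>
      proof eventually_elim
        case (elim \<theta>)
        have "emeasure (Rj \<theta> lam) B = emeasure lam {p. (\<theta> \<bullet> fst p, \<theta> \<bullet> snd p) \<in> B}"
          unfolding Rj_def using measurable_Rj[of \<theta>] B
          by (subst emeasure_distr) (auto simp: measurable_cong_sets[OF sets_lam refl] lam_def vimage_def split_beta)
        then show ?case using elim by (auto simp: \<gamma>s_def g_def split_beta indicator_def)
      qed
    qed
  qed (rule \<gamma>s)
  moreover have "\<gamma> \<in> pos_measures (\<Theta> \<times> ?\<Gamma>)"
  proof -
    have "emeasure \<gamma> S = 0" if S: "S \<in> sets borel" "S \<inter> \<Theta> \<times> ?\<Gamma> = {}" for S
    proof -
      have "(\<integral>\<^sup>+\<theta>. emeasure lam {p. g (\<theta>, p) \<in> S} \<partial>H) = (\<integral>\<^sup>+\<theta>. 0 \<partial>H)"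
      proof (rule nn_integral_cong_AE)
        show "AE \<theta> in H. emeasure lam {p. g (\<theta>, p) \<in> S} = 0"
          using AE\<Theta>
        proof eventually_elim
          case (elim \<theta>)
          have "{p. g (\<theta>, p) \<in> S} = (\<lambda>p. g (\<theta>, p)) -` S" by auto
          moreover have "(\<lambda>p. g (\<theta>, p)) \<in> borel_measurable borel"
            unfolding g_def split_beta by (intro borel_measurable_continuous_onI continuous_intros) 
          ultimately have "{p. g (\<theta>, p) \<in> S} \<in> sets borel" using S(1) measurable_sets_borel by metis
          moreover have "lam \<in> pos_measures (phase_domain \<Omega> \<Sigma>)"
            unfolding lam_def using xv by (intro atomic_measure_in_pos_measures)
          moreover have "{p. g (\<theta>, p) \<in> S} \<inter> phase_domain \<Omega> \<Sigma> = {}"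
            using S(2) elim by (force simp: g_def proj_domain_def)
          ultimately show ?case by (auto simp: pos_measures_def)
        qed
      qed
      then show ?thesis using em[OF S(1)] by simp
    qed
    moreover have "finite_measure \<gamma>"
      unfolding \<gamma>_def using H.finite_measure_axioms lam.finite_measure_axioms g
      by (intro finite_measure.finite_measure_distr finite_measure_pair_measure)
    ultimately show ?thesis by (auto simp: pos_measures_def \<gamma>_def)
  qed
  moreover have "Mv t lam \<in> pos_measures \<Omega>" if "t \<in> \<Sigma>" for t
    unfolding lam_def Mv_atomic_measure using xv that
    by (intro atomic_measure_in_pos_measures) (auto simp: phase_domain_def)
  \<comment> \<open>Projecting and moving commute, by linearity of the inner product.\<close>
  moreover have "AE \<theta> in H. Mv t (\<gamma>s \<theta>) = Rd \<theta> (Mv t lam)" for t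
    using AE\<Theta>
    by eventually_elim
      (simp add: \<gamma>s_def lam_def Mv_atomic_measure Rd_atomic_measure Rj_atomic_measure inner_add_right)
  ultimately have "feasible \<Omega> \<Sigma> \<Theta> H (\<lambda>t. Mv t lam, \<gamma>)"
    by (auto simp: feasible_def)
  then show thesis by (rule that)
qed

subsection \<open>Geometry of the projections\<close>

lemma compact_pos_lower_bound:
  fixes f :: "'a::topological_space \<Rightarrow> real"
  assumes "compact K" "continuous_on K f" "\<And>x. x \<in> K \<Longrightarrow> 0 < f x"
  obtains c where "0 < c" "\<And>x. x \<in> K \<Longrightarrow> c \<le> f x"
proof (cases "K = {}")
  case True
  then show ?thesis using that[of 1] by simp
next
  case False
  then obtain x0 where "x0 \<in> K" "\<And>x. x \<in> K \<Longrightarrow> f x0 \<le> f x"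
    using continuous_attains_inf[OF assms(1) _ assms(2)] by blast
  then show ?thesis using that[of "f x0"] assms(3) by blast
qed

lemma finite_uniform_pos:
  fixes P :: "'i \<Rightarrow> real \<Rightarrow> bool"
  assumes "finite I" "\<And>i. i \<in> I \<Longrightarrow> \<exists>c>0. P i c" "\<And>i c c'. P i c \<Longrightarrow> 0 < c' \<Longrightarrow> c' \<le> c \<Longrightarrow> P i c'"
  shows "\<exists>c>0. \<forall>i\<in>I. P i c"
  using assms(1,2)
proof (induction I)
  case empty
  then show ?case by (auto intro: exI[of _ 1])
next
  case (insert j I)
  then obtain c c' where "0 < c" "\<forall>i\<in>I. P i c" "0 < c'" "P j c'" by (metis insert_iff)
  then have "0 < min c c'" "\<forall>i\<in>insert j I. P i (min c c')" using assms(3) by auto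
  then show ?case by blast
qed

text \<open>There are finitely many pairs of particles, and each projected gap is continuous and
  positive on the compact set of pairs of a time and a direction.\<close>

lemma projected_separation:
  fixes x v :: "nat \<Rightarrow> 'a::euclidean_space"
  assumes "compact S" "compact \<Theta>"
    and "\<And>t \<theta> i j. t \<in> S \<Longrightarrow> \<theta> \<in> \<Theta> \<Longrightarrow> i \<in> {1..N} \<Longrightarrow> j \<in> {1..N} \<Longrightarrow> i \<noteq> j \<Longrightarrow>
           \<theta> \<bullet> (x i + t *\<^sub>R v i) \<noteq> \<theta> \<bullet> (x j + t *\<^sub>R v j)"
  obtains \<sigma> where "0 < \<sigma>"
    "\<And>t \<theta> i j. t \<in> S \<Longrightarrow> \<theta> \<in> \<Theta> \<Longrightarrow> i \<in> {1..N} \<Longrightarrow> j \<in> {1..N} \<Longrightarrow> i \<noteq> j \<Longrightarrow>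
       \<sigma> \<le> \<bar>\<theta> \<bullet> (x i + t *\<^sub>R v i) - \<theta> \<bullet> (x j + t *\<^sub>R v j)\<bar>"
proof -
  have "\<exists>c>0. \<forall>q\<in>{q\<in>{1..N} \<times> {1..N}. fst q \<noteq> snd q}. \<forall>p\<in>S \<times> \<Theta>.
      c \<le> \<bar>snd p \<bullet> (x (fst q) + fst p *\<^sub>R v (fst q)) - snd p \<bullet> (x (snd q) + fst p *\<^sub>R v (snd q))\<bar>"
  proof (rule finite_uniform_pos)
    fix q assume q: "q \<in> {q\<in>{1..N} \<times> {1..N}. fst q \<noteq> snd q}"
    obtain c where "0 < c" "\<And>p. p \<in> S \<times> \<Theta> \<Longrightarrow>
      c \<le> \<bar>snd p \<bullet> (x (fst q) + fst p *\<^sub>R v (fst q)) - snd p \<bullet> (x (snd q) + fst p *\<^sub>R v (snd q))\<bar>"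
    proof (rule compact_pos_lower_bound)
      show "compact (S \<times> \<Theta>)" using assms(1,2) by (rule compact_Times)
      show "continuous_on (S \<times> \<Theta>) (\<lambda>p. \<bar>snd p \<bullet> (x (fst q) + fst p *\<^sub>R v (fst q)) - snd p \<bullet> (x (snd q) + fst p *\<^sub>R v (snd q))\<bar>)"
        by (intro continuous_intros)
      fix p assume "p \<in> S \<times> \<Theta>"
      then show "0 < \<bar>snd p \<bullet> (x (fst q) + fst p *\<^sub>R v (fst q)) - snd p \<bullet> (x (snd q) + fst p *\<^sub>R v (snd q))\<bar>"
        using q assms(3)[of "fst p" "snd p" "fst q" "snd q"] by auto
    qed (rule that)
    then show "\<exists>c>0. \<forall>p\<in>S \<times> \<Theta>.
      c \<le> \<bar>snd p \<bullet> (x (fst q) + fst p *\<^sub>R v (fst q)) - snd p \<bullet> (x (snd q) + fst p *\<^sub>R v (snd q))\<bar>"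
      by blast
  qed (auto intro: order_trans)
  then show thesis using that by fastforce
qed

text \<open>With a single observation time, every particle could be replaced by one at the same
  position with another velocity, which is a ghost. Two times are what makes position and velocity
  computable from observed positions.\<close>

lemma two_times_if_no_ghost:
  fixes y w :: "nat \<Rightarrow> real"
  assumes "\<not> has_ghost T N y w" "1 \<le> N" "T \<noteq> {}"
  obtains t1 t2 where "t1 \<in> T" "t2 \<in> T" "t1 \<noteq> t2"
proof (rule ccontr)
  assume no: "\<not> thesis"
  from assms(3) obtain t where t: "t \<in> T" by blast
  with no that have T: "T = {t}" by blast
  \<comment> \<open>A velocity that no particle has, so that the constructed point cannot belong to
    the configuration.\<close>
  obtain q where q: "q \<notin> w ` {1..N}"
    using ex_new_if_finite[OF infinite_UNIV_char_0, of "w ` {1..N}"] by auto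
  have "has_ghost T N y w"
    unfolding has_ghost_def T
  proof (intro exI conjI ballI)
    show "(y 1 + t * (w 1 - q), q) \<notin> (\<lambda>i. (y i, w i)) ` {1..N}" using q by auto
    fix s assume "s \<in> {t}"
    then show "\<exists>i\<in>{1..N}. y 1 + t * (w 1 - q) + s *\<^sub>R q = y i + s *\<^sub>R w i"
      using assms(2) by (intro bexI[of _ 1]) (auto simp: algebra_simps)
  qed
  with assms(1) show False by simp
qed

text \<open>An assignment of particles to times that is matched by a line up to a small error is constant:
  the line through two of the matched points depends continuously on the projection direction, and
  an exact match of a nonconstant assignment would be a ghost particle or a coincidence.\<close>

lemma assignment_constant:
  fixes x v :: "nat \<Rightarrow> 'a::euclidean_space"
  assumes "finite T" "T \<noteq> {}" "compact \<Theta>"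
    and co: "\<And>\<theta>. \<theta> \<in> \<Theta> \<Longrightarrow> \<not> has_coincidence T N (\<lambda>i. \<theta> \<bullet> x i) (\<lambda>i. \<theta> \<bullet> v i)"
    and gh: "\<And>\<theta>. \<theta> \<in> \<Theta> \<Longrightarrow> \<not> has_ghost T N (\<lambda>i. \<theta> \<bullet> x i) (\<lambda>i. \<theta> \<bullet> v i)"
  obtains \<sigma> where "0 < \<sigma>"
    "\<And>\<theta> p q a. \<theta> \<in> \<Theta> \<Longrightarrow> a \<in> T \<rightarrow> {1..N} \<Longrightarrow>
      (\<And>t. t \<in> T \<Longrightarrow> \<bar>p + t * q - \<theta> \<bullet> (x (a t) + t *\<^sub>R v (a t))\<bar> < \<sigma>) \<Longrightarrow> \<exists>i\<in>{1..N}. \<forall>t\<in>T. a t = i"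
proof -
  define P where "P a \<sigma> \<longleftrightarrow> (\<forall>\<theta>\<in>\<Theta>. \<forall>p q. (\<forall>t\<in>T. \<bar>p + t * q - \<theta> \<bullet> (x (a t) + t *\<^sub>R v (a t))\<bar> < \<sigma>) \<longrightarrow>
      (\<exists>i\<in>{1..N}. \<forall>t\<in>T. a t = i))" for a \<sigma>
  \<comment> \<open>Functions that are undefined off \<open>T\<close> are finite in number, so each
    assignment may have its own threshold. An arbitrary assignment is restricted to \<open>T\<close>
    at the end.\<close>
  have "\<exists>\<sigma>>0. \<forall>a \<in> T \<rightarrow>\<^sub>E {1..N}. P a \<sigma>"
  proof (rule finite_uniform_pos)
    show "finite (T \<rightarrow>\<^sub>E {1..N})" using assms(1) by (intro finite_PiE) auto
    show "P a c'" if "P a c" "c' \<le> c" for a c c'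
      using that unfolding P_def by (meson less_le_trans)
    fix a assume a: "a \<in> T \<rightarrow>\<^sub>E {1..N}"
    show "\<exists>\<sigma>>0. P a \<sigma>"
    proof (cases "\<exists>i\<in>{1..N}. \<forall>t\<in>T. a t = i")
      case True
      then show ?thesis unfolding P_def by (intro exI[of _ 1]) auto
    next
      case False
      obtain t1 t2 where t: "t1 \<in> T" "t2 \<in> T" "a t1 \<noteq> a t2"
        using False a assms(2) by (metis PiE_mem all_not_in_conv)
      then have t12: "t1 \<noteq> t2" by auto
      \<comment> \<open>\<open>e \<theta> t\<close> is the position the assignment prescribes, and
        \<open>p0\<close>, \<open>q0\<close> describe the line through the prescribed positions at
        \<open>t1\<close> and \<open>t2\<close>. These times do not depend on \<theta>, so the total
        deviation of \<open>e\<close> from the line is continuous in \<theta>.\<close>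
      define e where "e \<theta> t = \<theta> \<bullet> (x (a t) + t *\<^sub>R v (a t))" for \<theta> t
      define q0 where "q0 \<theta> = (e \<theta> t2 - e \<theta> t1) / (t2 - t1)" for \<theta>
      define p0 where "p0 \<theta> = e \<theta> t1 - t1 * q0 \<theta>" for \<theta>
      have p1: "p0 \<theta> + t1 * q0 \<theta> = e \<theta> t1" for \<theta> by (simp add: p0_def)
      have p2: "p0 \<theta> + t2 * q0 \<theta> = e \<theta> t2" for \<theta>
      proof -
        have "(t2 - t1) * q0 \<theta> = e \<theta> t2 - e \<theta> t1" using t12 by (simp add: q0_def)
        then show ?thesis by (simp add: p0_def algebra_simps)
      qed
      obtain c where c: "0 < c" "\<And>\<theta>. \<theta> \<in> \<Theta> \<Longrightarrow> c \<le> (\<Sum>t\<in>T. \<bar>p0 \<theta> + t * q0 \<theta> - e \<theta> t\<bar>)"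
      proof (rule compact_pos_lower_bound[OF assms(3)])
        show "continuous_on \<Theta> (\<lambda>\<theta>. \<Sum>t\<in>T. \<bar>p0 \<theta> + t * q0 \<theta> - e \<theta> t\<bar>)"
          unfolding p0_def q0_def e_def using t12 by (intro continuous_intros) auto
        fix \<theta> assume \<theta>: "\<theta> \<in> \<Theta>"
        have "(\<Sum>t\<in>T. \<bar>p0 \<theta> + t * q0 \<theta> - e \<theta> t\<bar>) \<noteq> 0"
        proof
          assume "(\<Sum>t\<in>T. \<bar>p0 \<theta> + t * q0 \<theta> - e \<theta> t\<bar>) = 0"
          then have eq: "p0 \<theta> + t * q0 \<theta> = \<theta> \<bullet> x (a t) + t * (\<theta> \<bullet> v (a t))" if "t \<in> T" for t
            using that assms(1) by (subst (asm) sum_nonneg_eq_0_iff) (auto simp: e_def inner_add_right)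
          have "(p0 \<theta>, q0 \<theta>) \<in> (\<lambda>i. (\<theta> \<bullet> x i, \<theta> \<bullet> v i)) ` {1..N}"
          proof (rule ccontr)
            assume "(p0 \<theta>, q0 \<theta>) \<notin> (\<lambda>i. (\<theta> \<bullet> x i, \<theta> \<bullet> v i)) ` {1..N}"
            moreover have "\<forall>t\<in>T. \<exists>i\<in>{1..N}. p0 \<theta> + t *\<^sub>R q0 \<theta> = \<theta> \<bullet> x i + t *\<^sub>R (\<theta> \<bullet> v i)"
              using eq a by (intro ballI bexI[of _ "a _"]) auto
            ultimately have "has_ghost T N (\<lambda>i. \<theta> \<bullet> x i) (\<lambda>i. \<theta> \<bullet> v i)"
              unfolding has_ghost_def by blast
            then show False using gh[OF \<theta>] by simp
          qed
          then obtain j where j: "j \<in> {1..N}" "p0 \<theta> = \<theta> \<bullet> x j" "q0 \<theta> = \<theta> \<bullet> v j" by auto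
          have "a s = j" if s: "s \<in> T" for s
          proof (rule ccontr)
            assume "a s \<noteq> j"
            moreover have "\<theta> \<bullet> x (a s) + s *\<^sub>R (\<theta> \<bullet> v (a s)) = \<theta> \<bullet> x j + s *\<^sub>R (\<theta> \<bullet> v j)"
              using eq[OF s] j by simp
            moreover have "a s \<in> {1..N}" using a s by blast
            ultimately have "has_coincidence T N (\<lambda>i. \<theta> \<bullet> x i) (\<lambda>i. \<theta> \<bullet> v i)"
              unfolding has_coincidence_def using j(1) s by blast
            then show False using co[OF \<theta>] by simp
          qed
          then show False using False j(1) by blast
        qed
        then show "0 < (\<Sum>t\<in>T. \<bar>p0 \<theta> + t * q0 \<theta> - e \<theta> t\<bar>)"
          by (simp add: less_le sum_nonneg)
      qed (rule that)
      \<comment> \<open>If all prescribed positions are matched up to \<sigma>, the slope is off by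
        at most \<open>2 * \<sigma> / \<bar>t2 - t1\<bar>\<close>, and the deviation at t is at most
        \<open>\<sigma> * D t\<close>. The choice of \<sigma> makes the sum of these smaller than
        the minimal deviation \<open>c\<close>.\<close>
      define D where "D t = 2 + \<bar>t - t1\<bar> * (2 / \<bar>t2 - t1\<bar>)" for t
      define C where "C = (\<Sum>t\<in>T. D t)"
      have "0 \<le> C" unfolding C_def D_def by (intro sum_nonneg add_nonneg_nonneg mult_nonneg_nonneg) auto
      define \<sigma> where "\<sigma> = c / (C + 1)"
      have \<sigma>: "0 < \<sigma>" "\<sigma> * C < c" using c(1) \<open>0 \<le> C\<close> by (auto simp: \<sigma>_def field_simps)
      have "P a \<sigma>"
        unfolding P_def
      proof (intro ballI allI impI, rule ccontr)
        fix \<theta> p q assume \<theta>: "\<theta> \<in> \<Theta>" and "\<forall>t\<in>T. \<bar>p + t * q - \<theta> \<bullet> (x (a t) + t *\<^sub>R v (a t))\<bar> < \<sigma>"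
        then have near: "\<bar>p + t * q - e \<theta> t\<bar> < \<sigma>" if "t \<in> T" for t using that by (simp add: e_def)
        have "(t2 - t1) * (q - q0 \<theta>) = (p + t2 * q - e \<theta> t2) - (p + t1 * q - e \<theta> t1)"
          unfolding p1[symmetric] p2[symmetric] by (simp add: algebra_simps)
        then have "\<bar>t2 - t1\<bar> * \<bar>q - q0 \<theta>\<bar> \<le> 2 * \<sigma>"
          using near[OF t(1)] near[OF t(2)] by (simp flip: abs_mult)
        then have q: "\<bar>q - q0 \<theta>\<bar> \<le> 2 / \<bar>t2 - t1\<bar> * \<sigma>" using t12 by (simp add: field_simps)
        have "\<bar>p0 \<theta> + t * q0 \<theta> - e \<theta> t\<bar> \<le> \<sigma> * D t" if "t \<in> T" for t
        proof -
          have "p0 \<theta> + t * q0 \<theta> - e \<theta> t = (p + t * q - e \<theta> t) - (p + t1 * q - e \<theta> t1) - (t - t1) * (q - q0 \<theta>)"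
            unfolding p1[symmetric] by (simp add: algebra_simps)
          then have "\<bar>p0 \<theta> + t * q0 \<theta> - e \<theta> t\<bar> \<le> \<sigma> + \<sigma> + \<bar>(t - t1) * (q - q0 \<theta>)\<bar>"
            using near[OF that] near[OF t(1)] by linarith
          also have "\<bar>(t - t1) * (q - q0 \<theta>)\<bar> \<le> \<bar>t - t1\<bar> * (2 / \<bar>t2 - t1\<bar> * \<sigma>)"
            unfolding abs_mult using q by (intro mult_left_mono) auto
          finally show ?thesis by (simp add: D_def algebra_simps)
        qed
        then have "(\<Sum>t\<in>T. \<bar>p0 \<theta> + t * q0 \<theta> - e \<theta> t\<bar>) \<le> \<sigma> * C"
          unfolding C_def sum_distrib_left by (rule sum_mono)
        then show False using c(2)[OF \<theta>] \<sigma>(2) by simp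
      qed
      then show ?thesis using \<sigma>(1) by blast
    qed
  qed
  then obtain \<sigma> where \<sigma>: "0 < \<sigma>" "\<And>a. a \<in> T \<rightarrow>\<^sub>E {1..N} \<Longrightarrow> P a \<sigma>" by blast
  show thesis
  proof (rule that[OF \<sigma>(1)])
    fix \<theta> p q a assume *: "\<theta> \<in> \<Theta>" "a \<in> T \<rightarrow> {1..N}"
      "\<And>t. t \<in> T \<Longrightarrow> \<bar>p + t * q - \<theta> \<bullet> (x (a t) + t *\<^sub>R v (a t))\<bar> < \<sigma>"
    have "restrict a T \<in> T \<rightarrow>\<^sub>E {1..N}" using *(2) by auto
    from \<sigma>(2)[OF this] have "\<exists>i\<in>{1..N}. \<forall>t\<in>T. restrict a T t = i"
      unfolding P_def using *(1,3) by (metis (no_types, lifting) restrict_apply')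
    then show "\<exists>i\<in>{1..N}. \<forall>t\<in>T. a t = i" by simp
  qed
qed

lemma dist_Pair_le: "dist (a, b) (c, d) \<le> dist a c + dist b d"
  by (simp add: dist_Pair_Pair sqrt_sum_squares_le_sum)

text \<open>If at some time the capped distance reaches \<open>min r \<sigma>\<close>, that term
  alone dominates the left side, which is capped there. Otherwise every time selects a particle
  closer than \<sigma>; by \<open>const\<close> it is always the same one, and its positions at
  \<open>t1\<close> and \<open>t2\<close> determine position and velocity. For \<open>N = 0\<close>
  only the first case arises.\<close>

lemma phase_distance_le:
  fixes y w :: "nat \<Rightarrow> real" and P Q :: real
  assumes "finite T" "T \<noteq> {}" "0 < \<sigma>" "0 < r"
    and two: "1 \<le> N \<Longrightarrow> t1 \<in> T \<and> t2 \<in> T \<and> t1 \<noteq> t2"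
    and const: "\<And>a. a \<in> T \<rightarrow> {1..N} \<Longrightarrow>
      (\<And>t. t \<in> T \<Longrightarrow> \<bar>P + t * Q - (y (a t) + t * w (a t))\<bar> < \<sigma>) \<Longrightarrow> \<exists>i\<in>{1..N}. \<forall>t\<in>T. a t = i"
  defines "D \<equiv> 1 + (1 + \<bar>t1\<bar>) / \<bar>t2 - t1\<bar>"
  shows "(capped_min (min r \<sigma>) N (\<lambda>i. dist (P, Q) (y i, w i)))\<^sup>2
    \<le> 4 * D\<^sup>2 * (\<Sum>t\<in>T. (capped_min r N (\<lambda>i. \<bar>P + t * Q - (y i + t * w i)\<bar>))\<^sup>2)"
proof -
  let ?f = "\<lambda>t. capped_min r N (\<lambda>i. \<bar>P + t * Q - (y i + t * w i)\<bar>)"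
  let ?L = "capped_min (min r \<sigma>) N (\<lambda>i. dist (P, Q) (y i, w i))"
  have D: "1 \<le> D" by (simp add: D_def)
  then have D2: "1 \<le> D\<^sup>2" by simp
  have L0: "0 \<le> ?L" using assms(3,4) by (intro capped_min_nonneg) auto
  have f0: "0 \<le> ?f t" for t using assms(4) by (intro capped_min_nonneg) auto
  have single: "(?f t)\<^sup>2 \<le> (\<Sum>t\<in>T. (?f t)\<^sup>2)" if "t \<in> T" for t
    using that assms(1) by (intro member_le_sum) auto
  show ?thesis
  proof (cases "\<exists>t\<in>T. min r \<sigma> \<le> ?f t")
    case True
    then obtain t where t: "t \<in> T" "min r \<sigma> \<le> ?f t" by blast
    have "?L\<^sup>2 \<le> (?f t)\<^sup>2"
      using capped_min_le_cap[of "min r \<sigma>" N "\<lambda>i. dist (P, Q) (y i, w i)"] t(2) L0 by (intro power_mono) auto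
    also have "\<dots> \<le> 1 * (\<Sum>t\<in>T. (?f t)\<^sup>2)" using single[OF t(1)] by simp
    also have "\<dots> \<le> 4 * D\<^sup>2 * (\<Sum>t\<in>T. (?f t)\<^sup>2)"
      using D2 by (intro mult_right_mono sum_nonneg) auto
    finally show ?thesis .
  next
    case False
    then have lt: "?f t < min r \<sigma>" if "t \<in> T" for t using that by (auto simp: not_le)
    have "\<exists>i. i \<in> {1..N} \<and> ?f t = \<bar>P + t * Q - (y i + t * w i)\<bar>" if "t \<in> T" for t
    proof -
      have "?f t \<noteq> r" using lt[OF that] by simp
      then show ?thesis using capped_min_cases[of r N "\<lambda>i. \<bar>P + t * Q - (y i + t * w i)\<bar>"] by blast
    qed
    then obtain a where a: "\<And>t. t \<in> T \<Longrightarrow> a t \<in> {1..N} \<and> ?f t = \<bar>P + t * Q - (y (a t) + t * w (a t))\<bar>"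
      by metis
    have "\<exists>i\<in>{1..N}. \<forall>t\<in>T. a t = i"
    proof (rule const)
      show "a \<in> T \<rightarrow> {1..N}" using a by blast
      show "\<bar>P + t * Q - (y (a t) + t * w (a t))\<bar> < \<sigma>" if "t \<in> T" for t
        using a[OF that] lt[OF that] by simp
    qed
    then obtain i where i: "i \<in> {1..N}" "\<And>t. t \<in> T \<Longrightarrow> a t = i" by blast
    have f: "?f t = \<bar>P + t * Q - (y i + t * w i)\<bar>" if "t \<in> T" for t
      using a[OF that] i(2)[OF that] by simp
    have t: "t1 \<in> T" "t2 \<in> T" "t1 \<noteq> t2" using two i(1) by auto
    \<comment> \<open>The 2 by 2 linear system for \<open>P - y i\<close> and \<open>Q - w i\<close>
      is solved from the deviations at \<open>t1\<close> and \<open>t2\<close>; \<open>D\<close>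
      bounds the norm of its inverse. The factor 4 arises from squaring a sum of two terms and from
      bounding both squares by the full sum.\<close>
    have "(t2 - t1) * (Q - w i) = (P + t2 * Q - (y i + t2 * w i)) - (P + t1 * Q - (y i + t1 * w i))"
      by (simp add: algebra_simps)
    then have "\<bar>t2 - t1\<bar> * \<bar>Q - w i\<bar> \<le> ?f t1 + ?f t2"
      unfolding f[OF t(1)] f[OF t(2)] by (simp flip: abs_mult)
    then have Q: "\<bar>Q - w i\<bar> \<le> (?f t1 + ?f t2) / \<bar>t2 - t1\<bar>" using t(3) by (simp add: field_simps)
    have "P - y i = (P + t1 * Q - (y i + t1 * w i)) - t1 * (Q - w i)" by (simp add: algebra_simps)
    then have "\<bar>P - y i\<bar> \<le> ?f t1 + \<bar>t1\<bar> * \<bar>Q - w i\<bar>"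
      unfolding f[OF t(1)] by (metis abs_mult abs_triangle_ineq4)
    then have "\<bar>P - y i\<bar> + \<bar>Q - w i\<bar> \<le> ?f t1 + (1 + \<bar>t1\<bar>) * \<bar>Q - w i\<bar>" by (simp add: algebra_simps)
    also have "\<dots> \<le> (?f t1 + ?f t2) + (1 + \<bar>t1\<bar>) * ((?f t1 + ?f t2) / \<bar>t2 - t1\<bar>)"
      using Q f0[of t2] by (intro add_mono mult_left_mono) auto
    also have "\<dots> = D * (?f t1 + ?f t2)" by (simp add: D_def algebra_simps add_divide_distrib)
    finally have "dist (P, Q) (y i, w i) \<le> D * (?f t1 + ?f t2)"
      using dist_Pair_le[of P Q "y i" "w i"] by (simp add: dist_real_def)
    then have "?L \<le> D * (?f t1 + ?f t2)"
      using capped_min_le[OF i(1), of "min r \<sigma>" "\<lambda>i. dist (P, Q) (y i, w i)"] by linarith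
    then have "?L\<^sup>2 \<le> (D * (?f t1 + ?f t2))\<^sup>2" using L0 by (intro power_mono)
    also have "\<dots> = D\<^sup>2 * (?f t1 + ?f t2)\<^sup>2" by (simp add: power_mult_distrib)
    also have "\<dots> \<le> D\<^sup>2 * (2 * ((?f t1)\<^sup>2 + (?f t2)\<^sup>2))"
      using sum_squares_bound[of "?f t1" "?f t2"]
      by (intro mult_left_mono) (auto simp: power2_sum)
    also have "\<dots> \<le> D\<^sup>2 * (2 * (2 * (\<Sum>t\<in>T. (?f t)\<^sup>2)))"
      using single[OF t(1)] single[OF t(2)] by (intro mult_left_mono) auto
    finally show ?thesis by simp
  qed
qed

text \<open>Near an atom the capped distance of the projections is the projected distance, so there it
  suffices that the directions span; away from the atoms finitely many directions suffice by
  compactness.\<close>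

lemma finitely_many_directions:
  fixes x v :: "nat \<Rightarrow> 'a::euclidean_space"
  assumes "compact \<Omega>" "compact S" and \<Theta>: "\<And>\<theta>. \<theta> \<in> \<Theta> \<Longrightarrow> norm \<theta> = 1" and "0 < r" "0 < \<sigma>"
    and sep: "\<And>t \<theta> i j. t \<in> S \<Longrightarrow> \<theta> \<in> \<Theta> \<Longrightarrow> i \<in> {1..N} \<Longrightarrow> j \<in> {1..N} \<Longrightarrow> i \<noteq> j \<Longrightarrow>
       \<sigma> \<le> \<bar>\<theta> \<bullet> (x i + t *\<^sub>R v i) - \<theta> \<bullet> (x j + t *\<^sub>R v j)\<bar>"
    and det: "\<And>t y. t \<in> S \<Longrightarrow> y \<notin> (\<lambda>i. x i + t *\<^sub>R v i) ` {1..N} \<Longrightarrow>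
       \<exists>\<theta>\<in>\<Theta>. \<forall>i\<in>{1..N}. \<theta> \<bullet> y \<noteq> \<theta> \<bullet> (x i + t *\<^sub>R v i)"
    and \<rho>: "0 < \<rho>" "\<rho> \<le> r" "2 * \<rho> \<le> \<sigma>"
  obtains F C where "finite F" "F \<subseteq> \<Theta>" "0 < C"
    "\<And>t y. t \<in> S \<Longrightarrow> y \<in> \<Omega> \<Longrightarrow> (capped_min \<rho> N (\<lambda>i. dist y (x i + t *\<^sub>R v i)))\<^sup>2
       \<le> C * (\<Sum>\<theta>\<in>F. (capped_min r N (\<lambda>i. \<bar>\<theta> \<bullet> y - \<theta> \<bullet> (x i + t *\<^sub>R v i)\<bar>))\<^sup>2)"
proof (cases "S = {}")
  case True
  then show ?thesis using that[of "{}" 1] by auto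
next
  case False
  then obtain t0 where t0: "t0 \<in> S" by blast
  define z where "z i t = x i + t *\<^sub>R v i" for i t
  \<comment> \<open>Finitely many directions that span the space, with a lower bound of the
    resulting quadratic form. The bound is claimed only if there is an atom to start from.\<close>
  have "\<exists>F1 c1. finite F1 \<and> F1 \<subseteq> \<Theta> \<and> 0 < c1 \<and> (1 \<le> N \<longrightarrow> (\<forall>y. c1 * (norm y)\<^sup>2 \<le> (\<Sum>\<theta>\<in>F1. (\<theta> \<bullet> y)\<^sup>2)))"
  proof (cases "1 \<le> N")
    case True
    \<comment> \<open>Moving from an atom in direction y leaves the finite set of atoms at some
      point. A direction that tells this point from that atom is not orthogonal to y.\<close>
    have span: "\<exists>\<theta>\<in>\<Theta>. \<theta> \<bullet> y \<noteq> 0" if "y \<noteq> 0" for y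
    proof -
      let ?g = "\<lambda>s. z 1 t0 + s *\<^sub>R y"
      have "inj ?g" using that by (auto intro!: injI)
      then have "infinite (range ?g)" using infinite_UNIV_char_0 finite_imageD by blast
      then have "\<not> range ?g \<subseteq> (\<lambda>i. z i t0) ` {1..N}" using finite_subset by blast
      then obtain s where "?g s \<notin> (\<lambda>i. z i t0) ` {1..N}" by blast
      then obtain \<theta> where "\<theta> \<in> \<Theta>" "\<theta> \<bullet> ?g s \<noteq> \<theta> \<bullet> z 1 t0"
        using det[OF t0] True unfolding z_def by fastforce
      then show ?thesis by (intro bexI[of _ \<theta>]) (auto simp: inner_add_right)
    qed
    define U where "U \<theta> = {y. \<theta> \<bullet> y \<noteq> 0}" for \<theta> :: 'a
    have "compact (sphere (0::'a) 1)" by simp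
    moreover have "open (U \<theta>)" for \<theta>
      unfolding U_def by (intro open_Collect_neq continuous_intros)
    moreover have "sphere 0 1 \<subseteq> (\<Union>\<theta>\<in>\<Theta>. U \<theta>)"
    proof
      fix y :: 'a assume "y \<in> sphere 0 1"
      then have "y \<noteq> 0" by auto
      then show "y \<in> (\<Union>\<theta>\<in>\<Theta>. U \<theta>)" using span by (simp add: U_def)
    qed
    ultimately obtain F1 where F1: "F1 \<subseteq> \<Theta>" "finite F1" "sphere 0 1 \<subseteq> (\<Union>\<theta>\<in>F1. U \<theta>)"
      by (rule compactE_image[where f = U and C = \<Theta>])
    obtain c1 where c1: "0 < c1" "\<And>y. y \<in> sphere 0 1 \<Longrightarrow> c1 \<le> (\<Sum>\<theta>\<in>F1. (\<theta> \<bullet> y)\<^sup>2)"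
    proof (rule compact_pos_lower_bound)
      show "compact (sphere (0::'a) 1)" by simp
      show "continuous_on (sphere 0 1) (\<lambda>y. \<Sum>\<theta>\<in>F1. (\<theta> \<bullet> y)\<^sup>2)" by (intro continuous_intros)
      fix y :: 'a assume "y \<in> sphere 0 1"
      then obtain \<theta> where "\<theta> \<in> F1" "\<theta> \<bullet> y \<noteq> 0" using F1(3) by (auto simp: U_def)
      then show "0 < (\<Sum>\<theta>\<in>F1. (\<theta> \<bullet> y)\<^sup>2)" using F1(2) by (intro sum_pos2[of _ \<theta>]) auto
    qed (rule that)
    have "c1 * (norm y)\<^sup>2 \<le> (\<Sum>\<theta>\<in>F1. (\<theta> \<bullet> y)\<^sup>2)" for y
    proof (cases "y = 0")
      case False
      then have "c1 \<le> (\<Sum>\<theta>\<in>F1. (\<theta> \<bullet> (y /\<^sub>R norm y))\<^sup>2)" by (intro c1(2)) simp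
      also have "\<dots> = (\<Sum>\<theta>\<in>F1. (\<theta> \<bullet> y)\<^sup>2) / (norm y)\<^sup>2"
        by (simp add: power_mult_distrib sum_distrib_left divide_inverse power_inverse mult.commute)
      finally show ?thesis using False by (simp add: field_simps)
    qed simp
    then show ?thesis using F1 c1(1) by blast
  next
    case False
    then show ?thesis by (intro exI[of _ "{}"] exI[of _ 1]) auto
  qed
  then obtain F1 c1 where F1: "finite F1" "F1 \<subseteq> \<Theta>" "0 < c1"
    "\<And>y. 1 \<le> N \<Longrightarrow> c1 * (norm y)\<^sup>2 \<le> (\<Sum>\<theta>\<in>F1. (\<theta> \<bullet> y)\<^sup>2)" by blast
  \<comment> \<open>\<open>K\<close> consists of the times and points at distance at least \<rho>
    from all atoms. \<open>V (\<theta>, n)\<close> collects those that \<theta> tells from all atoms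
    with margin \<open>1 / (n + 1)\<close>; the index n makes the margins of a finite subcover
    uniform.\<close>
  define K where "K = {p \<in> S \<times> \<Omega>. \<forall>i\<in>{1..N}. \<rho> \<le> dist (snd p) (z i (fst p))}"
  define V where "V = (\<lambda>(\<theta>, n::nat). {p :: real \<times> 'a. \<forall>i\<in>{1..N}. inverse (real (Suc n)) < \<bar>\<theta> \<bullet> snd p - \<theta> \<bullet> z i (fst p)\<bar>})"
  have "K = (S \<times> \<Omega>) \<inter> (\<Inter>i\<in>{1..N}. {p. \<rho> \<le> dist (snd p) (z i (fst p))})" by (auto simp: K_def)
  moreover have "closed {p. \<rho> \<le> dist (snd p) (z i (fst p))}" for i
    unfolding z_def by (intro closed_Collect_le continuous_intros)
  ultimately have "compact K"
    using compact_Times[OF assms(2,1)] by (auto intro!: compact_Int_closed)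
  moreover have "open (V c)" for c
  proof -
    have "V c = (\<Inter>i\<in>{1..N}. {p. inverse (real (Suc (snd c))) < \<bar>fst c \<bullet> snd p - fst c \<bullet> z i (fst p)\<bar>})"
      by (auto simp: V_def split_beta)
    moreover have "open {p::real\<times>'a. inverse (real (Suc (snd c))) < \<bar>fst c \<bullet> snd p - fst c \<bullet> z i (fst p)\<bar>}" for i
      unfolding z_def by (intro open_Collect_less continuous_intros)
    ultimately show ?thesis by (auto intro!: open_INT)
  qed
  moreover have "K \<subseteq> (\<Union>c\<in>\<Theta> \<times> UNIV. V c)"
  proof
    fix p assume p: "p \<in> K"
    have "snd p \<noteq> x i + fst p *\<^sub>R v i" if "i \<in> {1..N}" for i
      using p that \<rho>(1) unfolding K_def z_def by fastforce
    then have "snd p \<notin> (\<lambda>i. x i + fst p *\<^sub>R v i) ` {1..N}" by blast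
    then obtain \<theta> where \<theta>: "\<theta> \<in> \<Theta>" "\<forall>i\<in>{1..N}. \<theta> \<bullet> snd p \<noteq> \<theta> \<bullet> z i (fst p)"
      using det[of "fst p" "snd p"] p by (auto simp: K_def z_def)
    have "\<exists>c>0. \<forall>i\<in>{1..N}. c \<le> \<bar>\<theta> \<bullet> snd p - \<theta> \<bullet> z i (fst p)\<bar>"
    proof (rule finite_uniform_pos)
      fix i assume "i \<in> {1..N}"
      then have "0 < \<bar>\<theta> \<bullet> snd p - \<theta> \<bullet> z i (fst p)\<bar>" using \<theta>(2) by simp
      then show "\<exists>c>0. c \<le> \<bar>\<theta> \<bullet> snd p - \<theta> \<bullet> z i (fst p)\<bar>" by blast
    qed auto
    then obtain c where c: "0 < c" "\<forall>i\<in>{1..N}. c \<le> \<bar>\<theta> \<bullet> snd p - \<theta> \<bullet> z i (fst p)\<bar>" by blast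
    obtain n where "inverse (real (Suc n)) < c" using reals_Archimedean[OF c(1)] by blast
    then have "p \<in> V (\<theta>, n)" using c(2) unfolding V_def by (simp, meson less_le_trans)
    then show "p \<in> (\<Union>c\<in>\<Theta> \<times> UNIV. V c)" using \<theta>(1) by blast
  qed
  ultimately obtain F2 where F2: "F2 \<subseteq> \<Theta> \<times> UNIV" "finite F2" "K \<subseteq> (\<Union>c\<in>F2. V c)"
    by (rule compactE_image[where f = V and C = "\<Theta> \<times> UNIV"])
  have "\<exists>e>0. \<forall>c\<in>F2. e \<le> inverse (real (Suc (snd c)))"
  proof (rule finite_uniform_pos[OF F2(2)])
    show "\<exists>e>0. e \<le> inverse (real (Suc (snd c)))" for c :: "'a \<times> nat"
      by (intro exI[of _ "inverse (real (Suc (snd c)))"]) simp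
  qed auto
  then obtain e0 where e0: "0 < e0" "\<And>c. c \<in> F2 \<Longrightarrow> e0 \<le> inverse (real (Suc (snd c)))" by blast
  \<comment> \<open>The margin must not exceed \<open>r\<close>, since the capped distances on the
    right side cannot.\<close>
  define e where "e = min r e0"
  have e: "0 < e" "e \<le> r" "e \<le> e0" using e0 \<open>0 < r\<close> by (auto simp: e_def)
  define F where "F = F1 \<union> fst ` F2"
  define C where "C = 1 / c1 + \<rho>\<^sup>2 / e\<^sup>2"
  show ?thesis
  proof
    show "finite F" "F \<subseteq> \<Theta>" "0 < C"
      using F1 F2 e \<rho> by (auto simp: F_def C_def intro!: add_pos_nonneg)
    fix t y assume t: "t \<in> S" and y: "y \<in> \<Omega>"
    let ?L = "capped_min \<rho> N (\<lambda>i. dist y (x i + t *\<^sub>R v i))"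
    let ?f = "\<lambda>\<theta>. capped_min r N (\<lambda>i. \<bar>\<theta> \<bullet> y - \<theta> \<bullet> (x i + t *\<^sub>R v i)\<bar>)"
    have L0: "0 \<le> ?L" using \<rho> by (intro capped_min_nonneg) auto
    have S0: "0 \<le> (\<Sum>\<theta>\<in>F. (?f \<theta>)\<^sup>2)" by (intro sum_nonneg) auto
    have C: "1 / c1 \<le> C" "\<rho>\<^sup>2 / e\<^sup>2 \<le> C" using F1(3) by (auto simp: C_def)
    show "?L\<^sup>2 \<le> C * (\<Sum>\<theta>\<in>F. (?f \<theta>)\<^sup>2)"
    proof (cases "(t, y) \<in> K")
      case True
      then obtain c where c: "c \<in> F2" "(t, y) \<in> V c" using F2(3) by blast
      have "e \<le> ?f (fst c)"
        unfolding capped_min_ge_iff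
      proof (intro conjI ballI)
        fix i assume "i \<in> {1..N}"
        then have "inverse (real (Suc (snd c))) < \<bar>fst c \<bullet> y - fst c \<bullet> z i t\<bar>"
          using c(2) by (auto simp: V_def split_beta)
        then show "e \<le> \<bar>fst c \<bullet> y - fst c \<bullet> (x i + t *\<^sub>R v i)\<bar>"
          using e(3) e0(2)[OF c(1)] by (simp add: z_def)
      qed (rule e(2))
      then have "e\<^sup>2 \<le> (?f (fst c))\<^sup>2" using e(1) by (intro power_mono) auto
      also have "\<dots> \<le> (\<Sum>\<theta>\<in>F. (?f \<theta>)\<^sup>2)"
        using c(1) \<open>finite F\<close> by (intro member_le_sum) (auto simp: F_def)
      finally have e2: "e\<^sup>2 \<le> (\<Sum>\<theta>\<in>F. (?f \<theta>)\<^sup>2)" .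
      have "?L\<^sup>2 \<le> \<rho>\<^sup>2" using L0 capped_min_le_cap by (intro power_mono)
      also have "\<dots> = \<rho>\<^sup>2 / e\<^sup>2 * e\<^sup>2" using e(1) by simp
      also have "\<dots> \<le> C * (\<Sum>\<theta>\<in>F. (?f \<theta>)\<^sup>2)"
        using C(2) e2 \<open>0 < C\<close> by (intro mult_mono) auto
      finally show ?thesis .
    next
      case False
      then obtain i where i: "i \<in> {1..N}" "dist y (x i + t *\<^sub>R v i) < \<rho>"
        using t y by (auto simp: K_def z_def not_le)
      let ?d = "y - (x i + t *\<^sub>R v i)"
      \<comment> \<open>A unit direction does not increase distances, so the projection stays within
        \<rho> of the i-th projected atom; \<open>2 * \<rho> \<le> \<sigma>\<close> keeps the other
        atoms farther away and \<open>\<rho> \<le> r\<close> keeps the cap inactive.\<close>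
      have fi: "?f \<theta> = \<bar>\<theta> \<bullet> ?d\<bar>" if "\<theta> \<in> \<Theta>" for \<theta>
      proof -
        have "\<bar>\<theta> \<bullet> ?d\<bar> \<le> norm \<theta> * norm ?d" by (rule Cauchy_Schwarz_ineq2)
        then have le: "\<bar>\<theta> \<bullet> y - \<theta> \<bullet> (x i + t *\<^sub>R v i)\<bar> < \<rho>"
          using i(2) \<Theta>[OF that] by (simp add: dist_norm inner_diff_right)
        have "?f \<theta> = \<bar>\<theta> \<bullet> y - \<theta> \<bullet> (x i + t *\<^sub>R v i)\<bar>"
        proof (rule capped_min_eqI[OF i(1)])
          fix j assume j: "j \<in> {1..N}" "j \<noteq> i"
          show "\<bar>\<theta> \<bullet> y - \<theta> \<bullet> (x i + t *\<^sub>R v i)\<bar> \<le> \<bar>\<theta> \<bullet> y - \<theta> \<bullet> (x j + t *\<^sub>R v j)\<bar>"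
            using sep[OF t that j(1) i(1) j(2)] le \<rho>(3) by linarith
        qed (use le \<rho>(2) in simp)
        then show ?thesis by (simp add: inner_diff_right)
      qed
      have "?L\<^sup>2 \<le> (norm ?d)\<^sup>2"
        using capped_min_le[OF i(1), of \<rho> "\<lambda>i. dist y (x i + t *\<^sub>R v i)"] L0
        by (intro power_mono) (auto simp: dist_norm)
      also have "\<dots> = 1 / c1 * (c1 * (norm ?d)\<^sup>2)" using F1(3) by simp
      also have "\<dots> \<le> 1 / c1 * (\<Sum>\<theta>\<in>F1. (\<theta> \<bullet> ?d)\<^sup>2)"
        using F1(3) F1(4)[of ?d] i(1) by (intro mult_left_mono) auto
      also have "(\<Sum>\<theta>\<in>F1. (\<theta> \<bullet> ?d)\<^sup>2) = (\<Sum>\<theta>\<in>F1. (?f \<theta>)\<^sup>2)"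
        using F1(2) fi by (intro sum.cong) auto
      also have "1 / c1 * (\<Sum>\<theta>\<in>F1. (?f \<theta>)\<^sup>2) \<le> C * (\<Sum>\<theta>\<in>F. (?f \<theta>)\<^sup>2)"
        using C(1) F1(1,3) \<open>finite F\<close> \<open>0 < C\<close> by (intro mult_mono sum_mono2 sum_nonneg) (auto simp: F_def)
      finally show ?thesis .
    qed
  qed
qed

text \<open>Both uniform constants on \<Theta> are positive, so giving away half of the smaller one
  leaves room for a perturbation of the direction.\<close>

lemma projection_neighbourhood:
  fixes x v :: "nat \<Rightarrow> 'a::euclidean_space"
  assumes "finite T" "T \<noteq> {}" "compact S" "T \<subseteq> S" "compact \<Theta>"
    and "\<And>\<theta>. \<theta> \<in> \<Theta> \<Longrightarrow> \<not> has_coincidence T N (\<lambda>i. \<theta> \<bullet> x i) (\<lambda>i. \<theta> \<bullet> v i)"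
    and "\<And>\<theta>. \<theta> \<in> \<Theta> \<Longrightarrow> \<not> has_ghost T N (\<lambda>i. \<theta> \<bullet> x i) (\<lambda>i. \<theta> \<bullet> v i)"
    and "\<And>t \<theta> i j. t \<in> S \<Longrightarrow> \<theta> \<in> \<Theta> \<Longrightarrow> i \<in> {1..N} \<Longrightarrow> j \<in> {1..N} \<Longrightarrow> i \<noteq> j \<Longrightarrow>
           \<theta> \<bullet> (x i + t *\<^sub>R v i) \<noteq> \<theta> \<bullet> (x j + t *\<^sub>R v j)"
  obtains \<sigma> \<eta> where "0 < \<sigma>" "0 < \<eta>"
    "\<And>\<theta> \<theta>' t i j. \<theta>' \<in> \<Theta> \<Longrightarrow> dist \<theta> \<theta>' < \<eta> \<Longrightarrow> t \<in> S \<Longrightarrow> i \<in> {1..N} \<Longrightarrow> j \<in> {1..N} \<Longrightarrow> i \<noteq> j \<Longrightarrow>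
       \<sigma> \<le> \<bar>\<theta> \<bullet> (x i + t *\<^sub>R v i) - \<theta> \<bullet> (x j + t *\<^sub>R v j)\<bar>"
    "\<And>\<theta> \<theta>' p q a. \<theta>' \<in> \<Theta> \<Longrightarrow> dist \<theta> \<theta>' < \<eta> \<Longrightarrow> a \<in> T \<rightarrow> {1..N} \<Longrightarrow>
      (\<And>t. t \<in> T \<Longrightarrow> \<bar>p + t * q - \<theta> \<bullet> (x (a t) + t *\<^sub>R v (a t))\<bar> < \<sigma>) \<Longrightarrow> \<exists>i\<in>{1..N}. \<forall>t\<in>T. a t = i"
proof -
  obtain \<sigma>1 where \<sigma>1: "0 < \<sigma>1" "\<And>t \<theta> i j. t \<in> S \<Longrightarrow> \<theta> \<in> \<Theta> \<Longrightarrow> i \<in> {1..N} \<Longrightarrow> j \<in> {1..N} \<Longrightarrow> i \<noteq> j \<Longrightarrow>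
       \<sigma>1 \<le> \<bar>\<theta> \<bullet> (x i + t *\<^sub>R v i) - \<theta> \<bullet> (x j + t *\<^sub>R v j)\<bar>"
  proof (rule projected_separation[OF assms(3,5), of N x v])
    show "\<theta> \<bullet> (x i + t *\<^sub>R v i) \<noteq> \<theta> \<bullet> (x j + t *\<^sub>R v j)"
      if "t \<in> S" "\<theta> \<in> \<Theta>" "i \<in> {1..N}" "j \<in> {1..N}" "i \<noteq> j" for t \<theta> i j
      using that by (rule assms(8))
  qed (rule that)
  obtain \<sigma>2 where \<sigma>2: "0 < \<sigma>2"
    "\<And>\<theta> p q a. \<theta> \<in> \<Theta> \<Longrightarrow> a \<in> T \<rightarrow> {1..N} \<Longrightarrow>
      (\<And>t. t \<in> T \<Longrightarrow> \<bar>p + t * q - \<theta> \<bullet> (x (a t) + t *\<^sub>R v (a t))\<bar> < \<sigma>2) \<Longrightarrow> \<exists>i\<in>{1..N}. \<forall>t\<in>T. a t = i"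
  proof (rule assignment_constant[OF assms(1,2,5,6,7)])
    fix s assume "0 < s" and "\<And>\<theta> p q a. \<theta> \<in> \<Theta> \<Longrightarrow> a \<in> T \<rightarrow> {1..N} \<Longrightarrow>
      (\<And>t. t \<in> T \<Longrightarrow> \<bar>p + t * q - \<theta> \<bullet> (x (a t) + t *\<^sub>R v (a t))\<bar> < s) \<Longrightarrow> \<exists>i\<in>{1..N}. \<forall>t\<in>T. a t = i"
    then show thesis by (rule that)
  qed
  obtain \<tau> where \<tau>: "\<And>t. t \<in> S \<Longrightarrow> \<bar>t\<bar> \<le> \<tau>"
    using compact_imp_bounded[OF assms(3)] by (auto simp: bounded_iff)
  define L where "L = (\<Sum>i\<in>{1..N}. norm (x i) + \<bar>\<tau>\<bar> * norm (v i))"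
  have L0: "0 \<le> L" by (simp add: L_def sum_nonneg)
  have L: "norm (x i + t *\<^sub>R v i) \<le> L" if "i \<in> {1..N}" "t \<in> S" for i t
  proof -
    have "norm (x i + t *\<^sub>R v i) \<le> norm (x i) + \<bar>t\<bar> * norm (v i)"
      by (metis norm_scaleR norm_triangle_ineq)
    also have "\<dots> \<le> norm (x i) + \<bar>\<tau>\<bar> * norm (v i)"
      using \<tau>[OF that(2)] by (intro add_left_mono mult_right_mono) auto
    also have "\<dots> \<le> L" unfolding L_def using that(1) by (intro member_le_sum) auto
    finally show ?thesis .
  qed
  \<comment> \<open>All particle positions have norm at most \<open>L\<close>, so directions at
    distance less than \<eta> project them with error at most \<open>\<sigma> / 2\<close>. Two such
    errors fit between \<sigma> and \<open>\<sigma>1\<close>, one fits between \<sigma> and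
    \<open>\<sigma>2\<close>.\<close>
  define \<sigma> where "\<sigma> = min \<sigma>1 \<sigma>2 / 2"
  define \<eta> where "\<eta> = \<sigma> / (2 * (L + 1))"
  have \<sigma>: "0 < \<sigma>" "2 * \<sigma> \<le> \<sigma>1" "2 * \<sigma> \<le> \<sigma>2" using \<sigma>1(1) \<sigma>2(1) by (auto simp: \<sigma>_def)
  have \<eta>: "0 < \<eta>" using \<sigma> L0 by (simp add: \<eta>_def)
  have close: "\<bar>\<theta> \<bullet> (x i + t *\<^sub>R v i) - \<theta>' \<bullet> (x i + t *\<^sub>R v i)\<bar> \<le> \<sigma> / 2"
    if "dist \<theta> \<theta>' < \<eta>" "i \<in> {1..N}" "t \<in> S" for \<theta> \<theta>' i t
  proof -
    have "\<bar>(\<theta> - \<theta>') \<bullet> (x i + t *\<^sub>R v i)\<bar> \<le> norm (\<theta> - \<theta>') * norm (x i + t *\<^sub>R v i)"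
      by (rule Cauchy_Schwarz_ineq2)
    also have "\<dots> \<le> \<eta> * L" using that L \<eta> by (intro mult_mono) (auto simp: dist_norm)
    also have "\<dots> \<le> \<sigma> / 2" using \<sigma>(1) L0 by (simp add: \<eta>_def field_simps)
    finally show ?thesis by (simp add: inner_diff_left)
  qed
  show thesis
  proof (rule that[OF \<sigma>(1) \<eta>])
    fix \<theta> \<theta>' t i j
    assume *: "\<theta>' \<in> \<Theta>" "dist \<theta> \<theta>' < \<eta>" "t \<in> S" "i \<in> {1..N}" "j \<in> {1..N}" "i \<noteq> j"
    show "\<sigma> \<le> \<bar>\<theta> \<bullet> (x i + t *\<^sub>R v i) - \<theta> \<bullet> (x j + t *\<^sub>R v j)\<bar>"
      using \<sigma>1(2)[OF *(3,1,4-6)] close[OF *(2,4,3)] close[OF *(2,5,3)] \<sigma>(2) by linarith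
  next
    fix \<theta> \<theta>' p q a
    assume *: "\<theta>' \<in> \<Theta>" "dist \<theta> \<theta>' < \<eta>" "a \<in> T \<rightarrow> {1..N}"
      "\<And>t. t \<in> T \<Longrightarrow> \<bar>p + t * q - \<theta> \<bullet> (x (a t) + t *\<^sub>R v (a t))\<bar> < \<sigma>"
    show "\<exists>i\<in>{1..N}. \<forall>t\<in>T. a t = i"
    proof (rule \<sigma>2(2)[OF *(1,3)])
      fix t assume t: "t \<in> T"
      then have "a t \<in> {1..N}" "t \<in> S" using *(3) assms(4) by auto
      then show "\<bar>p + t * q - \<theta>' \<bullet> (x (a t) + t *\<^sub>R v (a t))\<bar> < \<sigma>2"
        using *(4)[OF t] close[OF *(2), of "a t" t] \<sigma>(1,3) by linarith
    qed
  qed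
qed

lemma projected_nn_integral:
  assumes "sets g = sets borel" "sets u = sets borel" "Mv t g = Rd \<theta> u" "F \<in> borel_measurable borel"
  shows "(\<integral>\<^sup>+p. F (fst p + t * snd p) \<partial>g) = (\<integral>\<^sup>+y. F (\<theta> \<bullet> y) \<partial>u)"
proof -
  have "(\<integral>\<^sup>+y. F y \<partial>Mv t g) = (\<integral>\<^sup>+p. F (fst p + t * snd p) \<partial>g)"
    unfolding Mv_def using assms(1,4) measurable_Mv[of t, where 'a = real]
    by (subst nn_integral_distr) (auto simp: measurable_cong_sets[OF assms(1) refl] split_beta)
  moreover have "(\<integral>\<^sup>+y. F y \<partial>Rd \<theta> u) = (\<integral>\<^sup>+y. F (\<theta> \<bullet> y) \<partial>u)"
    unfolding Rd_def using assms(2,4) measurable_Rd[of \<theta>]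
    by (subst nn_integral_distr) (auto simp: measurable_cong_sets[OF assms(2) refl])
  ultimately show ?thesis using assms(3) by simp
qed

lemma projected_measure:
  assumes "sets g = sets borel" "sets u = sets borel" "Mv t g = Rd \<theta> u" "B \<in> sets borel"
  shows "measure g {p. fst p + t * snd p \<in> B} = measure u {y. \<theta> \<bullet> y \<in> B}"
proof -
  have 1: "{p. fst p + t * snd p \<in> B} \<in> sets g"
    using measurable_sets_borel[OF measurable_Mv[of t, where 'a = real] assms(4)] assms(1)
    by (simp add: vimage_def split_beta)
  have 2: "{y. \<theta> \<bullet> y \<in> B} \<in> sets u"
    using measurable_sets_borel[OF measurable_Rd[of \<theta>] assms(4)] assms(2) by (simp add: vimage_def)
  have "(\<integral>\<^sup>+p. indicator B (fst p + t * snd p) \<partial>g) = (\<integral>\<^sup>+y. indicator B (\<theta> \<bullet> y) \<partial>u)"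
    using assms by (intro projected_nn_integral) auto
  moreover have "(\<integral>\<^sup>+p. indicator B (fst p + t * snd p) \<partial>g) = emeasure g {p. fst p + t * snd p \<in> B}"
    using nn_integral_indicator[OF 1] by (simp add: indicator_def)
  moreover have "(\<integral>\<^sup>+y. indicator B (\<theta> \<bullet> y) \<partial>u) = emeasure u {y. \<theta> \<bullet> y \<in> B}"
    using nn_integral_indicator[OF 2] by (simp add: indicator_def)
  ultimately show ?thesis by (simp add: measure_def)
qed

lemma capped_min_scale:
  assumes "1 \<le> c" "0 \<le> r" "\<And>i. i \<in> {1..N} \<Longrightarrow> f i \<le> c * g i"
  shows "capped_min r N f \<le> c * capped_min r N g"
proof (rule capped_min_cases[of r N g])
  assume *: "capped_min r N g = r"
  have "capped_min r N f \<le> r" by (rule capped_min_le_cap)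
  also have "\<dots> \<le> c * r" using assms(1,2) by (simp add: mult_le_cancel_right1)
  finally show ?thesis by (simp add: *)
next
  fix i assume "i \<in> {1..N}" "capped_min r N g = g i"
  then show ?thesis using capped_min_le[of i N r f] assms(3)[of i] by simp
qed

lemma abs_moved_diff_le:
  fixes P Q a b t :: real
  shows "\<bar>P + t * Q - (a + t * b)\<bar> \<le> (1 + \<bar>t\<bar>) * dist (P, Q) (a, b)"
proof -
  have "P + t * Q - (a + t * b) = (P - a) + t * (Q - b)" by (simp add: algebra_simps)
  then have "\<bar>P + t * Q - (a + t * b)\<bar> \<le> \<bar>P - a\<bar> + \<bar>t\<bar> * \<bar>Q - b\<bar>"
    by (metis abs_mult abs_triangle_ineq)
  also have "\<dots> \<le> dist (P, Q) (a, b) + \<bar>t\<bar> * dist (P, Q) (a, b)"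
    using dist_fst_le[of "(P, Q)" "(a, b)"] dist_snd_le[of "(P, Q)" "(a, b)"]
    by (intro add_mono mult_left_mono) (auto simp: dist_real_def)
  finally show ?thesis by (simp add: algebra_simps)
qed

subsection \<open>Transfer of the estimates along the projections\<close>

lemma measurable_dist_const: "(\<lambda>y. dist y c) \<in> borel_measurable (borel :: 'a::euclidean_space measure)"
  by (intro borel_measurable_continuous_onI continuous_intros)

lemma measurable_abs_inner: "(\<lambda>y. \<bar>\<theta> \<bullet> y - c\<bar>) \<in> borel_measurable (borel :: 'a::euclidean_space measure)"
  by (intro borel_measurable_continuous_onI continuous_intros)

lemma measurable_abs_moved: "(\<lambda>p. \<bar>fst p + t * snd p - c\<bar>) \<in> borel_measurable (borel :: (real \<times> real) measure)"
  by (intro borel_measurable_continuous_onI continuous_intros)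

lemma nn_integral_capped_min_projected:
  assumes "sets g = sets borel" "sets u = sets borel" "Mv t g = Rd \<theta> u"
  shows "capped_cost g r N (\<lambda>p i. \<bar>fst p + t * snd p - c i\<bar>)
    = capped_cost u r N (\<lambda>y i. \<bar>\<theta> \<bullet> y - c i\<bar>)"
proof (rule projected_nn_integral[OF assms, where F = "\<lambda>s. ennreal ((capped_min r N (\<lambda>i. \<bar>s - c i\<bar>))\<^sup>2)"])
  have "(\<lambda>s. capped_min r N (\<lambda>i. \<bar>s - c i\<bar>)) \<in> borel_measurable (borel :: real measure)"
    by (rule capped_min_measurable) simp
  then show "(\<lambda>s. ennreal ((capped_min r N (\<lambda>i. \<bar>s - c i\<bar>))\<^sup>2)) \<in> borel_measurable (borel :: real measure)"
    by measurable
qed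

text \<open>Projection along a unit vector does not increase the cost, the constraint carries it
  over to \<open>g\<close> at each time of \<open>T\<close>, and \<open>phase_distance_le\<close>
  combines these times. The masses are carried along at the single time \<open>s\<close>.\<close>

lemma slice_bounds:
  fixes x v :: "nat \<Rightarrow> 'a::euclidean_space"
  assumes T: "finite T" "T \<noteq> {}" and \<theta>: "norm \<theta> = 1" and pos: "0 < r" "0 < \<sigma>"
    and two: "1 \<le> N \<Longrightarrow> t1 \<in> T \<and> t2 \<in> T \<and> t1 \<noteq> t2"
    and const: "\<And>p q a. a \<in> T \<rightarrow> {1..N} \<Longrightarrow>
      (\<And>t. t \<in> T \<Longrightarrow> \<bar>p + t * q - \<theta> \<bullet> (x (a t) + t *\<^sub>R v (a t))\<bar> < \<sigma>) \<Longrightarrow> \<exists>i\<in>{1..N}. \<forall>t\<in>T. a t = i"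
    and sep: "\<And>i j. i \<in> {1..N} \<Longrightarrow> j \<in> {1..N} \<Longrightarrow> i \<noteq> j \<Longrightarrow>
      \<sigma> \<le> \<bar>\<theta> \<bullet> (x i + s *\<^sub>R v i) - \<theta> \<bullet> (x j + s *\<^sub>R v j)\<bar>"
    and g: "finite_measure g" "sets g = sets borel"
    and u: "\<And>t. t \<in> T \<Longrightarrow> u t \<in> pos_measures \<Omega>" "\<And>t. t \<in> T \<Longrightarrow> Mv t g = Rd \<theta> (u t)"
    and int: "\<And>t. t \<in> T \<Longrightarrow>
      capped_cost (u t) r N (\<lambda>y i. dist y (x i + t *\<^sub>R v i)) \<le> ennreal A"
    and s: "s \<in> T" "\<bar>s\<bar> \<le> \<tau>" and A: "0 \<le> A"
    and mass: "\<And>i. i \<in> {1..N} \<Longrightarrow> \<bar>measure (u s) (ball (x i + s *\<^sub>R v i) \<rho>) - m i\<bar> \<le> A"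
    and \<rho>: "0 < \<rho>" "\<rho> \<le> r" "2 * \<rho> \<le> \<sigma>"
  defines "C \<equiv> 4 * (1 + (1 + \<bar>t1\<bar>) / \<bar>t2 - t1\<bar>)\<^sup>2 * card T"
  shows "capped_cost g (min r \<sigma>) N (\<lambda>p i. dist p (\<theta> \<bullet> x i, \<theta> \<bullet> v i)) \<le> ennreal (C * A)"
    and "i \<in> {1..N} \<Longrightarrow> \<bar>measure g (ball (\<theta> \<bullet> x i, \<theta> \<bullet> v i) (\<rho> / (1 + \<tau>))) - m i\<bar>
      \<le> (1 + 3 / \<rho>\<^sup>2 + C / (\<rho> / (1 + \<tau>))\<^sup>2) * A"
proof -
  let ?z = "\<lambda>i t. x i + t *\<^sub>R v i" and ?p = "\<lambda>i. (\<theta> \<bullet> x i, \<theta> \<bullet> v i)"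
  let ?e = "\<lambda>i t. \<theta> \<bullet> (x i + t *\<^sub>R v i)"
  have e: "?e i t = \<theta> \<bullet> x i + t * (\<theta> \<bullet> v i)" for i t by (simp add: inner_add_right)
  have spg: "space g = UNIV" using sets_eq_imp_space_eq[OF g(2)] by simp
  note su = pos_measuresD[OF u(1)]
  note mg = measurable_cong_sets[OF g(2) refl] 
  have inner_le: "\<bar>\<theta> \<bullet> y - \<theta> \<bullet> c\<bar> \<le> dist y c" for y c
    using Cauchy_Schwarz_ineq2[of \<theta> "y - c"] \<theta> by (simp add: dist_norm inner_diff_right)
  have proj: "capped_cost (u t) r N (\<lambda>y i. \<bar>\<theta> \<bullet> y - ?e i t\<bar>) \<le> ennreal A"
    if t: "t \<in> T" for t
  proof -
    have "capped_cost (u t) r N (\<lambda>y i. \<bar>\<theta> \<bullet> y - ?e i t\<bar>)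
        \<le> capped_cost (u t) r N (\<lambda>y i. dist y (?z i t))"
      using inner_le pos
      by (intro nn_integral_mono ennreal_leI power_mono capped_min_mono capped_min_nonneg) auto
    with int[OF t] show ?thesis by simp
  qed
  have moved: "capped_cost g r N (\<lambda>p i. \<bar>fst p + t * snd p - ?e i t\<bar>) \<le> ennreal A"
    if t: "t \<in> T" for t
    using nn_integral_capped_min_projected[OF g(2) su(1)[OF t] u(2)[OF t], of r N "\<lambda>i. ?e i t"] proj[OF t] by simp
  have meas: "(\<lambda>p. ennreal ((capped_min r N (\<lambda>i. \<bar>fst p + t * snd p - ?e i t\<bar>))\<^sup>2)) \<in> borel_measurable g" for t
  proof -
    have "(\<lambda>p. capped_min r N (\<lambda>i. \<bar>fst p + t * snd p - ?e i t\<bar>)) \<in> borel_measurable g"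
      unfolding mg by (intro capped_min_measurable measurable_abs_moved)
    then show ?thesis by measurable
  qed
  let ?D = "4 * (1 + (1 + \<bar>t1\<bar>) / \<bar>t2 - t1\<bar>)\<^sup>2"
  have D0: "0 \<le> ?D" by simp
  have "capped_cost g (min r \<sigma>) N (\<lambda>p i. dist p (?p i))
      \<le> (\<integral>\<^sup>+p. ennreal ?D * (\<Sum>t\<in>T. ennreal ((capped_min r N (\<lambda>i. \<bar>fst p + t * snd p - ?e i t\<bar>))\<^sup>2)) \<partial>g)"
  proof (rule nn_integral_mono)
    fix p :: "real \<times> real"
    have "(capped_min (min r \<sigma>) N (\<lambda>i. dist (fst p, snd p) (?p i)))\<^sup>2
      \<le> ?D * (\<Sum>t\<in>T. (capped_min r N (\<lambda>i. \<bar>fst p + t * snd p - (\<theta> \<bullet> x i + t * (\<theta> \<bullet> v i))\<bar>))\<^sup>2)"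
      by (rule phase_distance_le[OF T pos(2,1) two const]) (auto simp: e)
    then have "(capped_min (min r \<sigma>) N (\<lambda>i. dist p (?p i)))\<^sup>2
      \<le> ?D * (\<Sum>t\<in>T. (capped_min r N (\<lambda>i. \<bar>fst p + t * snd p - ?e i t\<bar>))\<^sup>2)"
      by (simp add: e)
    then have "ennreal ((capped_min (min r \<sigma>) N (\<lambda>i. dist p (?p i)))\<^sup>2)
      \<le> ennreal (?D * (\<Sum>t\<in>T. (capped_min r N (\<lambda>i. \<bar>fst p + t * snd p - ?e i t\<bar>))\<^sup>2))"
      by (rule ennreal_leI)
    also have "\<dots> = ennreal ?D * (\<Sum>t\<in>T. ennreal ((capped_min r N (\<lambda>i. \<bar>fst p + t * snd p - ?e i t\<bar>))\<^sup>2))"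
      by (subst ennreal_mult[OF D0]) (simp_all add: sum_nonneg)
    finally show "ennreal ((capped_min (min r \<sigma>) N (\<lambda>i. dist p (?p i)))\<^sup>2)
      \<le> ennreal ?D * (\<Sum>t\<in>T. ennreal ((capped_min r N (\<lambda>i. \<bar>fst p + t * snd p - ?e i t\<bar>))\<^sup>2))" .
  qed
  also have "\<dots> = ennreal ?D * (\<Sum>t\<in>T. capped_cost g r N (\<lambda>p i. \<bar>fst p + t * snd p - ?e i t\<bar>))"
    by (subst nn_integral_cmult[OF borel_measurable_sum[OF meas]], subst nn_integral_sum[OF meas]) (rule refl)
  also have "\<dots> \<le> ennreal ?D * (\<Sum>t\<in>T. ennreal A)"
    using moved by (intro mult_left_mono sum_mono) auto
  also have "\<dots> = ennreal (C * A)"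
    using A by (simp only: sum_constant C_def) (simp add: ennreal_mult ennreal_of_nat_eq_real_of_nat mult.assoc)
  finally show 1: "capped_cost g (min r \<sigma>) N (\<lambda>p i. dist p (?p i)) \<le> ennreal (C * A)" .
  assume i: "i \<in> {1..N}"
  have C0: "0 \<le> C" by (simp add: C_def)
  have \<tau>: "0 \<le> \<tau>" using s(2) by linarith
  \<comment> \<open>Moving a phase-space point for a time of modulus at most \<tau> enlarges
    distances by a factor of at most \<open>1 + \<tau>\<close>, so balls of this radius are moved
    into intervals of radius \<rho>.\<close>
  define \<rho>2 where "\<rho>2 = \<rho> / (1 + \<tau>)"
  have \<rho>2: "0 < \<rho>2" "\<rho>2 \<le> \<rho>" "(1 + \<tau>) * \<rho>2 = \<rho>" using \<rho>(1) \<tau> by (auto simp: \<rho>2_def field_simps)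
  \<comment> \<open>The mass passes from a ball to a slab in space (\<open>a\<close>), to a strip in
    phase space by the constraint (\<open>b\<close>, an identity), and to a ball in phase space
    (\<open>c\<close>). Three Chebyshev terms have radius \<rho>, two in \<open>a\<close> and one in
    \<open>c\<close>; the remaining one has radius \<open>\<rho>2\<close>.\<close>
  have a: "\<bar>measure (u s) {y \<in> space (u s). dist y (?z i s) < \<rho>} - measure (u s) {y \<in> space (u s). \<bar>\<theta> \<bullet> y - ?e i s\<bar> < \<rho>}\<bar>
    \<le> A / \<rho>\<^sup>2 + A / \<rho>\<^sup>2"
  proof (rule measure_capped_min_transfer[OF su(2)[OF s(1)] _ _ int[OF s(1)] \<rho>(1,2) A proj[OF s(1)] \<rho>(1,2) A _ i])
    fix y k j assume "k \<in> {1..N}" "j \<in> {1..N}" "k \<noteq> j" "dist y (?z k s) < \<rho>" "\<bar>\<theta> \<bullet> y - ?e j s\<bar> < \<rho>"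
    then show False using sep[of k j] inner_le[of y "?z k s"] \<rho>(3) by linarith
  qed (simp_all only: measurable_cong_sets[OF su(1)[OF s(1)] refl] measurable_dist_const measurable_abs_inner)
  have b: "measure (u s) {y. \<bar>\<theta> \<bullet> y - ?e i s\<bar> < \<rho>} = measure g {p. \<bar>fst p + s * snd p - ?e i s\<bar> < \<rho>}"
  proof -
    have "ball (?e i s) \<rho> \<in> sets borel" by simp
    from projected_measure[OF g(2) su(1)[OF s(1)] u(2)[OF s(1)] this]
    show ?thesis by (simp add: dist_real_def abs_minus_commute)
  qed
  have c: "\<bar>measure g {p \<in> space g. \<bar>fst p + s * snd p - ?e i s\<bar> < \<rho>} - measure g {p \<in> space g. dist p (?p i) < \<rho>2}\<bar>
    \<le> A / \<rho>\<^sup>2 + C * A / \<rho>2\<^sup>2"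
  proof (rule measure_capped_min_transfer[OF g(1) _ _ moved[OF s(1)] \<rho>(1,2) A 1 \<rho>2(1) _ _ _ i])
    show "\<rho>2 \<le> min r \<sigma>" using \<rho> \<rho>2(2) by auto
    show "0 \<le> C * A" using C0 A by simp
    fix p k j assume kj: "k \<in> {1..N}" "j \<in> {1..N}" "k \<noteq> j" "\<bar>fst p + s * snd p - ?e k s\<bar> < \<rho>" "dist p (?p j) < \<rho>2"
    have "\<bar>fst p + s * snd p - ?e j s\<bar> \<le> (1 + \<bar>s\<bar>) * dist p (?p j)"
      using abs_moved_diff_le[of "fst p" s "snd p" "\<theta> \<bullet> x j" "\<theta> \<bullet> v j"] by (simp add: e)
    also have "\<dots> \<le> (1 + \<tau>) * \<rho>2" using kj(5) s(2) \<tau> by (intro mult_mono) auto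
    finally show False using sep[OF kj(1-3)] kj(4) \<rho>(3) \<rho>2(3) by linarith
  qed (simp_all only: mg measurable_dist_const measurable_abs_moved)
  have "{p \<in> space g. dist p (?p i) < \<rho>2} = ball (?p i) \<rho>2" by (auto simp: spg dist_commute)
  moreover have "{y \<in> space (u s). dist y (?z i s) < \<rho>} = ball (?z i s) \<rho>" by (auto simp: su(3)[OF s(1)] dist_commute)
  ultimately have "\<bar>measure g (ball (?p i) \<rho>2) - m i\<bar> \<le> A + (A / \<rho>\<^sup>2 + A / \<rho>\<^sup>2) + (A / \<rho>\<^sup>2 + C * A / \<rho>2\<^sup>2)"
    using a b c mass[OF i] by (simp add: spg su(3)[OF s(1)])
  then show "\<bar>measure g (ball (?p i) (\<rho> / (1 + \<tau>))) - m i\<bar> \<le> (1 + 3 / \<rho>\<^sup>2 + C / (\<rho> / (1 + \<tau>))\<^sup>2) * A"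
    unfolding \<rho>2_def[symmetric] by (simp add: algebra_simps)
qed

text \<open>The way back from phase space to a projection of \<open>u\<close>. Moving is Lipschitz
  with constant \<open>1 + \<tau>\<close>, hence the squared factor. A single direction sees slabs
  only; balls need several directions.\<close>

lemma moved_slice_bounds:
  fixes x v :: "nat \<Rightarrow> 'a::euclidean_space"
  assumes pos: "0 < r"
    and sep: "\<And>i j. i \<in> {1..N} \<Longrightarrow> j \<in> {1..N} \<Longrightarrow> i \<noteq> j \<Longrightarrow>
      \<sigma> \<le> \<bar>\<theta> \<bullet> (x i + t *\<^sub>R v i) - \<theta> \<bullet> (x j + t *\<^sub>R v j)\<bar>"
    and g: "finite_measure g" "sets g = sets borel"
    and u: "u \<in> pos_measures \<Omega>" "Mv t g = Rd \<theta> u"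
    and int: "capped_cost g r N (\<lambda>p i. dist p (\<theta> \<bullet> x i, \<theta> \<bullet> v i)) \<le> ennreal A"
    and t: "\<bar>t\<bar> \<le> \<tau>" and A: "0 \<le> A"
    and mass: "\<And>i. i \<in> {1..N} \<Longrightarrow> \<bar>measure g (ball (\<theta> \<bullet> x i, \<theta> \<bullet> v i) (\<rho> / (1 + \<tau>))) - m i\<bar> \<le> A'"
    and \<rho>: "0 < \<rho>" "\<rho> \<le> r" "2 * \<rho> \<le> \<sigma>"
  shows "capped_cost u r N (\<lambda>y i. \<bar>\<theta> \<bullet> y - \<theta> \<bullet> (x i + t *\<^sub>R v i)\<bar>) \<le> ennreal ((1 + \<tau>)\<^sup>2 * A)"
    and "i \<in> {1..N} \<Longrightarrow> \<bar>measure u {y. \<bar>\<theta> \<bullet> y - \<theta> \<bullet> (x i + t *\<^sub>R v i)\<bar> < \<rho>} - m i\<bar>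
      \<le> A' + (A / (\<rho> / (1 + \<tau>))\<^sup>2 + (1 + \<tau>)\<^sup>2 * A / \<rho>\<^sup>2)"
proof -
  let ?p = "\<lambda>i. (\<theta> \<bullet> x i, \<theta> \<bullet> v i)"
  let ?e = "\<lambda>i. \<theta> \<bullet> (x i + t *\<^sub>R v i)"
  have e: "?e i = \<theta> \<bullet> x i + t * (\<theta> \<bullet> v i)" for i by (simp add: inner_add_right)
  have spg: "space g = UNIV" using sets_eq_imp_space_eq[OF g(2)] by simp
  note su = pos_measuresD[OF u(1)]
  note mg = measurable_cong_sets[OF g(2) refl]
  have \<tau>: "0 \<le> \<tau>" using t by linarith
  have dist_le: "\<bar>fst p + t * snd p - ?e i\<bar> \<le> (1 + \<tau>) * dist p (?p i)" for p i
  proof -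
    have "\<bar>fst p + t * snd p - ?e i\<bar> \<le> (1 + \<bar>t\<bar>) * dist p (?p i)"
      using abs_moved_diff_le[of "fst p" t "snd p" "\<theta> \<bullet> x i" "\<theta> \<bullet> v i"] by (simp add: e)
    also have "\<dots> \<le> (1 + \<tau>) * dist p (?p i)" using t by (intro mult_right_mono) auto
    finally show ?thesis .
  qed
  have meas: "(\<lambda>p. ennreal ((capped_min r N (\<lambda>i. dist p (?p i)))\<^sup>2)) \<in> borel_measurable g"
  proof -
    have "(\<lambda>p. capped_min r N (\<lambda>i. dist p (?p i))) \<in> borel_measurable g"
      unfolding mg by (intro capped_min_measurable measurable_dist_const)
    then show ?thesis by measurable
  qed
  have "capped_cost g r N (\<lambda>p i. \<bar>fst p + t * snd p - ?e i\<bar>)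
      \<le> (\<integral>\<^sup>+p. ennreal ((1 + \<tau>)\<^sup>2) * ennreal ((capped_min r N (\<lambda>i. dist p (?p i)))\<^sup>2) \<partial>g)"
  proof (rule nn_integral_mono)
    fix p
    have "capped_min r N (\<lambda>i. \<bar>fst p + t * snd p - ?e i\<bar>) \<le> (1 + \<tau>) * capped_min r N (\<lambda>i. dist p (?p i))"
      using dist_le \<tau> pos by (intro capped_min_scale) auto
    then have "(capped_min r N (\<lambda>i. \<bar>fst p + t * snd p - ?e i\<bar>))\<^sup>2 \<le> (1 + \<tau>)\<^sup>2 * (capped_min r N (\<lambda>i. dist p (?p i)))\<^sup>2"
      unfolding power_mult_distrib[symmetric] using pos by (intro power_mono capped_min_nonneg) auto
    then show "ennreal ((capped_min r N (\<lambda>i. \<bar>fst p + t * snd p - ?e i\<bar>))\<^sup>2)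
      \<le> ennreal ((1 + \<tau>)\<^sup>2) * ennreal ((capped_min r N (\<lambda>i. dist p (?p i)))\<^sup>2)"
      by (simp add: ennreal_leI flip: ennreal_mult)
  qed
  also have "\<dots> \<le> ennreal ((1 + \<tau>)\<^sup>2) * ennreal A"
    using int by (subst nn_integral_cmult[OF meas]) (auto intro: mult_left_mono)
  also have "\<dots> = ennreal ((1 + \<tau>)\<^sup>2 * A)" using A by (simp add: ennreal_mult)
  finally have moved: "capped_cost g r N (\<lambda>p i. \<bar>fst p + t * snd p - ?e i\<bar>) \<le> ennreal ((1 + \<tau>)\<^sup>2 * A)" .
  then show "capped_cost u r N (\<lambda>y i. \<bar>\<theta> \<bullet> y - ?e i\<bar>) \<le> ennreal ((1 + \<tau>)\<^sup>2 * A)"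
    using nn_integral_capped_min_projected[OF g(2) su(1) u(2), of r N ?e] by simp
  assume i: "i \<in> {1..N}"
  define \<rho>2 where "\<rho>2 = \<rho> / (1 + \<tau>)"
  have \<rho>2: "0 < \<rho>2" "\<rho>2 \<le> \<rho>" "(1 + \<tau>) * \<rho>2 = \<rho>" using \<rho>(1) \<tau> by (auto simp: \<rho>2_def field_simps)
  have c: "\<bar>measure g {p \<in> space g. dist p (?p i) < \<rho>2} - measure g {p \<in> space g. \<bar>fst p + t * snd p - ?e i\<bar> < \<rho>}\<bar>
    \<le> A / \<rho>2\<^sup>2 + (1 + \<tau>)\<^sup>2 * A / \<rho>\<^sup>2"
  proof (rule measure_capped_min_transfer[OF g(1) _ _ int \<rho>2(1) _ A moved \<rho>(1,2) _ _ i])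
    show "\<rho>2 \<le> r" using \<rho> \<rho>2(2) by auto
    show "0 \<le> (1 + \<tau>)\<^sup>2 * A" using A by simp
    fix p k j assume kj: "k \<in> {1..N}" "j \<in> {1..N}" "k \<noteq> j" "dist p (?p k) < \<rho>2" "\<bar>fst p + t * snd p - ?e j\<bar> < \<rho>"
    have "\<bar>fst p + t * snd p - ?e k\<bar> \<le> (1 + \<tau>) * dist p (?p k)" by (rule dist_le)
    also have "\<dots> \<le> (1 + \<tau>) * \<rho>2" using kj(4) \<tau> by (intro mult_left_mono) auto
    finally show False using sep[OF kj(1-3)] kj(5) \<rho>(3) \<rho>2(3) by linarith
  qed (simp_all only: mg measurable_dist_const measurable_abs_moved)
  have b: "measure u {y. \<bar>\<theta> \<bullet> y - ?e i\<bar> < \<rho>} = measure g {p. \<bar>fst p + t * snd p - ?e i\<bar> < \<rho>}"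
  proof -
    have "ball (?e i) \<rho> \<in> sets borel" by simp
    from projected_measure[OF g(2) su(1) u(2) this]
    show ?thesis by (simp add: dist_real_def abs_minus_commute)
  qed
  have "{p \<in> space g. dist p (?p i) < \<rho>2} = ball (?p i) \<rho>2" by (auto simp: spg dist_commute)
  then show "\<bar>measure u {y. \<bar>\<theta> \<bullet> y - ?e i\<bar> < \<rho>} - m i\<bar>
      \<le> A' + (A / (\<rho> / (1 + \<tau>))\<^sup>2 + (1 + \<tau>)\<^sup>2 * A / \<rho>\<^sup>2)"
    using b c mass[OF i] by (simp add: spg flip: \<rho>2_def)
qed

lemma power2_le_add:
  fixes a b d r :: real
  assumes "0 \<le> a" "a \<le> r" "0 \<le> b" "b \<le> r" "a \<le> b + d" "0 \<le> d"
  shows "a\<^sup>2 \<le> b\<^sup>2 + 2 * r * d"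
proof (cases "a \<le> b")
  case True
  then have "a\<^sup>2 \<le> b\<^sup>2" using assms(1) by (intro power_mono)
  moreover have "0 \<le> 2 * r * d" using assms by simp
  ultimately show ?thesis by linarith
next
  case False
  then have "(a - b) * (a + b) \<le> d * (2 * r)" using assms by (intro mult_mono) auto
  then show ?thesis by (simp add: power2_eq_square algebra_simps)
qed

text \<open>On the compact set \<Omega> the squared capped distance is Lipschitz in the direction
  with constant \<open>2 * r * L\<close>, and \<open>u\<close> is finite, so the costs
  converge.\<close>

lemma projected_bound_limit:
  fixes \<theta> :: "'a::euclidean_space"
  assumes "compact \<Omega>" "u \<in> pos_measures \<Omega>" "0 < r"
    and near: "\<And>\<epsilon>. 0 < \<epsilon> \<Longrightarrow> \<exists>\<theta>'. dist \<theta> \<theta>' < \<epsilon> \<and>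
      capped_cost u r N (\<lambda>y i. \<bar>\<theta>' \<bullet> y - \<theta>' \<bullet> z i\<bar>) \<le> ennreal A"
  shows "capped_cost u r N (\<lambda>y i. \<bar>\<theta> \<bullet> y - \<theta> \<bullet> z i\<bar>) \<le> ennreal A"
proof (rule ennreal_le_epsilon)
  fix e :: real assume e: "0 < e"
  interpret u: finite_measure u using assms(2) by (rule pos_measuresD)
  let ?c = "\<lambda>\<theta> y. capped_min r N (\<lambda>i. \<bar>\<theta> \<bullet> y - \<theta> \<bullet> z i\<bar>)"
  obtain b where b: "\<And>y. y \<in> \<Omega> \<Longrightarrow> norm y \<le> b"
    using compact_imp_bounded[OF assms(1)] by (auto simp: bounded_iff)
  define L where "L = \<bar>b\<bar> + (\<Sum>i\<in>{1..N}. norm (z i))"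
  have L0: "0 \<le> L" by (simp add: L_def sum_nonneg)
  have L: "norm (y - z i) \<le> L" if "y \<in> \<Omega>" "i \<in> {1..N}" for y i
  proof -
    have "norm (z i) \<le> (\<Sum>i\<in>{1..N}. norm (z i))" using that(2) by (intro member_le_sum) auto
    then show ?thesis using norm_triangle_ineq4[of y "z i"] b[OF that(1)] by (simp add: L_def)
  qed
  define U where "U = measure u UNIV"
  have U0: "0 \<le> U" by (simp add: U_def)
  \<comment> \<open>Makes the integrated error at most \<open>e\<close>; the summand 1 keeps the
    denominator positive even for the zero measure.\<close>
  define \<epsilon> where "\<epsilon> = e / (2 * r * L * U + 1)"
  have d: "0 < 2 * r * L * U + 1" using assms(3) L0 U0 by (intro add_nonneg_pos) auto
  have \<epsilon>: "0 < \<epsilon>" "2 * r * L * U * \<epsilon> \<le> e"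
    using e d by (auto simp: \<epsilon>_def field_simps)
  obtain \<theta>' where \<theta>': "dist \<theta> \<theta>' < \<epsilon>" "(\<integral>\<^sup>+y. ennreal ((?c \<theta>' y)\<^sup>2) \<partial>u) \<le> ennreal A"
    using near[OF \<epsilon>(1)] by blast
  have pt: "(?c \<theta> y)\<^sup>2 \<le> (?c \<theta>' y)\<^sup>2 + 2 * r * L * \<epsilon>" if y: "y \<in> \<Omega>" for y
  proof -
    have "?c \<theta> y \<le> ?c \<theta>' y + \<epsilon> * L"
    proof (rule capped_min_add)
      fix i assume i: "i \<in> {1..N}"
      have "\<bar>(\<theta> - \<theta>') \<bullet> (y - z i)\<bar> \<le> norm (\<theta> - \<theta>') * norm (y - z i)" by (rule Cauchy_Schwarz_ineq2)
      also have "\<dots> \<le> \<epsilon> * L" using \<theta>'(1) L[OF y i] \<epsilon>(1) by (intro mult_mono) (auto simp: dist_norm)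
      finally show "\<bar>\<theta> \<bullet> y - \<theta> \<bullet> z i\<bar> \<le> \<bar>\<theta>' \<bullet> y - \<theta>' \<bullet> z i\<bar> + \<epsilon> * L"
        by (simp add: inner_diff_left inner_diff_right)
    qed (use \<epsilon> L0 in auto)
    moreover have "0 \<le> ?c \<theta> y" "0 \<le> ?c \<theta>' y" "?c \<theta> y \<le> r" "?c \<theta>' y \<le> r"
      using assms(3) by (auto intro: capped_min_le_cap capped_min_nonneg)
    ultimately have "(?c \<theta> y)\<^sup>2 \<le> (?c \<theta>' y)\<^sup>2 + 2 * r * (\<epsilon> * L)"
      using \<epsilon>(1) L0 by (intro power2_le_add) auto
    then show ?thesis by (simp add: mult_ac)
  qed
  have meas: "(\<lambda>y. ennreal ((?c \<theta>' y)\<^sup>2)) \<in> borel_measurable u"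
  proof -
    have "?c \<theta>' \<in> borel_measurable u"
      unfolding measurable_cong_sets[OF pos_measuresD(1)[OF assms(2)] refl]
      by (intro capped_min_measurable measurable_abs_inner)
    then show ?thesis by measurable
  qed
  have "(\<integral>\<^sup>+y. ennreal ((?c \<theta> y)\<^sup>2) \<partial>u) \<le> (\<integral>\<^sup>+y. ennreal ((?c \<theta>' y)\<^sup>2) + ennreal (2 * r * L * \<epsilon>) \<partial>u)"
  proof (rule nn_integral_mono_AE)
    show "AE y in u. ennreal ((?c \<theta> y)\<^sup>2) \<le> ennreal ((?c \<theta>' y)\<^sup>2) + ennreal (2 * r * L * \<epsilon>)"
      using AE_pos_measures[OF assms(2) subset_refl compact_imp_closed[OF assms(1)]]
    proof eventually_elim
      case (elim y)
      then show ?case using pt[OF elim] assms(3) L0 \<epsilon>(1) by (simp flip: ennreal_plus add: ennreal_leI)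
    qed
  qed
  also have "\<dots> = (\<integral>\<^sup>+y. ennreal ((?c \<theta>' y)\<^sup>2) \<partial>u) + ennreal (2 * r * L * \<epsilon>) * ennreal U"
    using meas by (simp add: nn_integral_add U_def u.emeasure_eq_measure pos_measuresD[OF assms(2)])
  also have "\<dots> \<le> ennreal A + ennreal e"
  proof (rule add_mono[OF \<theta>'(2)])
    have "ennreal (2 * r * L * \<epsilon>) * ennreal U = ennreal (2 * r * L * \<epsilon> * U)"
      using assms(3) L0 \<epsilon>(1) U0 by (subst ennreal_mult) auto
    also have "\<dots> \<le> ennreal e" using \<epsilon>(2) by (intro ennreal_leI) (simp add: mult_ac)
    finally show "ennreal (2 * r * L * \<epsilon>) * ennreal U \<le> ennreal e" .
  qed
  finally show "(\<integral>\<^sup>+y. ennreal ((?c \<theta> y)\<^sup>2) \<partial>u) \<le> ennreal A + ennreal e" .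
qed

text \<open>A ball about a point of the support has positive measure, so it cannot avoid a set of
  full measure.\<close>

lemma AE_dense_in_supp:
  fixes \<theta> :: "'a::euclidean_space"
  assumes "sets H = sets borel" "\<theta> \<in> supp H" "AE \<theta>' in H. P \<theta>'" "0 < \<epsilon>"
  obtains \<theta>' where "dist \<theta> \<theta>' < \<epsilon>" "P \<theta>'"
proof (rule ccontr)
  assume no: "\<not> thesis"
  have "AE \<theta>' in H. \<theta>' \<notin> ball \<theta> \<epsilon>"
    using assms(3) by eventually_elim (use no that in auto)
  then have "emeasure H (ball \<theta> \<epsilon>) = 0"
    using emeasure_eq_0_AE[of "\<lambda>x. x \<in> ball \<theta> \<epsilon>" H] sets_eq_imp_space_eq[OF assms(1)] by (simp add: ball_def)
  moreover have "0 < emeasure H (ball \<theta> \<epsilon>)" using assms(2,4) by (auto simp: supp_def)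
  ultimately show False by simp
qed

text \<open>Comparison with the exact configuration would not bound the residual if the mass of
  \<gamma> could drop well below that of \<open>lam\<close>. The certificate at one time
  \<open>s\<close> prevents this: its modulus is at most 1, so its integral is a lower bound for the
  mass of \<open>u s\<close>, and by duality this integral is close to the exact mass. The resulting
  bound covers all times of \<open>T\<close>.\<close>

lemma minimizer_discrepancy:
  fixes x v :: "nat \<Rightarrow> 'a::euclidean_space"
    and Ob :: "real \<Rightarrow> ('a set \<Rightarrow> real) \<Rightarrow> 'h::real_inner" and m :: "nat \<Rightarrow> real" and N :: nat
  defines "lam \<equiv> atomic_measure N m (\<lambda>i. (x i, v i))"
  assumes "compact \<Omega>" "compact \<Theta>" and H: "H \<in> pos_measures \<Theta>" "prob_space H"
    and T: "finite T" "T \<subseteq> \<Sigma>"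
    and B: "bounded_linear_to_C \<Omega> (ObS s)" "is_dual_of \<Omega> (Ob s) (ObS s)"
    and m: "\<And>i. i \<in> {1..N} \<Longrightarrow> 0 < m i"
    and xv: "\<And>i. i \<in> {1..N} \<Longrightarrow> (x i, v i) \<in> phase_domain \<Omega> \<Sigma>"
    and s: "s \<in> T" and h: "(\<lambda>x. - ObS s h x) \<in> tv_subdifferential \<Omega> (measure (Mv s lam))"
    and \<delta>: "\<delta> = 1/2 * (\<Sum>t\<in>T. (norm (f t - Ob t (measure (Mv t lam))))\<^sup>2)" "0 < \<delta>"
    and min: "is_arg_min (objective T Ob (sqrt \<delta>) f) (feasible \<Omega> \<Sigma> \<Theta> H) (u, \<gamma>)"
    and t: "t \<in> T"
  shows "norm (Ob t (measure (u t)) - Ob t (measure (Mv t lam))) \<le> (6 * norm h + 4) * sqrt \<delta>"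
    and "measure (u t) UNIV \<le> measure (Mv t lam) UNIV + (6 * norm h + 4) * sqrt \<delta>"
proof -
  define M where "M = (\<Sum>i\<in>{1..N}. m i)"
  have mass_dag: "measure (Mv t lam) UNIV = M" for t
    unfolding lam_def Mv_atomic_measure M_def using m by (subst measure_atomic_measure) (auto simp: less_imp_le)
  have tv: "tv_norm (measure \<nu>) = measure \<nu> UNIV" if "\<nu> \<in> pos_measures X" for \<nu> :: "'b::topological_space measure" and X
    by (rule tv_norm_measure) (rule pos_measuresD[OF that])+
  obtain \<gamma>d where \<gamma>d: "feasible \<Omega> \<Sigma> \<Theta> H (\<lambda>t. Mv t lam, \<gamma>d)"
  proof (rule feasible_atomic_measure[OF assms(3) H])
    show "(x i, v i) \<in> phase_domain \<Omega> \<Sigma>" if "i \<in> {1..N}" for i using that by (rule xv)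
  qed (auto simp: lam_def intro: that)
  have feas: "feasible \<Omega> \<Sigma> \<Theta> H (u, \<gamma>)" using min by (simp add: is_arg_min_def)
  have le: "objective T Ob (sqrt \<delta>) f (u, \<gamma>) \<le> objective T Ob (sqrt \<delta>) f (\<lambda>t. Mv t lam, \<gamma>d)"
    using min \<gamma>d by (auto simp: is_arg_min_def not_less)
  have t\<Sigma>: "t \<in> \<Sigma>" if "t \<in> T" for t using that T by blast
  have mass: "measure (u t) UNIV = measure \<gamma> UNIV" if "t \<in> T" for t
    by (rule feasible_mass[OF feas H t\<Sigma>[OF that]])
  have mass\<gamma>d: "measure \<gamma>d UNIV = M"
    using feasible_mass[OF \<gamma>d H t\<Sigma>[OF s]] mass_dag by simp
  have \<gamma>p: "\<gamma> \<in> pos_measures (\<Theta> \<times> proj_domain \<Theta> \<Omega> \<Sigma>)" "\<gamma>d \<in> pos_measures (\<Theta> \<times> proj_domain \<Theta> \<Omega> \<Sigma>)"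
    and up: "u s \<in> pos_measures \<Omega>" "Mv s lam \<in> pos_measures \<Omega>"
    using feas \<gamma>d t\<Sigma>[OF s] by (auto simp: feasible_def)
  define r where "r t = norm (Ob t (measure (u t)) - f t)" for t
  define n where "n t = norm (f t - Ob t (measure (Mv t lam)))" for t
  have sq: "sqrt \<delta> * sqrt \<delta> = \<delta>" "0 < sqrt \<delta>" using \<delta>(2) by auto
  \<comment> \<open>The exact configuration pays for the noise only, namely
    \<open>2 * \<delta> / (2 * sqrt \<delta>) = sqrt \<delta>\<close>.\<close>
  have cancel: "1 / (2 * c) * (2 * (c * c)) = c" if "0 < c" for c :: real using that by simp
  have "(\<Sum>t\<in>T. (n t)\<^sup>2) = 2 * (sqrt \<delta> * sqrt \<delta>)" unfolding sq using \<delta>(1) by (simp add: n_def)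
  then have "1 / (2 * sqrt \<delta>) * (\<Sum>t\<in>T. (n t)\<^sup>2) = sqrt \<delta>" by (simp only: cancel[OF sq(2)])
  then have opt: "measure \<gamma> UNIV + 1 / (2 * sqrt \<delta>) * (\<Sum>t\<in>T. (r t)\<^sup>2) \<le> M + sqrt \<delta>"
    using le tv[OF \<gamma>p(1)] tv[OF \<gamma>p(2)] mass\<gamma>d by (simp add: objective_def r_def n_def norm_minus_commute)
  have tri: "norm (Ob t (measure (u t)) - Ob t (measure (Mv t lam))) \<le> r t + n t" for t
    using norm_triangle_ineq[of "Ob t (measure (u t)) - f t" "f t - Ob t (measure (Mv t lam))"]
    by (simp add: r_def n_def)
  have low: "M - measure \<gamma> UNIV \<le> norm h * (r s + n s)"
  proof -
    have "(LINT x:\<Omega>|Mv s lam. - ObS s h x) = M"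
      using h signed_integral_measure[of "Mv s lam" \<Omega>] tv[OF up(2)] pos_measuresD[OF up(2)] mass_dag
      by (simp add: tv_subdifferential_def)
    then have 1: "(LINT x:\<Omega>|Mv s lam. ObS s h x) = - M" by (simp add: set_lebesgue_integral_def)
    have cont: "continuous_on \<Omega> (ObS s h)" using B(1) by (simp add: bounded_linear_to_C_def)
    have "(LINT x:\<Omega>|u s. -1) \<le> (LINT x:\<Omega>|u s. ObS s h x)"
    proof (rule set_integral_mono)
      show "set_integrable (u s) \<Omega> (\<lambda>x. -1::real)" "set_integrable (u s) \<Omega> (ObS s h)"
        using cont by (intro set_integrable_continuous_on_compact[OF up(1) assms(2)] continuous_intros; simp)+
      fix y assume "y \<in> \<Omega>"
      then have "\<bar>- ObS s h y\<bar> \<le> 1" using h by (auto simp: tv_subdifferential_def)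
      then show "-1 \<le> ObS s h y" by linarith
    qed
    then have "- measure \<gamma> UNIV \<le> (LINT x:\<Omega>|u s. ObS s h x)"
      using set_integral_const_pos_measures[OF up(1) compact_imp_closed[OF assms(2)], of "-1"] mass[OF s] by simp
    with dual_integral_diff[OF B(2) up tri, of h] 1 show ?thesis by linarith
  qed
  have nn: "0 \<le> r t" "0 \<le> n t" for t by (auto simp: r_def n_def)
  have \<delta>n: "\<delta> = 1/2 * (\<Sum>t\<in>T. (n t)\<^sup>2)" using \<delta>(1) by (simp add: n_def)
  note db = discrepancy_bound[OF T(1) s nn(1) nn(2) \<delta>n \<delta>(2) opt low norm_ge_zero]
  show "norm (Ob t (measure (u t)) - Ob t (measure (Mv t lam))) \<le> (6 * norm h + 4) * sqrt \<delta>"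
    using tri[of t] db(2)[OF t] by linarith
  have "1 * sqrt \<delta> \<le> (6 * norm h + 4) * sqrt \<delta>" using sq(2) by (intro mult_right_mono) auto
  then show "measure (u t) UNIV \<le> measure (Mv t lam) UNIV + (6 * norm h + 4) * sqrt \<delta>"
    using db(1) mass[OF t] mass_dag[of t] by linarith
qed

text \<open>The part of the argument that is free of observations: it starts from the cost at the
  times of \<open>T\<close> and the ball masses at \<open>s\<close>, both bounded by A. Since C is
  obtained before \<open>u\<close>, \<open>\<gamma>s\<close> and A, it cannot depend on the noise.
  \<open>sep\<close> and \<open>const\<close> hold for all directions within \<eta> of
  \<open>\<Theta>b\<close>.\<close>

proposition reconstruction_bounds:
  fixes x v :: "nat \<Rightarrow> 'a::euclidean_space" and m :: "nat \<Rightarrow> real"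
  assumes "compact \<Omega>" "compact \<Theta>" "\<Theta> \<subseteq> sphere 0 1" and H: "H \<in> pos_measures \<Theta>" "supp H = \<Theta>"
    and T: "finite T" "T \<subseteq> \<Sigma>" and \<Theta>b: "\<Theta>b \<subseteq> \<Theta>" "\<Theta>b \<noteq> {}" and \<Sigma>b: "compact \<Sigma>b" "\<Sigma>b \<subseteq> \<Sigma>"
    and \<sigma>: "0 < \<sigma>" "0 < \<eta>"
    and sep: "\<And>\<theta> \<theta>' t i j. \<theta>' \<in> \<Theta>b \<Longrightarrow> dist \<theta> \<theta>' < \<eta> \<Longrightarrow> t \<in> T \<union> \<Sigma>b \<Longrightarrow> i \<in> {1..N} \<Longrightarrow> j \<in> {1..N} \<Longrightarrow> i \<noteq> j \<Longrightarrow>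
       \<sigma> \<le> \<bar>\<theta> \<bullet> (x i + t *\<^sub>R v i) - \<theta> \<bullet> (x j + t *\<^sub>R v j)\<bar>"
    and const: "\<And>\<theta> \<theta>' p q a. \<theta>' \<in> \<Theta>b \<Longrightarrow> dist \<theta> \<theta>' < \<eta> \<Longrightarrow> a \<in> T \<rightarrow> {1..N} \<Longrightarrow>
      (\<And>t. t \<in> T \<Longrightarrow> \<bar>p + t * q - \<theta> \<bullet> (x (a t) + t *\<^sub>R v (a t))\<bar> < \<sigma>) \<Longrightarrow> \<exists>i\<in>{1..N}. \<forall>t\<in>T. a t = i"
    and two: "1 \<le> N \<Longrightarrow> t1 \<in> T \<and> t2 \<in> T \<and> t1 \<noteq> t2"
    and \<tau>: "\<And>t. t \<in> T \<union> \<Sigma>b \<Longrightarrow> \<bar>t\<bar> \<le> \<tau>"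
    and det: "\<And>t y. t \<in> \<Sigma>b \<Longrightarrow> y \<notin> (\<lambda>i. x i + t *\<^sub>R v i) ` {1..N} \<Longrightarrow>
       \<exists>\<theta>\<in>\<Theta>b. \<forall>i\<in>{1..N}. \<theta> \<bullet> y \<noteq> \<theta> \<bullet> (x i + t *\<^sub>R v i)"
    and m: "\<And>i. i \<in> {1..N} \<Longrightarrow> 0 < m i" and s: "s \<in> T" and \<rho>: "0 < \<rho>" "2 * \<rho> \<le> \<sigma>"
  obtains C where "0 < C"
    "\<And>u \<gamma>s A. 0 \<le> A \<Longrightarrow> (\<And>t. t \<in> \<Sigma> \<Longrightarrow> u t \<in> pos_measures \<Omega>) \<Longrightarrow> (\<And>\<theta>. \<gamma>s \<theta> \<in> pos_measures \<Gamma>) \<Longrightarrow>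
      (\<And>t. t \<in> \<Sigma> \<Longrightarrow> AE \<theta> in H. Mv t (\<gamma>s \<theta>) = Rd \<theta> (u t)) \<Longrightarrow>
      (\<And>t. t \<in> T \<Longrightarrow> capped_cost (u t) \<rho> N (\<lambda>y i. dist y (x i + t *\<^sub>R v i)) \<le> ennreal A) \<Longrightarrow>
      (\<And>i. i \<in> {1..N} \<Longrightarrow> \<bar>measure (u s) (ball (x i + s *\<^sub>R v i) \<rho>) - m i\<bar> \<le> A) \<Longrightarrow>
      (\<forall>t\<in>\<Sigma>b. unbalanced_wasserstein2_sq 1 (u t) (atomic_measure N m (\<lambda>i. x i + t *\<^sub>R v i)) \<le> ennreal (C * A)) \<and>
      (AE \<theta> in H. \<theta> \<in> \<Theta>b \<longrightarrow>
        unbalanced_wasserstein2_sq 1 (\<gamma>s \<theta>) (atomic_measure N m (\<lambda>i. (\<theta> \<bullet> x i, \<theta> \<bullet> v i))) \<le> ennreal (C * A))"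
proof -
  obtain \<theta>0 where \<theta>0: "\<theta>0 \<in> \<Theta>b" using \<Theta>b(2) by blast
  have nrm: "norm \<theta> = 1" if "\<theta> \<in> \<Theta>" for \<theta> using that assms(3) by auto
  have nrm_b: "norm \<theta> = 1" if "\<theta> \<in> \<Theta>b" for \<theta> using that \<Theta>b(1) nrm by blast
  have sep0: "\<sigma> \<le> \<bar>\<theta> \<bullet> (x i + t *\<^sub>R v i) - \<theta> \<bullet> (x j + t *\<^sub>R v j)\<bar>"
    if "\<theta> \<in> \<Theta>b" "t \<in> T \<union> \<Sigma>b" "i \<in> {1..N}" "j \<in> {1..N}" "i \<noteq> j" for \<theta> t i j
    using sep[OF that(1) _ that(2-)] \<sigma>(2) by simp
  have inner_le: "\<bar>\<theta> \<bullet> y - \<theta> \<bullet> c\<bar> \<le> dist y c" if "norm \<theta> = 1" for \<theta> y c :: 'a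
    using Cauchy_Schwarz_ineq2[of \<theta> "y - c"] that by (simp add: dist_norm inner_diff_right)
  have \<tau>0: "0 \<le> \<tau>" using \<tau>[of s] s by force
  have min\<rho>: "min \<rho> \<sigma> = \<rho>" using \<rho> by simp
  define \<rho>2 where "\<rho>2 = \<rho> / (1 + \<tau>)"
  have \<rho>2: "0 < \<rho>2" "\<rho>2 \<le> \<rho>" "(1 + \<tau>) * \<rho>2 = \<rho>" using \<rho>(1) \<tau>0 by (auto simp: \<rho>2_def field_simps)
  \<comment> \<open>The constants come in pairs of cost and mass: \<open>C1\<close>,
    \<open>C2\<close> for the slices, \<open>C3\<close>, \<open>C4\<close> for the projections of
    \<open>u t\<close>, and \<open>C5\<close>, \<open>C6\<close> for \<open>u t\<close>
    itself.\<close>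
  define C1 where "C1 = 4 * (1 + (1 + \<bar>t1\<bar>) / \<bar>t2 - t1\<bar>)\<^sup>2 * card T"
  define C2 where "C2 = 1 + 3 / \<rho>\<^sup>2 + C1 / \<rho>2\<^sup>2"
  define C3 where "C3 = (1 + \<tau>)\<^sup>2 * C1"
  define C4 where "C4 = C2 + (C1 / \<rho>2\<^sup>2 + C3 / \<rho>\<^sup>2)"
  have C0: "0 \<le> C1" "0 \<le> C2" "0 \<le> C3" "0 \<le> C4" using \<tau>0 by (auto simp: C1_def C2_def C3_def C4_def)
  obtain F CF where F: "finite F" "F \<subseteq> \<Theta>b" "0 < CF" and geo:
    "\<And>t y. t \<in> \<Sigma>b \<Longrightarrow> y \<in> \<Omega> \<Longrightarrow> (capped_min \<rho> N (\<lambda>i. dist y (x i + t *\<^sub>R v i)))\<^sup>2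
       \<le> CF * (\<Sum>\<theta>\<in>F. (capped_min \<rho> N (\<lambda>i. \<bar>\<theta> \<bullet> y - \<theta> \<bullet> (x i + t *\<^sub>R v i)\<bar>))\<^sup>2)"
  proof (rule finitely_many_directions[OF assms(1) \<Sigma>b(1) nrm_b \<rho>(1) \<sigma>(1) _ det \<rho>(1) order_refl \<rho>(2)])
    show "\<sigma> \<le> \<bar>\<theta> \<bullet> (x i + t *\<^sub>R v i) - \<theta> \<bullet> (x j + t *\<^sub>R v j)\<bar>"
      if "t \<in> \<Sigma>b" "\<theta> \<in> \<Theta>b" "i \<in> {1..N}" "j \<in> {1..N}" "i \<noteq> j" for t \<theta> i j
      using sep0[of \<theta> t i j] that by simp
  qed (assumption | rule that)+
  define C5 where "C5 = CF * (card F * C3)"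
  define C6 where "C6 = C4 + (C3 / \<rho>\<^sup>2 + C5 / \<rho>\<^sup>2)"
  have C0': "0 \<le> C5" "0 \<le> C6" using C0 F(3) by (auto simp: C5_def C6_def)
  obtain W1 where W1: "0 < W1"
    "\<And>(\<nu> :: 'a measure) z A. finite_measure \<nu> \<Longrightarrow> sets \<nu> = sets borel \<Longrightarrow> 0 \<le> A \<Longrightarrow>
      (\<And>i j. i \<in> {1..N} \<Longrightarrow> j \<in> {1..N} \<Longrightarrow> i \<noteq> j \<Longrightarrow> 2 * \<rho> \<le> dist (z i) (z j)) \<Longrightarrow>
      capped_cost \<nu> \<rho> N (\<lambda>x i. dist x (z i)) \<le> ennreal A \<Longrightarrow>
      (\<And>i. i \<in> {1..N} \<Longrightarrow> \<bar>measure \<nu> (ball (z i) \<rho>) - m i\<bar> \<le> A) \<Longrightarrow>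
      unbalanced_wasserstein2_sq 1 \<nu> (atomic_measure N m z) \<le> ennreal (W1 * A)"
  proof (rule unbalanced_wasserstein2_sq_atomic_measure[of N m \<rho>])
    show "0 < m i" if "i \<in> {1..N}" for i using that by (rule m)
    fix W assume "0 < W"
      and "\<And>(\<nu> :: 'a measure) z A. finite_measure \<nu> \<Longrightarrow> sets \<nu> = sets borel \<Longrightarrow> 0 \<le> A \<Longrightarrow>
      (\<And>i j. i \<in> {1..N} \<Longrightarrow> j \<in> {1..N} \<Longrightarrow> i \<noteq> j \<Longrightarrow> 2 * \<rho> \<le> dist (z i) (z j)) \<Longrightarrow>
      capped_cost \<nu> \<rho> N (\<lambda>x i. dist x (z i)) \<le> ennreal A \<Longrightarrow>
      (\<And>i. i \<in> {1..N} \<Longrightarrow> \<bar>measure \<nu> (ball (z i) \<rho>) - m i\<bar> \<le> A) \<Longrightarrow>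
      unbalanced_wasserstein2_sq 1 \<nu> (atomic_measure N m z) \<le> ennreal (W * A)"
    then show thesis by (rule that)
  qed (rule \<rho>(1))
  \<comment> \<open>In phase space the smaller radius is used, because the atoms of a slice are
    known to be separated by \<open>2 * \<rho>2\<close> only.\<close>
  obtain W2 where W2: "0 < W2"
    "\<And>(\<nu> :: (real \<times> real) measure) z A. finite_measure \<nu> \<Longrightarrow> sets \<nu> = sets borel \<Longrightarrow> 0 \<le> A \<Longrightarrow>
      (\<And>i j. i \<in> {1..N} \<Longrightarrow> j \<in> {1..N} \<Longrightarrow> i \<noteq> j \<Longrightarrow> 2 * \<rho>2 \<le> dist (z i) (z j)) \<Longrightarrow>
      capped_cost \<nu> \<rho>2 N (\<lambda>x i. dist x (z i)) \<le> ennreal A \<Longrightarrow>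
      (\<And>i. i \<in> {1..N} \<Longrightarrow> \<bar>measure \<nu> (ball (z i) \<rho>2) - m i\<bar> \<le> A) \<Longrightarrow>
      unbalanced_wasserstein2_sq 1 \<nu> (atomic_measure N m z) \<le> ennreal (W2 * A)"
  proof (rule unbalanced_wasserstein2_sq_atomic_measure[of N m \<rho>2])
    show "0 < m i" if "i \<in> {1..N}" for i using that by (rule m)
    fix W assume "0 < W"
      and "\<And>(\<nu> :: (real \<times> real) measure) z A. finite_measure \<nu> \<Longrightarrow> sets \<nu> = sets borel \<Longrightarrow> 0 \<le> A \<Longrightarrow>
      (\<And>i j. i \<in> {1..N} \<Longrightarrow> j \<in> {1..N} \<Longrightarrow> i \<noteq> j \<Longrightarrow> 2 * \<rho>2 \<le> dist (z i) (z j)) \<Longrightarrow>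
      capped_cost \<nu> \<rho>2 N (\<lambda>x i. dist x (z i)) \<le> ennreal A \<Longrightarrow>
      (\<And>i. i \<in> {1..N} \<Longrightarrow> \<bar>measure \<nu> (ball (z i) \<rho>2) - m i\<bar> \<le> A) \<Longrightarrow>
      unbalanced_wasserstein2_sq 1 \<nu> (atomic_measure N m z) \<le> ennreal (W * A)"
    then show thesis by (rule that)
  qed (rule \<rho>2(1))
  define C where "C = W1 * (C5 + C6) + W2 * (C1 + C2)"
  have C2pos: "0 < C2" using C0(1) \<rho>(1) by (auto simp: C2_def intro!: add_pos_nonneg)
  show thesis
  proof (rule that)
    show "0 < C" using W1(1) W2(1) C0 C0' C2pos unfolding C_def by (intro add_nonneg_pos mult_pos_pos) auto
    fix u \<gamma>s A
    assume A: "0 \<le> A" and u: "\<And>t. t \<in> \<Sigma> \<Longrightarrow> u t \<in> pos_measures \<Omega>"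
      and \<gamma>s: "\<And>\<theta>. \<gamma>s \<theta> \<in> pos_measures \<Gamma>"
      and AE: "\<And>t. t \<in> \<Sigma> \<Longrightarrow> AE \<theta> in H. Mv t (\<gamma>s \<theta>) = Rd \<theta> (u t)"
      and int: "\<And>t. t \<in> T \<Longrightarrow> capped_cost (u t) \<rho> N (\<lambda>y i. dist y (x i + t *\<^sub>R v i)) \<le> ennreal A"
      and mass: "\<And>i. i \<in> {1..N} \<Longrightarrow> \<bar>measure (u s) (ball (x i + s *\<^sub>R v i) \<rho>) - m i\<bar> \<le> A"
    have uT: "u t \<in> pos_measures \<Omega>" if "t \<in> T" for t using that T(2) u by blast
    have AE\<Theta>: "AE \<theta> in H. \<theta> \<in> \<Theta>"
      by (rule AE_pos_measures[OF H(1) subset_refl compact_imp_closed[OF assms(2)]])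
    \<comment> \<open>Only the finitely many times of \<open>T\<close> are included, since an
      uncountable family of times could exhaust all directions.\<close>
    define good where "good \<theta> \<longleftrightarrow> \<theta> \<in> \<Theta> \<and> (\<forall>t\<in>T. Mv t (\<gamma>s \<theta>) = Rd \<theta> (u t))" for \<theta>
    have AE_good: "AE \<theta> in H. good \<theta>"
    proof -
      have "AE \<theta> in H. \<forall>t\<in>T. Mv t (\<gamma>s \<theta>) = Rd \<theta> (u t)"
        using T AE by (intro AE_finite_allI) auto
      with AE\<Theta> show ?thesis by eventually_elim (simp add: good_def)
    qed
    have slice: "capped_cost (\<gamma>s \<theta>) \<rho> N (\<lambda>p i. dist p (\<theta> \<bullet> x i, \<theta> \<bullet> v i)) \<le> ennreal (C1 * A)"
      "\<And>i. i \<in> {1..N} \<Longrightarrow> \<bar>measure (\<gamma>s \<theta>) (ball (\<theta> \<bullet> x i, \<theta> \<bullet> v i) \<rho>2) - m i\<bar> \<le> C2 * A"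
      if \<theta>: "good \<theta>" "\<theta>' \<in> \<Theta>b" "dist \<theta> \<theta>' < \<eta>" for \<theta> \<theta>'
    proof -
      have g: "finite_measure (\<gamma>s \<theta>)" "sets (\<gamma>s \<theta>) = sets borel" using pos_measuresD[OF \<gamma>s] by auto
      have n: "norm \<theta> = 1" and eq: "\<And>t. t \<in> T \<Longrightarrow> Mv t (\<gamma>s \<theta>) = Rd \<theta> (u t)"
        using \<theta>(1) nrm by (auto simp: good_def)
      have T0: "T \<noteq> {}" using s by blast
      have s\<tau>: "\<bar>s\<bar> \<le> \<tau>" using \<tau> s by blast
      have sep_s: "\<sigma> \<le> \<bar>\<theta> \<bullet> (x i + s *\<^sub>R v i) - \<theta> \<bullet> (x j + s *\<^sub>R v j)\<bar>"
        if "i \<in> {1..N}" "j \<in> {1..N}" "i \<noteq> j" for i j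
        using sep[OF \<theta>(2,3) _ that] s by blast
      have "capped_cost (\<gamma>s \<theta>) (min \<rho> \<sigma>) N (\<lambda>p i. dist p (\<theta> \<bullet> x i, \<theta> \<bullet> v i))
        \<le> ennreal (4 * (1 + (1 + \<bar>t1\<bar>) / \<bar>t2 - t1\<bar>)\<^sup>2 * card T * A)"
      proof (rule slice_bounds(1)[OF T(1) T0 n \<rho>(1) \<sigma>(1) two _ sep_s g uT eq int s s\<tau> A mass \<rho>(1) order_refl \<rho>(2)])
        fix p q a assume "a \<in> T \<rightarrow> {1..N}" "\<And>t. t \<in> T \<Longrightarrow> \<bar>p + t * q - \<theta> \<bullet> (x (a t) + t *\<^sub>R v (a t))\<bar> < \<sigma>"
        then show "\<exists>i\<in>{1..N}. \<forall>t\<in>T. a t = i" by (rule const[OF \<theta>(2,3)])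
      qed
      then show "capped_cost (\<gamma>s \<theta>) \<rho> N (\<lambda>p i. dist p (\<theta> \<bullet> x i, \<theta> \<bullet> v i)) \<le> ennreal (C1 * A)"
        unfolding min\<rho> C1_def .
      fix i assume i: "i \<in> {1..N}"
      show "\<bar>measure (\<gamma>s \<theta>) (ball (\<theta> \<bullet> x i, \<theta> \<bullet> v i) \<rho>2) - m i\<bar> \<le> C2 * A"
        unfolding \<rho>2_def C1_def C2_def
      proof (rule slice_bounds(2)[OF T(1) T0 n \<rho>(1) \<sigma>(1) two _ sep_s g uT eq int s s\<tau> A mass \<rho>(1) order_refl \<rho>(2) i])
        fix p q a assume "a \<in> T \<rightarrow> {1..N}" "\<And>t. t \<in> T \<Longrightarrow> \<bar>p + t * q - \<theta> \<bullet> (x (a t) + t *\<^sub>R v (a t))\<bar> < \<sigma>"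
        then show "\<exists>i\<in>{1..N}. \<forall>t\<in>T. a t = i" by (rule const[OF \<theta>(2,3)])
      qed
    qed
    have "unbalanced_wasserstein2_sq 1 (\<gamma>s \<theta>) (atomic_measure N m (\<lambda>i. (\<theta> \<bullet> x i, \<theta> \<bullet> v i))) \<le> ennreal (C * A)"
      if \<theta>: "good \<theta>" "\<theta> \<in> \<Theta>b" for \<theta>
    proof -
      have near: "dist \<theta> \<theta> < \<eta>" using \<sigma>(2) by simp
      have "unbalanced_wasserstein2_sq 1 (\<gamma>s \<theta>) (atomic_measure N m (\<lambda>i. (\<theta> \<bullet> x i, \<theta> \<bullet> v i)))
        \<le> ennreal (W2 * ((C1 + C2) * A))"
      proof (rule W2(2))
        show "finite_measure (\<gamma>s \<theta>)" "sets (\<gamma>s \<theta>) = sets borel" using pos_measuresD[OF \<gamma>s] by auto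
        show "0 \<le> (C1 + C2) * A" using C0 A by simp
        fix i j assume ij: "i \<in> {1..N}" "j \<in> {1..N}" "i \<noteq> j"
        \<comment> \<open>Particles that are apart at time \<open>s\<close> are apart in phase
          space, up to the Lipschitz constant of moving.\<close>
        have "2 * \<rho> \<le> \<bar>\<theta> \<bullet> (x i + s *\<^sub>R v i) - \<theta> \<bullet> (x j + s *\<^sub>R v j)\<bar>"
          using sep0[OF \<theta>(2) _ ij] s \<rho>(2) by fastforce
        also have "\<dots> \<le> (1 + \<bar>s\<bar>) * dist (\<theta> \<bullet> x i, \<theta> \<bullet> v i) (\<theta> \<bullet> x j, \<theta> \<bullet> v j)"
          using abs_moved_diff_le[of "\<theta> \<bullet> x i" s "\<theta> \<bullet> v i" "\<theta> \<bullet> x j" "\<theta> \<bullet> v j"] by (simp add: inner_add_right)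
        also have "\<dots> \<le> (1 + \<tau>) * dist (\<theta> \<bullet> x i, \<theta> \<bullet> v i) (\<theta> \<bullet> x j, \<theta> \<bullet> v j)"
          using \<tau>[of s] s by (intro mult_right_mono) auto
        finally show "2 * \<rho>2 \<le> dist (\<theta> \<bullet> x i, \<theta> \<bullet> v i) (\<theta> \<bullet> x j, \<theta> \<bullet> v j)"
          using \<tau>0 by (simp add: \<rho>2_def field_simps)
      next
        have "capped_cost (\<gamma>s \<theta>) \<rho>2 N (\<lambda>p i. dist p (\<theta> \<bullet> x i, \<theta> \<bullet> v i))
          \<le> capped_cost (\<gamma>s \<theta>) \<rho> N (\<lambda>p i. dist p (\<theta> \<bullet> x i, \<theta> \<bullet> v i))"
          using \<rho>2 by (intro nn_integral_mono ennreal_leI power_mono capped_min_mono capped_min_nonneg) auto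
        also have "\<dots> \<le> ennreal (C1 * A)" by (rule slice(1)[OF \<theta> near])
        also have "\<dots> \<le> ennreal ((C1 + C2) * A)" using C0 A by (intro ennreal_leI mult_right_mono) auto
        finally show "capped_cost (\<gamma>s \<theta>) \<rho>2 N (\<lambda>p i. dist p (\<theta> \<bullet> x i, \<theta> \<bullet> v i)) \<le> ennreal ((C1 + C2) * A)" .
      next
        fix i assume "i \<in> {1..N}"
        from slice(2)[OF \<theta> near this] show "\<bar>measure (\<gamma>s \<theta>) (ball (\<theta> \<bullet> x i, \<theta> \<bullet> v i) \<rho>2) - m i\<bar> \<le> (C1 + C2) * A"
          using mult_nonneg_nonneg[OF C0(1) A] by (simp add: distrib_right)
      qed
      also have "\<dots> \<le> ennreal (C * A)"
        unfolding mult.assoc[symmetric] C_def using W1(1) C0 C0' A by (intro ennreal_leI mult_right_mono) auto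
      finally show ?thesis .
    qed
    then have part2: "AE \<theta> in H. \<theta> \<in> \<Theta>b \<longrightarrow>
        unbalanced_wasserstein2_sq 1 (\<gamma>s \<theta>) (atomic_measure N m (\<lambda>i. (\<theta> \<bullet> x i, \<theta> \<bullet> v i))) \<le> ennreal (C * A)"
      using AE_good by (auto elim: eventually_mono)
    have part1: "unbalanced_wasserstein2_sq 1 (u t) (atomic_measure N m (\<lambda>i. x i + t *\<^sub>R v i)) \<le> ennreal (C * A)"
      if t: "t \<in> \<Sigma>b" for t
    proof -
      let ?z = "\<lambda>i. x i + t *\<^sub>R v i"
      have t\<Sigma>: "t \<in> \<Sigma>" using t \<Sigma>b(2) by blast
      note ut = u[OF t\<Sigma>] and su = pos_measuresD[OF u[OF t\<Sigma>]]
      have t\<tau>: "\<bar>t\<bar> \<le> \<tau>" using \<tau> t by blast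
      \<comment> \<open>The exceptional set may depend on t here; the bounds do not, because the
        constants were fixed beforehand.\<close>
      have AE_t: "AE \<theta> in H. good \<theta> \<and> Mv t (\<gamma>s \<theta>) = Rd \<theta> (u t)"
        using AE_good AE[OF t\<Sigma>] by eventually_elim simp
      have moved: "capped_cost (u t) \<rho> N (\<lambda>y i. \<bar>\<theta> \<bullet> y - \<theta> \<bullet> ?z i\<bar>) \<le> ennreal (C3 * A)"
        "\<And>i. i \<in> {1..N} \<Longrightarrow> \<bar>measure (u t) {y. \<bar>\<theta> \<bullet> y - \<theta> \<bullet> ?z i\<bar> < \<rho>} - m i\<bar> \<le> C4 * A"
        if \<theta>: "good \<theta>" "Mv t (\<gamma>s \<theta>) = Rd \<theta> (u t)" "\<theta>' \<in> \<Theta>b" "dist \<theta> \<theta>' < \<eta>" for \<theta> \<theta>'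
      proof -
        have g: "finite_measure (\<gamma>s \<theta>)" "sets (\<gamma>s \<theta>) = sets borel" using pos_measuresD[OF \<gamma>s] by auto
        have sep_t: "\<sigma> \<le> \<bar>\<theta> \<bullet> ?z i - \<theta> \<bullet> ?z j\<bar>" if "i \<in> {1..N}" "j \<in> {1..N}" "i \<noteq> j" for i j
          using sep[OF \<theta>(3,4) _ that] t by blast
        have C1A: "0 \<le> C1 * A" using C0 A by simp
        have "capped_cost (u t) \<rho> N (\<lambda>y i. \<bar>\<theta> \<bullet> y - \<theta> \<bullet> ?z i\<bar>) \<le> ennreal ((1 + \<tau>)\<^sup>2 * (C1 * A))"
          by (rule moved_slice_bounds(1)[OF \<rho>(1) sep_t g ut \<theta>(2) slice(1)[OF \<theta>(1,3,4)] t\<tau> C1A slice(2)[OF \<theta>(1,3,4), unfolded \<rho>2_def] \<rho>(1) order_refl \<rho>(2)])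
        then show "capped_cost (u t) \<rho> N (\<lambda>y i. \<bar>\<theta> \<bullet> y - \<theta> \<bullet> ?z i\<bar>) \<le> ennreal (C3 * A)"
          by (simp add: C3_def mult.assoc)
        fix i assume i: "i \<in> {1..N}"
        have "\<bar>measure (u t) {y. \<bar>\<theta> \<bullet> y - \<theta> \<bullet> ?z i\<bar> < \<rho>} - m i\<bar>
          \<le> C2 * A + (C1 * A / (\<rho> / (1 + \<tau>))\<^sup>2 + (1 + \<tau>)\<^sup>2 * (C1 * A) / \<rho>\<^sup>2)"
          by (rule moved_slice_bounds(2)[OF \<rho>(1) sep_t g ut \<theta>(2) slice(1)[OF \<theta>(1,3,4)] t\<tau> C1A slice(2)[OF \<theta>(1,3,4), unfolded \<rho>2_def] \<rho>(1) order_refl \<rho>(2) i])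
        then show "\<bar>measure (u t) {y. \<bar>\<theta> \<bullet> y - \<theta> \<bullet> ?z i\<bar> < \<rho>} - m i\<bar> \<le> C4 * A"
          unfolding C4_def C3_def \<rho>2_def by (simp add: distrib_left mult_ac)
      qed
      have close: "\<exists>\<theta>'. dist \<theta> \<theta>' < \<epsilon> \<and> dist \<theta>' \<theta> < \<eta> \<and> good \<theta>' \<and> Mv t (\<gamma>s \<theta>') = Rd \<theta>' (u t)"
        if \<theta>\<epsilon>: "\<theta> \<in> \<Theta>b" "0 < \<epsilon>" for \<theta> \<epsilon>
      proof -
        have "\<theta> \<in> supp H" using \<theta>\<epsilon>(1) \<Theta>b(1) H(2) by blast
        then obtain \<theta>' where "dist \<theta> \<theta>' < min \<epsilon> \<eta>" "good \<theta>' \<and> Mv t (\<gamma>s \<theta>') = Rd \<theta>' (u t)"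
          using AE_dense_in_supp[OF pos_measuresD(1)[OF H(1)] _ AE_t, of \<theta> "min \<epsilon> \<eta>"] \<theta>\<epsilon>(2) \<sigma>(2) by auto
        then show ?thesis by (intro exI[of _ \<theta>']) (simp add: dist_commute)
      qed
      have lim: "capped_cost (u t) \<rho> N (\<lambda>y i. \<bar>\<theta> \<bullet> y - \<theta> \<bullet> ?z i\<bar>) \<le> ennreal (C3 * A)"
        if \<theta>: "\<theta> \<in> \<Theta>b" for \<theta>
      proof (rule projected_bound_limit[OF assms(1) ut \<rho>(1)])
        fix \<epsilon> :: real assume "0 < \<epsilon>"
        from close[OF \<theta> this] obtain \<theta>' where "dist \<theta> \<theta>' < \<epsilon>" "dist \<theta>' \<theta> < \<eta>" "good \<theta>'" "Mv t (\<gamma>s \<theta>') = Rd \<theta>' (u t)"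
          by blast
        then show "\<exists>\<theta>'. dist \<theta> \<theta>' < \<epsilon> \<and>
          capped_cost (u t) \<rho> N (\<lambda>y i. \<bar>\<theta>' \<bullet> y - \<theta>' \<bullet> ?z i\<bar>) \<le> ennreal (C3 * A)"
          using moved(1)[OF _ _ \<theta>] by blast
      qed
      have meas: "(\<lambda>y. ennreal ((capped_min \<rho> N (\<lambda>i. \<bar>\<theta> \<bullet> y - \<theta> \<bullet> ?z i\<bar>))\<^sup>2)) \<in> borel_measurable (u t)" for \<theta>
      proof -
        have "(\<lambda>y. capped_min \<rho> N (\<lambda>i. \<bar>\<theta> \<bullet> y - \<theta> \<bullet> ?z i\<bar>)) \<in> borel_measurable (u t)"
          unfolding measurable_cong_sets[OF su(1) refl] by (intro capped_min_measurable measurable_abs_inner)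
        then show ?thesis by measurable
      qed
      have "capped_cost (u t) \<rho> N (\<lambda>y i. dist y (?z i))
        \<le> (\<integral>\<^sup>+y. ennreal CF * (\<Sum>\<theta>\<in>F. ennreal ((capped_min \<rho> N (\<lambda>i. \<bar>\<theta> \<bullet> y - \<theta> \<bullet> ?z i\<bar>))\<^sup>2)) \<partial>u t)"
      proof (rule nn_integral_mono_AE)
        show "AE y in u t. ennreal ((capped_min \<rho> N (\<lambda>i. dist y (?z i)))\<^sup>2)
          \<le> ennreal CF * (\<Sum>\<theta>\<in>F. ennreal ((capped_min \<rho> N (\<lambda>i. \<bar>\<theta> \<bullet> y - \<theta> \<bullet> ?z i\<bar>))\<^sup>2))"
          using AE_pos_measures[OF ut subset_refl compact_imp_closed[OF assms(1)]]
        proof eventually_elim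
          case (elim y)
          have "ennreal ((capped_min \<rho> N (\<lambda>i. dist y (?z i)))\<^sup>2)
            \<le> ennreal (CF * (\<Sum>\<theta>\<in>F. (capped_min \<rho> N (\<lambda>i. \<bar>\<theta> \<bullet> y - \<theta> \<bullet> ?z i\<bar>))\<^sup>2))"
            by (rule ennreal_leI[OF geo[OF t elim]])
          also have "\<dots> = ennreal CF * (\<Sum>\<theta>\<in>F. ennreal ((capped_min \<rho> N (\<lambda>i. \<bar>\<theta> \<bullet> y - \<theta> \<bullet> ?z i\<bar>))\<^sup>2))"
            using F(3) by (subst ennreal_mult) (simp_all add: sum_nonneg)
          finally show ?case .
        qed
      qed
      also have "\<dots> = ennreal CF * (\<Sum>\<theta>\<in>F. capped_cost (u t) \<rho> N (\<lambda>y i. \<bar>\<theta> \<bullet> y - \<theta> \<bullet> ?z i\<bar>))"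
        by (subst nn_integral_cmult[OF borel_measurable_sum[OF meas]], subst nn_integral_sum[OF meas]) (rule refl)
      also have "\<dots> \<le> ennreal CF * (\<Sum>\<theta>\<in>F. ennreal (C3 * A))"
        using lim F(2) by (intro mult_left_mono sum_mono) auto
      also have "\<dots> = ennreal (C5 * A)"
        using A C0 F(3) by (simp only: sum_constant C5_def)
          (simp add: ennreal_mult ennreal_of_nat_eq_real_of_nat mult.assoc)
      finally have int_t: "capped_cost (u t) \<rho> N (\<lambda>y i. dist y (?z i)) \<le> ennreal (C5 * A)" .
      \<comment> \<open>Masses of slabs need not depend continuously on the direction, so the mass
        estimate is not passed to the limit. One good direction near \<open>\<theta>0\<close>
        suffices, because the cost of \<open>u t\<close> in space is already controlled.\<close>
      obtain \<theta>1 where \<theta>1: "dist \<theta>1 \<theta>0 < \<eta>" "good \<theta>1" "Mv t (\<gamma>s \<theta>1) = Rd \<theta>1 (u t)"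
        using close[OF \<theta>0, of 1] by auto
      have n1: "norm \<theta>1 = 1" using \<theta>1(2) nrm by (simp add: good_def)
      have mass_t: "\<bar>measure (u t) (ball (?z i) \<rho>) - m i\<bar> \<le> C6 * A" if i: "i \<in> {1..N}" for i
      proof -
        have CA: "0 \<le> C3 * A" "0 \<le> C5 * A" using C0 C0' A by auto
        have "\<bar>measure (u t) {y \<in> space (u t). \<bar>\<theta>1 \<bullet> y - \<theta>1 \<bullet> ?z i\<bar> < \<rho>} - measure (u t) {y \<in> space (u t). dist y (?z i) < \<rho>}\<bar>
          \<le> C3 * A / \<rho>\<^sup>2 + C5 * A / \<rho>\<^sup>2"
        proof (rule measure_capped_min_transfer[OF su(2) _ _ moved(1)[OF \<theta>1(2,3) \<theta>0 \<theta>1(1)] \<rho>(1) order_refl CA(1)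
            int_t \<rho>(1) order_refl CA(2) _ i])
          fix y k j assume kj: "k \<in> {1..N}" "j \<in> {1..N}" "k \<noteq> j" "\<bar>\<theta>1 \<bullet> y - \<theta>1 \<bullet> ?z k\<bar> < \<rho>" "dist y (?z j) < \<rho>"
          have "\<sigma> \<le> \<bar>\<theta>1 \<bullet> ?z k - \<theta>1 \<bullet> ?z j\<bar>" using sep[OF \<theta>0 \<theta>1(1) _ kj(1-3)] t by blast
          then show False using kj(4,5) inner_le[OF n1, of y "?z j"] \<rho>(2) by linarith
        qed (simp_all only: measurable_cong_sets[OF su(1) refl] measurable_dist_const measurable_abs_inner)
        moreover have "{y \<in> space (u t). dist y (?z i) < \<rho>} = ball (?z i) \<rho>" by (auto simp: su(3) dist_commute)
        ultimately have "\<bar>measure (u t) (ball (?z i) \<rho>) - m i\<bar> \<le> C4 * A + (C3 * A / \<rho>\<^sup>2 + C5 * A / \<rho>\<^sup>2)"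
          using moved(2)[OF \<theta>1(2,3) \<theta>0 \<theta>1(1) i] by (simp add: su(3))
        then show ?thesis by (simp add: C6_def algebra_simps)
      qed
      have "unbalanced_wasserstein2_sq 1 (u t) (atomic_measure N m ?z) \<le> ennreal (W1 * ((C5 + C6) * A))"
      proof (rule W1(2)[OF su(2,1)])
        show "0 \<le> (C5 + C6) * A" using C0' A by simp
        fix i j assume ij: "i \<in> {1..N}" "j \<in> {1..N}" "i \<noteq> j"
        show "2 * \<rho> \<le> dist (?z i) (?z j)"
          using sep0[OF \<theta>0 _ ij, of t] t inner_le[OF nrm_b[OF \<theta>0], of "?z i" "?z j"] \<rho>(2) by simp
      next
        show "capped_cost (u t) \<rho> N (\<lambda>y i. dist y (?z i)) \<le> ennreal ((C5 + C6) * A)"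
          using int_t by (rule order_trans) (use C0' A in \<open>intro ennreal_leI mult_right_mono; simp\<close>)
      next
        fix i assume "i \<in> {1..N}"
        from mass_t[OF this] show "\<bar>measure (u t) (ball (?z i) \<rho>) - m i\<bar> \<le> (C5 + C6) * A"
          using mult_nonneg_nonneg[OF C0'(1) A] by (simp add: distrib_right)
      qed
      also have "\<dots> \<le> ennreal (C * A)"
        unfolding mult.assoc[symmetric] C_def using W2(1) C0 C0' A by (intro ennreal_leI mult_right_mono) auto
      finally show ?thesis .
    qed
    show "(\<forall>t\<in>\<Sigma>b. unbalanced_wasserstein2_sq 1 (u t) (atomic_measure N m (\<lambda>i. x i + t *\<^sub>R v i)) \<le> ennreal (C * A)) \<and>
      (AE \<theta> in H. \<theta> \<in> \<Theta>b \<longrightarrow>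
        unbalanced_wasserstein2_sq 1 (\<gamma>s \<theta>) (atomic_measure N m (\<lambda>i. (\<theta> \<bullet> x i, \<theta> \<bullet> v i))) \<le> ennreal (C * A))"
      using part1 part2 by blast
  qed
qed

theorem theorem6:
  fixes \<Omega> :: "(real ^ 'd::finite) set"
    and \<Sigma> \<T> :: "real set"
    and \<Theta> :: "(real ^ 'd) set"
    and H\<Theta> :: "(real ^ 'd) measure"
    and ObS :: "real \<Rightarrow> 'h::{real_inner, complete_space} \<Rightarrow> real ^ 'd \<Rightarrow> real"
    and Ob :: "real \<Rightarrow> ((real ^ 'd) set \<Rightarrow> real) \<Rightarrow> 'h"
    and N :: nat and m :: "nat \<Rightarrow> real" and x v :: "nat \<Rightarrow> real ^ 'd"
    and lam_dag :: "((real ^ 'd) \<times> (real ^ 'd)) measure"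
    and u_dag :: "real \<Rightarrow> (real ^ 'd) measure"
    and \<gamma>_dag :: "real ^ 'd \<Rightarrow> (real \<times> real) measure"
    and f_dag :: "real \<Rightarrow> 'h"
    and \<T>' \<Sigma>b :: "real set"
    and \<Theta>b :: "(real ^ 'd) set"
  assumes "compact \<Omega>" and "compact \<Sigma>"
    and "compact \<Theta>" and "\<Theta> \<subseteq> sphere 0 1"
    and "finite \<T>" and "\<T> \<noteq> {}" and "\<T> \<subseteq> \<Sigma>"
    and "H\<Theta> \<in> pos_measures \<Theta>" and "prob_space H\<Theta>" and "supp H\<Theta> = \<Theta>"
    and "\<And>t. t \<in> \<T> \<Longrightarrow> bounded_linear_to_C \<Omega> (ObS t)"
    and "\<And>t. t \<in> \<T> \<Longrightarrow> is_dual_of \<Omega> (Ob t) (ObS t)"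
    and "\<And>i. i \<in> {1..N} \<Longrightarrow> m i > 0"
    and "inj_on (\<lambda>i. (x i, v i)) {1..N}"
    and "lam_dag = atomic_measure N m (\<lambda>i. (x i, v i))"
    and "lam_dag \<in> pos_measures (phase_domain \<Omega> \<Sigma>)"
    and "\<And>t. u_dag t = Mv t lam_dag"
    and "\<And>\<theta>. \<gamma>_dag \<theta> = Rj \<theta> lam_dag"
    and "\<And>t. f_dag t = Ob t (measure (u_dag t))"
    and "\<T>' \<noteq> {}" and "\<T>' \<subseteq> \<T>"
    and "\<And>t. t \<in> \<T>' \<Longrightarrow> stably_reconstructible \<Omega> (ObS t) (u_dag t)"
    and "compact \<Theta>b" and "\<Theta>b \<subseteq> \<Theta>"
    and "\<And>\<theta>. \<theta> \<in> \<Theta>b \<Longrightarrow> \<not> has_coincidence \<T>' N (\<lambda>i. \<theta> \<bullet> x i) (\<lambda>i. \<theta> \<bullet> v i)"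
    and "\<And>\<theta>. \<theta> \<in> \<Theta>b \<Longrightarrow> \<not> has_ghost \<T>' N (\<lambda>i. \<theta> \<bullet> x i) (\<lambda>i. \<theta> \<bullet> v i)"
    and "compact \<Sigma>b" and "\<Sigma>b \<subseteq> \<Sigma>"
    and "\<And>t \<theta> i j. t \<in> \<Sigma>b \<Longrightarrow> \<theta> \<in> \<Theta>b \<Longrightarrow> i \<in> {1..N} \<Longrightarrow> j \<in> {1..N} \<Longrightarrow> i \<noteq> j \<Longrightarrow>
           \<theta> \<bullet> (x i + t *\<^sub>R v i) \<noteq> \<theta> \<bullet> (x j + t *\<^sub>R v j)"
    and "\<And>t S. t \<in> \<Sigma>b \<Longrightarrow> compact S \<Longrightarrow>
           (\<And>\<theta>. \<theta> \<in> \<Theta>b \<Longrightarrow> (\<lambda>p. \<theta> \<bullet> p) ` S = supp (Rd \<theta> (u_dag t))) \<Longrightarrow>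
           S = supp (u_dag t)"
  shows "\<exists>R>0. \<exists>C>0. \<forall>(f :: real \<Rightarrow> 'h) \<delta> u \<gamma>.
           \<delta> = 1/2 * (\<Sum>t\<in>\<T>. (norm (f t - f_dag t))\<^sup>2) \<longrightarrow> \<delta> > 0 \<longrightarrow>
           is_arg_min (objective \<T> Ob (sqrt \<delta>) f) (feasible \<Omega> \<Sigma> \<Theta> H\<Theta>) (u, \<gamma>) \<longrightarrow>
           (\<forall>t\<in>\<Sigma>b. unbalanced_wasserstein2_sq R (u t) (u_dag t) \<le> ennreal (C * sqrt \<delta>)) \<and>
           (\<forall>\<gamma>s. slices H\<Theta> (proj_domain \<Theta> \<Omega> \<Sigma>) \<gamma> \<gamma>s \<longrightarrow>
              (AE \<theta> in H\<Theta>. \<theta> \<in> \<Theta>b \<longrightarrow>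
                 unbalanced_wasserstein2_sq R (\<gamma>s \<theta>) (\<gamma>_dag \<theta>) \<le> ennreal (C * sqrt \<delta>)))"
proof -
  note Hpos = assms(8) and Hprob = assms(9) and Hsupp = assms(10) and blC = assms(11) and dual = assms(12)
    and mpos = assms(13) and lam = assms(15) and lam_pos = assms(16) and u_dag = assms(17) and \<gamma>_dag = assms(18)
    and f_dag = assms(19) and stab = assms(22) and co = assms(25) and gh = assms(26) and sep = assms(29)
    and uniq = assms(30)
  show ?thesis
  proof (cases "\<Theta>b = {}")
    case True
    \<comment> \<open>Without directions the hypothesis on supports would make every compact set the
      support, so there can be no time either, and both claims are void.\<close>
    have "\<Sigma>b = {}"
    proof (rule ccontr)
      assume "\<Sigma>b \<noteq> {}"
      then obtain t where "t \<in> \<Sigma>b" by blast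
      then have "S = supp (u_dag t)" if "compact S" for S
        using uniq[of t S] that True by blast
      from this[of "{}"] this[of "{0}"] show False by simp
    qed
    with True show ?thesis by (auto intro: exI[of _ 1])
  next
    case False
    then obtain \<theta>0 where \<theta>0: "\<theta>0 \<in> \<Theta>b" by blast
    obtain s where s: "s \<in> \<T>'" using \<open>\<T>' \<noteq> {}\<close> by blast
    define z where "z i t = x i + t *\<^sub>R v i" for i t
    have fin: "finite \<T>'" using \<open>finite \<T>\<close> \<open>\<T>' \<subseteq> \<T>\<close> by (rule finite_subset[rotated])
    have xv: "(x i, v i) \<in> phase_domain \<Omega> \<Sigma>" if "i \<in> {1..N}" for i
      using pos_measures_atomic_measureD[of N m "\<lambda>i. (x i, v i)"] lam_pos mpos that unfolding lam by blast
    have u_dag_eq: "u_dag t = atomic_measure N m (\<lambda>i. z i t)" for t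
      unfolding u_dag lam z_def by (rule Mv_atomic_measure)
    have \<gamma>_dag_eq: "\<gamma>_dag \<theta> = atomic_measure N m (\<lambda>i. (\<theta> \<bullet> x i, \<theta> \<bullet> v i))" for \<theta>
      unfolding \<gamma>_dag lam by (rule Rj_atomic_measure)
    have inner_z: "\<theta> \<bullet> z i t = \<theta> \<bullet> x i + t *\<^sub>R (\<theta> \<bullet> v i)" for \<theta> i t
      by (simp add: z_def inner_add_right)
    \<comment> \<open>At times of \<open>\<Sigma>b\<close> this is assumed; at times of
      \<open>\<T>'\<close> it expresses the absence of coincidences.\<close>
    have distinct: "\<theta> \<bullet> z i t \<noteq> \<theta> \<bullet> z j t"
      if "t \<in> \<T>' \<union> \<Sigma>b" "\<theta> \<in> \<Theta>b" "i \<in> {1..N}" "j \<in> {1..N}" "i \<noteq> j" for t \<theta> i j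
    proof (cases "t \<in> \<Sigma>b")
      case True
      then show ?thesis using sep that unfolding z_def by blast
    next
      case False
      then have "t \<in> \<T>'" using that(1) by blast
      then show ?thesis using co[OF that(2)] that(3-5) unfolding has_coincidence_def inner_z by blast
    qed
    have compS: "compact (\<T>' \<union> \<Sigma>b)" by (rule compact_Un[OF finite_imp_compact[OF fin] \<open>compact \<Sigma>b\<close>])
    obtain \<sigma> \<eta> where \<sigma>: "0 < \<sigma>" "0 < \<eta>" and
      nsep: "\<And>\<theta> \<theta>' t i j. \<theta>' \<in> \<Theta>b \<Longrightarrow> dist \<theta> \<theta>' < \<eta> \<Longrightarrow> t \<in> \<T>' \<union> \<Sigma>b \<Longrightarrow> i \<in> {1..N} \<Longrightarrow> j \<in> {1..N} \<Longrightarrow> i \<noteq> j \<Longrightarrow>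
         \<sigma> \<le> \<bar>\<theta> \<bullet> (x i + t *\<^sub>R v i) - \<theta> \<bullet> (x j + t *\<^sub>R v j)\<bar>" and
      nconst: "\<And>\<theta> \<theta>' p q a. \<theta>' \<in> \<Theta>b \<Longrightarrow> dist \<theta> \<theta>' < \<eta> \<Longrightarrow> a \<in> \<T>' \<rightarrow> {1..N} \<Longrightarrow>
        (\<And>t. t \<in> \<T>' \<Longrightarrow> \<bar>p + t * q - \<theta> \<bullet> (x (a t) + t *\<^sub>R v (a t))\<bar> < \<sigma>) \<Longrightarrow> \<exists>i\<in>{1..N}. \<forall>t\<in>\<T>'. a t = i"
    proof (rule projection_neighbourhood[OF fin \<open>\<T>' \<noteq> {}\<close> compS Un_upper1 \<open>compact \<Theta>b\<close> co gh])
      show "\<theta> \<bullet> (x i + t *\<^sub>R v i) \<noteq> \<theta> \<bullet> (x j + t *\<^sub>R v j)"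
        if "t \<in> \<T>' \<union> \<Sigma>b" "\<theta> \<in> \<Theta>b" "i \<in> {1..N}" "j \<in> {1..N}" "i \<noteq> j" for t \<theta> i j
        using distinct[OF that] by (simp add: z_def)
      fix \<sigma> \<eta> :: real
      assume "0 < \<sigma>" "0 < \<eta>"
        "\<And>\<theta> \<theta>' t i j. \<theta>' \<in> \<Theta>b \<Longrightarrow> dist \<theta> \<theta>' < \<eta> \<Longrightarrow> t \<in> \<T>' \<union> \<Sigma>b \<Longrightarrow> i \<in> {1..N} \<Longrightarrow> j \<in> {1..N} \<Longrightarrow> i \<noteq> j \<Longrightarrow>
           \<sigma> \<le> \<bar>\<theta> \<bullet> (x i + t *\<^sub>R v i) - \<theta> \<bullet> (x j + t *\<^sub>R v j)\<bar>"
        "\<And>\<theta> \<theta>' p q a. \<theta>' \<in> \<Theta>b \<Longrightarrow> dist \<theta> \<theta>' < \<eta> \<Longrightarrow> a \<in> \<T>' \<rightarrow> {1..N} \<Longrightarrow>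
          (\<And>t. t \<in> \<T>' \<Longrightarrow> \<bar>p + t * q - \<theta> \<bullet> (x (a t) + t *\<^sub>R v (a t))\<bar> < \<sigma>) \<Longrightarrow> \<exists>i\<in>{1..N}. \<forall>t\<in>\<T>'. a t = i"
      then show thesis by (rule that)
    qed
    obtain t1 t2 where two: "1 \<le> N \<Longrightarrow> t1 \<in> \<T>' \<and> t2 \<in> \<T>' \<and> t1 \<noteq> t2"
      using two_times_if_no_ghost[OF gh[OF \<theta>0] _ \<open>\<T>' \<noteq> {}\<close>] by blast
    obtain \<tau> where \<tau>: "\<And>t. t \<in> \<T>' \<union> \<Sigma>b \<Longrightarrow> \<bar>t\<bar> \<le> \<tau>"
      using compact_imp_bounded[OF compS] by (auto simp: bounded_iff)
    have nrm0: "norm \<theta>0 = 1" using \<theta>0 \<open>\<Theta>b \<subseteq> \<Theta>\<close> \<open>\<Theta> \<subseteq> sphere 0 1\<close> by auto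
    have zsep: "\<sigma> \<le> dist (z i t) (z j t)"
      if "t \<in> \<T>'" "i \<in> {1..N}" "j \<in> {1..N}" "i \<noteq> j" for t i j
    proof -
      have "\<sigma> \<le> \<bar>\<theta>0 \<bullet> (z i t - z j t)\<bar>"
        using nsep[OF \<theta>0, of \<theta>0 t i j] that \<sigma>(2) by (simp add: z_def inner_diff_right)
      also have "\<dots> \<le> norm \<theta>0 * norm (z i t - z j t)" by (rule Cauchy_Schwarz_ineq2)
      finally show ?thesis by (simp add: nrm0 dist_norm)
    qed
    \<comment> \<open>A point that no direction tells from the atoms could be added to the support
      without changing any projection, contrary to unique determination.\<close>
    have det: "\<exists>\<theta>\<in>\<Theta>b. \<forall>i\<in>{1..N}. \<theta> \<bullet> y \<noteq> \<theta> \<bullet> (x i + t *\<^sub>R v i)"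
      if t: "t \<in> \<Sigma>b" and y: "y \<notin> (\<lambda>i. x i + t *\<^sub>R v i) ` {1..N}" for t y
    proof (rule ccontr)
      assume no: "\<not> (\<exists>\<theta>\<in>\<Theta>b. \<forall>i\<in>{1..N}. \<theta> \<bullet> y \<noteq> \<theta> \<bullet> (x i + t *\<^sub>R v i))"
      let ?Z = "(\<lambda>i. z i t) ` {1..N}"
      have "insert y ?Z = supp (u_dag t)"
      proof (rule uniq[OF t])
        show "compact (insert y ?Z)" by (intro finite_imp_compact) simp
        fix \<theta> assume "\<theta> \<in> \<Theta>b"
        then have "\<theta> \<bullet> y \<in> (\<lambda>p. \<theta> \<bullet> p) ` ?Z" using no by (auto simp: z_def)
        then have "(\<lambda>p. \<theta> \<bullet> p) ` insert y ?Z = (\<lambda>i. \<theta> \<bullet> z i t) ` {1..N}" by auto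
        also have "\<dots> = supp (Rd \<theta> (u_dag t))"
          unfolding u_dag_eq Rd_atomic_measure by (rule supp_atomic_measure[symmetric]) (rule mpos)
        finally show "(\<lambda>p. \<theta> \<bullet> p) ` insert y ?Z = supp (Rd \<theta> (u_dag t))" .
      qed
      also have "\<dots> = ?Z" unfolding u_dag_eq by (rule supp_atomic_measure) (rule mpos)
      finally show False using y by (auto simp: z_def)
    qed
    \<comment> \<open>Abbreviates the conclusion of \<open>stably_reconstructible_bounds\<close>
      with \<rho> and K still open: the radii \<open>R t\<close> of all times must be known before a
      common \<rho> can be chosen, and K only exists for a given \<rho>.\<close>
    define bnd where "bnd t R \<rho> K \<longleftrightarrow> (\<forall>u\<in>pos_measures \<Omega>. \<forall>k\<ge>0.
        norm (Ob t (measure u) - Ob t (measure (u_dag t))) \<le> k \<longrightarrow>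
        measure u UNIV \<le> measure (u_dag t) UNIV + k \<longrightarrow>
        capped_cost u R N (\<lambda>y i. dist y (z i t)) \<le> ennreal (K * k) \<and>
        (\<forall>i\<in>{1..N}. \<bar>measure u (ball (z i t) \<rho>) - m i\<bar> \<le> K * k))" for t R \<rho> K
    have "\<forall>t\<in>\<T>'. \<exists>h R. 0 < R \<and> (\<lambda>x. - ObS t h x) \<in> tv_subdifferential \<Omega> (measure (u_dag t)) \<and>
      (\<forall>\<rho>. 0 < \<rho> \<longrightarrow> \<rho> \<le> R \<longrightarrow> 2 * \<rho> \<le> \<sigma> \<longrightarrow> (\<exists>K>0. bnd t R \<rho> K))"
    proof
      fix t assume t: "t \<in> \<T>'"
      then have tT: "t \<in> \<T>" using \<open>\<T>' \<subseteq> \<T>\<close> by blast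
      have inj: "inj_on (\<lambda>i. z i t) {1..N}"
      proof (rule inj_onI, rule ccontr)
        fix i j assume "i \<in> {1..N}" "j \<in> {1..N}" "z i t = z j t" "i \<noteq> j"
        then show False using distinct[of t \<theta>0 i j] t \<theta>0 by simp
      qed
      show "\<exists>h R. 0 < R \<and> (\<lambda>x. - ObS t h x) \<in> tv_subdifferential \<Omega> (measure (u_dag t)) \<and>
        (\<forall>\<rho>. 0 < \<rho> \<longrightarrow> \<rho> \<le> R \<longrightarrow> 2 * \<rho> \<le> \<sigma> \<longrightarrow> (\<exists>K>0. bnd t R \<rho> K))"
      proof (rule stably_reconstructible_bounds[OF \<open>compact \<Omega>\<close> blC[OF tT] dual[OF tT] stab[OF t] _ inj u_dag_eq])
        show "0 < m i" if "i \<in> {1..N}" for i using that by (rule mpos)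
        fix h R
        assume hR: "0 < R" "(\<lambda>x. - ObS t h x) \<in> tv_subdifferential \<Omega> (measure (u_dag t))"
          and K: "\<And>\<rho>. 0 < \<rho> \<Longrightarrow> \<rho> \<le> R \<Longrightarrow>
            (\<And>i j. i \<in> {1..N} \<Longrightarrow> j \<in> {1..N} \<Longrightarrow> i \<noteq> j \<Longrightarrow> 2 * \<rho> \<le> dist (z i t) (z j t)) \<Longrightarrow>
            \<exists>K>0. \<forall>u\<in>pos_measures \<Omega>. \<forall>k\<ge>0. norm (Ob t (measure u) - Ob t (measure (u_dag t))) \<le> k \<longrightarrow>
              measure u UNIV \<le> measure (u_dag t) UNIV + k \<longrightarrow>
              capped_cost u R N (\<lambda>y i. dist y (z i t)) \<le> ennreal (K * k) \<and>
              (\<forall>i\<in>{1..N}. \<bar>measure u (ball (z i t) \<rho>) - m i\<bar> \<le> K * k)"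
        have "\<exists>K>0. bnd t R \<rho> K" if \<rho>: "0 < \<rho>" "\<rho> \<le> R" "2 * \<rho> \<le> \<sigma>" for \<rho>
          unfolding bnd_def
        proof (rule K[OF \<rho>(1,2)])
          fix i j assume "i \<in> {1..N}" "j \<in> {1..N}" "i \<noteq> j"
          from zsep[OF t this] show "2 * \<rho> \<le> dist (z i t) (z j t)" using \<rho>(3) by linarith
        qed
        with hR show ?thesis by blast
      qed
    qed
    then obtain h R where R0: "\<And>t. t \<in> \<T>' \<Longrightarrow> 0 < R t"
      and h: "\<And>t. t \<in> \<T>' \<Longrightarrow> (\<lambda>x. - ObS t (h t) x) \<in> tv_subdifferential \<Omega> (measure (u_dag t))"
      and RK: "\<And>t \<rho>. t \<in> \<T>' \<Longrightarrow> 0 < \<rho> \<Longrightarrow> \<rho> \<le> R t \<Longrightarrow> 2 * \<rho> \<le> \<sigma> \<Longrightarrow> \<exists>K>0. bnd t (R t) \<rho> K"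
      by metis
    have "\<exists>r>0. \<forall>t\<in>\<T>'. r \<le> R t"
      by (rule finite_uniform_pos[OF fin]) (use R0 in auto)
    then obtain r where r: "0 < r" "\<And>t. t \<in> \<T>' \<Longrightarrow> r \<le> R t" by blast
    \<comment> \<open>Below all certificate radii, so that the costs with cap \<open>R t\<close>
      dominate those with cap \<rho>, and at most half the separation, so that the balls about the
      atoms are disjoint.\<close>
    define \<rho> where "\<rho> = min r (\<sigma> / 2)"
    have \<rho>: "0 < \<rho>" "2 * \<rho> \<le> \<sigma>" "\<And>t. t \<in> \<T>' \<Longrightarrow> \<rho> \<le> R t"
      using r \<sigma>(1) by (auto simp: \<rho>_def intro: min.coboundedI1)
    have "\<exists>K>0. bnd t (R t) \<rho> K" if "t \<in> \<T>'" for t by (rule RK[OF that \<rho>(1) \<rho>(3)[OF that] \<rho>(2)])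
    then obtain K where K0: "\<And>t. t \<in> \<T>' \<Longrightarrow> 0 < K t" and K: "\<And>t. t \<in> \<T>' \<Longrightarrow> bnd t (R t) \<rho> (K t)"
      by metis
    define K' where "K' = (\<Sum>t\<in>\<T>'. K t)"
    have K': "K t \<le> K'" if "t \<in> \<T>'" for t
      unfolding K'_def using that fin K0 by (intro member_le_sum) (auto simp: less_imp_le)
    have K'0: "0 < K'" using K'[OF s] K0[OF s] by simp
    define a where "a = 6 * norm (h s) + 4"
    have a: "0 < a" by (simp add: a_def add_nonneg_pos)
    have T'\<Sigma>: "\<T>' \<subseteq> \<Sigma>" using \<open>\<T>' \<subseteq> \<T>\<close> \<open>\<T> \<subseteq> \<Sigma>\<close> by blast
    show ?thesis
    proof (rule reconstruction_bounds[OF \<open>compact \<Omega>\<close> \<open>compact \<Theta>\<close> \<open>\<Theta> \<subseteq> sphere 0 1\<close> Hpos Hsupp fin T'\<Sigma>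
          \<open>\<Theta>b \<subseteq> \<Theta>\<close> False \<open>compact \<Sigma>b\<close> \<open>\<Sigma>b \<subseteq> \<Sigma>\<close> \<sigma> _ _ two \<tau> det _ s \<rho>(1,2)])
      show "\<sigma> \<le> \<bar>\<theta> \<bullet> (x i + t *\<^sub>R v i) - \<theta> \<bullet> (x j + t *\<^sub>R v j)\<bar>"
        if "\<theta>' \<in> \<Theta>b" "dist \<theta> \<theta>' < \<eta>" "t \<in> \<T>' \<union> \<Sigma>b" "i \<in> {1..N}" "j \<in> {1..N}" "i \<noteq> j" for \<theta> \<theta>' t i j
        using that by (rule nsep)
      show "\<exists>i\<in>{1..N}. \<forall>t\<in>\<T>'. a t = i"
        if "\<theta>' \<in> \<Theta>b" "dist \<theta> \<theta>' < \<eta>" "a \<in> \<T>' \<rightarrow> {1..N}"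
          "\<And>t. t \<in> \<T>' \<Longrightarrow> \<bar>p + t * q - \<theta> \<bullet> (x (a t) + t *\<^sub>R v (a t))\<bar> < \<sigma>" for \<theta> \<theta>' p q a
        using that by (rule nconst)
      show "0 < m i" if "i \<in> {1..N}" for i using that by (rule mpos)
      fix C
      assume C: "0 < C" and bounds:
        "\<And>u \<gamma>s A. 0 \<le> A \<Longrightarrow> (\<And>t. t \<in> \<Sigma> \<Longrightarrow> u t \<in> pos_measures \<Omega>) \<Longrightarrow>
          (\<And>\<theta>. \<gamma>s \<theta> \<in> pos_measures (proj_domain \<Theta> \<Omega> \<Sigma>)) \<Longrightarrow>
          (\<And>t. t \<in> \<Sigma> \<Longrightarrow> AE \<theta> in H\<Theta>. Mv t (\<gamma>s \<theta>) = Rd \<theta> (u t)) \<Longrightarrow>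
          (\<And>t. t \<in> \<T>' \<Longrightarrow> capped_cost (u t) \<rho> N (\<lambda>y i. dist y (x i + t *\<^sub>R v i)) \<le> ennreal A) \<Longrightarrow>
          (\<And>i. i \<in> {1..N} \<Longrightarrow> \<bar>measure (u s) (ball (x i + s *\<^sub>R v i) \<rho>) - m i\<bar> \<le> A) \<Longrightarrow>
          (\<forall>t\<in>\<Sigma>b. unbalanced_wasserstein2_sq 1 (u t) (atomic_measure N m (\<lambda>i. x i + t *\<^sub>R v i)) \<le> ennreal (C * A)) \<and>
          (AE \<theta> in H\<Theta>. \<theta> \<in> \<Theta>b \<longrightarrow>
            unbalanced_wasserstein2_sq 1 (\<gamma>s \<theta>) (atomic_measure N m (\<lambda>i. (\<theta> \<bullet> x i, \<theta> \<bullet> v i))) \<le> ennreal (C * A))"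
      show ?thesis
      \<comment> \<open>The constant is a composition: \<open>a\<close> turns
        \<open>sqrt \<delta>\<close> into a bound of the discrepancy, \<open>K'\<close> turns this
        into the two estimates at the times of \<open>\<T>'\<close>, and \<open>C\<close> turns
        those into the divergence.\<close>
      proof (rule exI[of _ 1], intro conjI zero_less_one, rule exI[of _ "C * K' * a"], intro conjI allI impI)
        show "0 < C * K' * a" using C K'0 a by simp
        fix f :: "real \<Rightarrow> 'h" and \<delta> u \<gamma>
        assume \<delta>: "\<delta> = 1/2 * (\<Sum>t\<in>\<T>. (norm (f t - f_dag t))\<^sup>2)" "\<delta> > 0"
          and min: "is_arg_min (objective \<T> Ob (sqrt \<delta>) f) (feasible \<Omega> \<Sigma> \<Theta> H\<Theta>) (u, \<gamma>)"
        define k where "k = a * sqrt \<delta>"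
        have k: "0 \<le> k" using a \<delta>(2) by (simp add: k_def)
        have sT: "s \<in> \<T>" using s \<open>\<T>' \<subseteq> \<T>\<close> by blast
        have feas: "feasible \<Omega> \<Sigma> \<Theta> H\<Theta> (u, \<gamma>)" using min by (simp add: is_arg_min_def)
        then obtain \<gamma>1 where up: "\<And>t. t \<in> \<Sigma> \<Longrightarrow> u t \<in> pos_measures \<Omega>"
          and \<gamma>p: "\<gamma> \<in> pos_measures (\<Theta> \<times> proj_domain \<Theta> \<Omega> \<Sigma>)"
          and \<gamma>1: "slices H\<Theta> (proj_domain \<Theta> \<Omega> \<Sigma>) \<gamma> \<gamma>1"
          and AE1: "\<And>t. t \<in> \<Sigma> \<Longrightarrow> AE \<theta> in H\<Theta>. Mv t (\<gamma>1 \<theta>) = Rd \<theta> (u t)"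
          by (auto simp: feasible_def)
        have hs: "(\<lambda>x. - ObS s (h s) x) \<in> tv_subdifferential \<Omega> (measure (Mv s (atomic_measure N m (\<lambda>i. (x i, v i)))))"
          using h[OF s] by (simp add: u_dag lam)
        have \<delta>': "\<delta> = 1/2 * (\<Sum>t\<in>\<T>. (norm (f t - Ob t (measure (Mv t (atomic_measure N m (\<lambda>i. (x i, v i)))))))\<^sup>2)"
          using \<delta>(1) by (simp add: f_dag u_dag lam)
        have disc: "norm (Ob t (measure (u t)) - Ob t (measure (u_dag t))) \<le> k"
          "measure (u t) UNIV \<le> measure (u_dag t) UNIV + k" if t: "t \<in> \<T>" for t
          unfolding k_def a_def u_dag lam
          by (rule minimizer_discrepancy[where \<Sigma> = \<Sigma> and ObS = ObS, OF \<open>compact \<Omega>\<close> \<open>compact \<Theta>\<close> Hpos Hprob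
                \<open>finite \<T>\<close> \<open>\<T> \<subseteq> \<Sigma>\<close> blC[OF sT] dual[OF sT] mpos xv sT hs \<delta>' \<delta>(2) min t]; assumption)+
        have A: "0 \<le> K' * k" using K'0 k by simp
        have small: "capped_cost (u t) \<rho> N (\<lambda>y i. dist y (x i + t *\<^sub>R v i)) \<le> ennreal (K' * k)"
          "\<And>i. i \<in> {1..N} \<Longrightarrow> \<bar>measure (u t) (ball (x i + t *\<^sub>R v i) \<rho>) - m i\<bar> \<le> K' * k"
          if t: "t \<in> \<T>'" for t
        proof -
          have tT: "t \<in> \<T>" "t \<in> \<Sigma>" using t T'\<Sigma> \<open>\<T>' \<subseteq> \<T>\<close> by auto
          note * = K[OF t, unfolded bnd_def, rule_format, OF up[OF tT(2)] k disc[OF tT(1)]]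
          have KK: "K t * k \<le> K' * k" using K'[OF t] k by (rule mult_right_mono)
          have "capped_cost (u t) \<rho> N (\<lambda>y i. dist y (z i t))
            \<le> capped_cost (u t) (R t) N (\<lambda>y i. dist y (z i t))"
            using \<rho>(1) \<rho>(3)[OF t]
            by (intro nn_integral_mono ennreal_leI power_mono capped_min_mono capped_min_nonneg) auto
          also have "\<dots> \<le> ennreal (K t * k)" using * by blast
          also have "\<dots> \<le> ennreal (K' * k)" using KK by (rule ennreal_leI)
          finally show "capped_cost (u t) \<rho> N (\<lambda>y i. dist y (x i + t *\<^sub>R v i)) \<le> ennreal (K' * k)"
            by (simp add: z_def)
          fix i assume "i \<in> {1..N}"
          then have "\<bar>measure (u t) (ball (z i t) \<rho>) - m i\<bar> \<le> K t * k" using * by blast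
          then show "\<bar>measure (u t) (ball (x i + t *\<^sub>R v i) \<rho>) - m i\<bar> \<le> K' * k" using KK by (simp add: z_def)
        qed
        have \<gamma>1p: "\<gamma>1 \<theta> \<in> pos_measures (proj_domain \<Theta> \<Omega> \<Sigma>)" for \<theta> using \<gamma>1 by (simp add: slices_def)
        have CA: "C * (K' * k) = C * K' * a * sqrt \<delta>" by (simp add: k_def mult_ac)
        have result: "\<forall>t\<in>\<Sigma>b. unbalanced_wasserstein2_sq 1 (u t) (u_dag t) \<le> ennreal (C * K' * a * sqrt \<delta>)"
          "AE \<theta> in H\<Theta>. \<theta> \<in> \<Theta>b \<longrightarrow> unbalanced_wasserstein2_sq 1 (\<gamma>1 \<theta>) (\<gamma>_dag \<theta>) \<le> ennreal (C * K' * a * sqrt \<delta>)"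
          using bounds[of "K' * k" u \<gamma>1, OF A up \<gamma>1p AE1 small(1) small(2)[OF s]]
          unfolding u_dag_eq \<gamma>_dag_eq z_def CA by blast+
        show "\<forall>t\<in>\<Sigma>b. unbalanced_wasserstein2_sq 1 (u t) (u_dag t) \<le> ennreal (C * K' * a * sqrt \<delta>)"
          by (rule result(1))
        fix \<gamma>s assume "slices H\<Theta> (proj_domain \<Theta> \<Omega> \<Sigma>) \<gamma> \<gamma>s"
        \<comment> \<open>The estimate was obtained for the disintegration that feasibility
          provides; uniqueness carries it over to an arbitrary one.\<close>
        then have "AE \<theta> in H\<Theta>. \<gamma>1 \<theta> = \<gamma>s \<theta>"
          using slices_AE_eq[OF Hpos \<gamma>1 _ pos_measuresD(2)[OF \<gamma>p]] by blast
        with result(2) show "AE \<theta> in H\<Theta>. \<theta> \<in> \<Theta>b \<longrightarrow>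
          unbalanced_wasserstein2_sq 1 (\<gamma>s \<theta>) (\<gamma>_dag \<theta>) \<le> ennreal (C * K' * a * sqrt \<delta>)"
          by eventually_elim simp
      qed
    qed
  qed
qed

end
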